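(* Let $m\ge 2$ and $n\geq 1$ be (finite) integers. (1) There is no complex-linear isometric embedding $\mathcal S_3^m\to\mathcal S_1^n$. (2) For every $q>2$ and $0<p<1$, there is no complex-linear isometric embedding $\mathcal S_q^m\to\mathcal S_p^n$. (3) For every $0<p<1$, including every $p=1/k$ with integer $k\ge2$, neither $\mathcal S_1^m$ nor $\mathcal S_\infty^m$ admits a complex-linear isometric embedding into $\mathcal S_p^n$. (4) If $\mathcal H,\mathcal K$ are complex Hilbert spaces with $\dim\mathcal H\ge 2$, then $\mathcal S_q(\mathcal H)$ does not embed complex-linearly isometrically into $\mathcal S_p(\mathcal K)$ for $2<q\le\infty$ and $0<p<1$, or for $2<q<4$ and $p=1$.
   Context: For a complex Hilbert space $\mathcal H$ and $0<p<\infty$, $\mathcal S_p(\mathcal H)$ is the space of compact operators $A$ on $\mathcal H$ with $\sum_j s_j(A)^p<\infty$, where $s_j(A)$ are the singular values of $A$ counted with multiplicity, equipped with the (quasi-)norm $\|A\|_p=(\sum_j s_j(A)^p)^{1/p}$. $\mathcal S_\infty(\mathcal H)$ is the space of compact operators with the operator norm. $\mathcal S_p^n=\mathcal S_p(\mathbb C^n)$. A complex-linear isometric embedding is a complex-linear map $T$ with $\|Tx\|=\|x\|$ for all $x$ (with respect to the given (quasi-)norms). *)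

theory Defs
  imports "HOL-Analysis.Analysis"
begin

text \<open>
  A complex Hilbert space is a complete real inner product space with a compatible complex
  scalar multiplication and a complex inner product (linear in the first argument) whose
  real part is the underlying real inner product; completeness and the norm are inherited.
\<close>

class complex_hilbert = real_inner + complete_space +
  fixes scaleC :: "complex \<Rightarrow> 'a \<Rightarrow> 'a"
    and cinner :: "'a \<Rightarrow> 'a \<Rightarrow> complex"
  assumes scaleC_add_right: "scaleC a (x + y) = scaleC a x + scaleC a y"
    and scaleC_add_left: "scaleC (a + b) x = scaleC a x + scaleC b x"
    and scaleC_scaleC: "scaleC a (scaleC b x) = scaleC (a * b) x"
    and scaleC_of_real: "scaleC (complex_of_real r) x = scaleR r x"
    and cinner_commute: "cinner x y = cnj (cinner y x)"
    and cinner_add_left: "cinner (x + y) z = cinner x z + cinner y z"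
    and cinner_scaleC_left: "cinner (scaleC a x) y = a * cinner x y"
    and Re_cinner: "Re (cinner x y) = inner x y"

global_interpretation complex_vector:
  vector_space "scaleC :: complex \<Rightarrow> 'a \<Rightarrow> 'a::complex_hilbert"
proof
  show "scaleC 1 x = x" for x :: 'a
    using scaleC_of_real[of 1 x] by simp
qed (simp_all add: scaleC_add_right scaleC_add_left scaleC_scaleC)

instantiation complex :: complex_hilbert
begin

definition scaleC_complex :: "complex \<Rightarrow> complex \<Rightarrow> complex" where
  "scaleC_complex a x = a * x"

definition cinner_complex :: "complex \<Rightarrow> complex \<Rightarrow> complex" where
  "cinner_complex x y = x * cnj y"

instance
  by standard
    (simp_all add: scaleC_complex_def cinner_complex_def inner_complex_def
      algebra_simps scaleR_conv_of_real)

end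

instantiation vec :: (complex_hilbert, finite) complex_hilbert
begin

definition scaleC_vec :: "complex \<Rightarrow> 'a ^ 'b \<Rightarrow> 'a ^ 'b" where
  "scaleC_vec a x = (\<chi> i. scaleC a (x $ i))"

definition cinner_vec :: "'a ^ 'b \<Rightarrow> 'a ^ 'b \<Rightarrow> complex" where
  "cinner_vec x y = (\<Sum>i\<in>UNIV. cinner (x $ i) (y $ i))"

instance
proof
  fix x y :: "'a ^ 'b"
  show "cinner x y = cnj (cinner y x)"
    unfolding cinner_vec_def cnj_sum by (intro sum.cong refl cinner_commute)
qed (simp_all add: scaleC_vec_def cinner_vec_def inner_vec_def vec_eq_iff
      scaleC_add_right scaleC_add_left scaleC_scaleC scaleC_of_real cinner_add_left
      cinner_scaleC_left Re_cinner sum.distrib sum_distrib_left)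

end

definition compact_operator :: "('h::complex_hilbert \<Rightarrow> 'h) \<Rightarrow> bool" where
  "compact_operator A \<longleftrightarrow>
     Vector_Spaces.linear scaleC scaleC A \<and> compact (closure (A ` cball 0 1))"

definition hilbert_adjoint :: "('h::complex_hilbert \<Rightarrow> 'h) \<Rightarrow> 'h \<Rightarrow> 'h" where
  "hilbert_adjoint A = (SOME B. \<forall>x y. cinner (A x) y = cinner x (B y))"

text \<open>
  The multiplicity of \<open>\<sigma>\<close> as a singular value of \<open>A\<close> is the complex dimension of the
  \<open>\<sigma>\<^sup>2\<close>-eigenspace of \<open>A\<^sup>* A\<close>; it is \<open>0\<close> iff \<open>\<sigma>\<close> is not a singular value.
  The underlying \<open>dim\<close> is also \<open>0\<close> for infinite-dimensional spaces, but for compact \<open>A\<close>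
  and \<open>\<sigma> > 0\<close> the eigenspace is finite-dimensional.
\<close>

definition singular_value_mult :: "('h::complex_hilbert \<Rightarrow> 'h) \<Rightarrow> real \<Rightarrow> nat" where
  "singular_value_mult A \<sigma> =
     complex_vector.dim {x. hilbert_adjoint A (A x) = scaleC (complex_of_real (\<sigma>\<^sup>2)) x}"

text \<open>
  Sums over the singular values counted with multiplicity are written as sums over
  \<open>\<sigma> > 0\<close> weighted by the multiplicity; the singular value \<open>0\<close> contributes nothing.
  The exponent ranges over \<open>0 < p \<le> \<infinity>\<close>.
\<close>

definition schatten_class :: "ereal \<Rightarrow> ('h::complex_hilbert \<Rightarrow> 'h) set" where
  "schatten_class p =
     {A. compact_operator A \<and>
         (p \<noteq> \<infinity> \<longrightarrow>
           (\<lambda>\<sigma>. real (singular_value_mult A \<sigma>) * \<sigma> powr real_of_ereal p) summable_on {0<..})}"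

definition schatten_norm :: "ereal \<Rightarrow> ('h::complex_hilbert \<Rightarrow> 'h) \<Rightarrow> real" where
  "schatten_norm p A =
     (if p = \<infinity> then onorm A
      else (\<Sum>\<^sub>\<infinity>\<sigma>\<in>{0<..}. real (singular_value_mult A \<sigma>) * \<sigma> powr real_of_ereal p)
             powr (1 / real_of_ereal p))"

text \<open>Only the values of \<open>T\<close> on \<open>schatten_class q\<close> are constrained.\<close>

definition schatten_isometric_embedding ::
    "ereal \<Rightarrow> ereal \<Rightarrow>
     (('h::complex_hilbert \<Rightarrow> 'h) \<Rightarrow> ('k::complex_hilbert \<Rightarrow> 'k)) \<Rightarrow> bool" where
  "schatten_isometric_embedding q p T \<longleftrightarrow>
     (\<forall>A\<in>schatten_class q. T A \<in> schatten_class p) \<and>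
     (\<forall>A\<in>schatten_class q. \<forall>B\<in>schatten_class q.
        T (\<lambda>x. A x + B x) = (\<lambda>y. T A y + T B y)) \<and>
     (\<forall>c. \<forall>A\<in>schatten_class q. T (\<lambda>x. scaleC c (A x)) = (\<lambda>y. scaleC c (T A y))) \<and>
     (\<forall>A\<in>schatten_class q. schatten_norm p (T A) = schatten_norm q A)"

end

theory Submission
  imports Defs "HOL-Complex_Analysis.Conformal_Mappings" "Jordan_Normal_Form.Determinant"
begin

text \<open>
  All parts are obstructions for the two-dimensional space of diagonal operators: an embedding
  \<open>T\<close> gives \<open>A\<close>, \<open>B\<close> with \<open>\<bar>A + t B\<bar>\<^sub>p\<close> equal to \<open>(1 + \<bar>t\<bar>\<^sup>q)\<close> to the power \<open>1/q\<close> for all complex \<open>t\<close>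
  in the unit disc. Products of the largest singular values of \<open>A + t B\<close> dominate minors, which are
  polynomials in \<open>t\<close>, so the \<open>p\<close>-th Schatten sum behaves like a subharmonic function of \<open>t\<close>.

  If \<open>q > 2\<close>, strict convexity in the logarithm of the singular values yields growth of order
  \<open>\<bar>t\<bar>\<^sup>2\<close> on small circles, whereas the norm grows only like \<open>\<bar>t\<bar>\<^sup>q\<close>.

  If \<open>q = 1\<close>, \<open>p < 1\<close> and the target has finite dimension, the singular values have leading terms
  \<open>\<kappa> \<bar>t\<bar>\<^sup>k\<close> with integers \<open>k\<close>. The singular values that survive at \<open>t = 0\<close> contribute no term of first order
  on average, so those vanishing at \<open>0\<close> contribute at least \<open>p \<bar>t\<bar>\<close>; by the maximum principle the sum
  of all leading terms, at least \<open>1 + p \<bar>t\<bar>\<close>, is bounded by \<open>(1 + \<bar>t\<bar>)\<close> to the power \<open>p\<close>,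
  which is strictly smaller.
\<close>

section \<open>Orthonormal families in a complex Hilbert space\<close>

text \<open>The norm along the line depends on \<bar>t\<bar> only, so it is enough to bound the
  Schatten sum from below at one unspecified point of each circle. This is why the maximum principle
  can stand in for mean values: no integral is formed, and all quantities that must be controlled at
  the same point enter one holomorphic product. Schatten sums are written with the squares
  \<open>l\<close> of the singular values and the exponent \<open>p / 2\<close>. For
  \<open>p < 2\<close>, which includes \<open>p = 1\<close>, the power is concave, and a small
  multiple of \<open>x\<close> can be subtracted without losing convexity in \<open>ln x\<close>;
  the sum of the \<open>x\<close> is a trace and can be computed. In infinite dimension only
  finitely many singular values are used: a finite part of the Schatten sum of \<open>A\<close>, and
  for \<open>A + t B\<close> the fact that finitely many terms stay below the whole sum. For
  \<open>q = 1\<close> the norm itself grows linearly, so quadratic growth contradicts nothing. The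
  comparison of leading terms needed there relies on finite dimension of the target.\<close>

lemma cinner_add_right: "cinner x (y + z) = cinner x y + cinner x (z::'a::complex_hilbert)"
  by (metis cinner_add_left cinner_commute complex_cnj_add)

lemma cinner_scaleC_right: "cinner x (scaleC a y) = cnj a * cinner x (y::'a::complex_hilbert)"
  by (metis cinner_scaleC_left cinner_commute complex_cnj_mult)

lemma scaleC_one [simp]: "scaleC 1 x = (x::'a::complex_hilbert)"
  using scaleC_of_real[of 1 x] by simp

lemma scaleC_zero_left [simp]: "scaleC 0 x = (0::'a::complex_hilbert)"
  using scaleC_of_real[of 0 x] by simp

lemma scaleC_zero_right [simp]: "scaleC a (0::'a::complex_hilbert) = 0"
  by (rule complex_vector.scale_zero_right)

lemma cinner_zero_left [simp]: "cinner 0 (y::'a::complex_hilbert) = 0"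
  using cinner_add_left[of 0 0 y] by simp

lemma cinner_zero_right [simp]: "cinner (x::'a::complex_hilbert) 0 = 0"
  using cinner_add_right[of x 0 0] by simp

lemma cinner_minus_left [simp]: "cinner (- x) (y::'a::complex_hilbert) = - cinner x y"
  using cinner_add_left[of x "-x" y] by (simp add: add_eq_0_iff)

lemma cinner_minus_right [simp]: "cinner x (- y::'a::complex_hilbert) = - cinner x y"
  using cinner_add_right[of x y "-y"] by (simp add: add_eq_0_iff)

lemma cinner_diff_left: "cinner (x - y) (z::'a::complex_hilbert) = cinner x z - cinner y z"
  using cinner_add_left[of x "-y" z] by simp

lemma cinner_diff_right: "cinner x (y - z::'a::complex_hilbert) = cinner x y - cinner x z"
  using cinner_add_right[of x y "-z"] by simp

lemma cinner_sum_left: "cinner (\<Sum>i\<in>I. f i) (y::'a::complex_hilbert) = (\<Sum>i\<in>I. cinner (f i) y)"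
  by (induction I rule: infinite_finite_induct) (auto simp: cinner_add_left)

lemma cinner_sum_right: "cinner (y::'a::complex_hilbert) (\<Sum>i\<in>I. f i) = (\<Sum>i\<in>I. cinner y (f i))"
  by (induction I rule: infinite_finite_induct) (auto simp: cinner_add_right)

lemmas cinner_simps = cinner_add_left cinner_add_right cinner_diff_left cinner_diff_right
  cinner_scaleC_left cinner_scaleC_right

lemma cinner_self: "cinner x x = complex_of_real ((norm (x::'a::complex_hilbert))\<^sup>2)"
proof -
  have "cinner x x = cnj (cinner x x)" by (rule cinner_commute)
  then have "Im (cinner x x) = 0" by (metis complex_cnj_cancel_iff Reals_cnj_iff complex_is_Real_iff)
  then show ?thesis
    by (simp add: complex_eq_iff Re_cinner power2_norm_eq_inner)
qed

lemma cinner_self_eq_zero [simp]: "cinner x x = 0 \<longleftrightarrow> (x::'a::complex_hilbert) = 0"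
  by (simp add: cinner_self)

lemma norm_scaleC: "norm (scaleC a (x::'a::complex_hilbert)) = cmod a * norm x"
proof -
  have "complex_of_real ((norm (scaleC a x))\<^sup>2) = a * cnj a * complex_of_real ((norm x)\<^sup>2)"
    by (simp only: cinner_self[symmetric] cinner_scaleC_left cinner_scaleC_right mult_ac)
  also have "\<dots> = complex_of_real ((cmod a * norm x)\<^sup>2)"
    by (simp only: complex_norm_square[symmetric] power_mult_distrib of_real_mult)
  finally have "(norm (scaleC a x))\<^sup>2 = (cmod a * norm x)\<^sup>2"
    using of_real_eq_iff by blast
  then show ?thesis by (simp add: power2_eq_iff_nonneg)
qed

text \<open>Rotating \<open>x\<close> by a unit scalar makes the complex inner product real and
  nonnegative; the real Cauchy-Schwarz inequality then applies to its real part.\<close>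

lemma norm_cinner_le: "cmod (cinner x y) \<le> norm (x::'a::complex_hilbert) * norm y"
proof (cases "cinner x y = 0")
  case False
  define u where "u = cnj (cinner x y) / cmod (cinner x y)"
  have u: "cmod u = 1" using False by (simp add: u_def norm_divide)
  have "cinner (scaleC u x) y = (cinner x y * cnj (cinner x y)) / cmod (cinner x y)"
    by (simp add: u_def cinner_scaleC_left)
  also have "\<dots> = complex_of_real (cmod (cinner x y))"
    using False by (simp only: complex_norm_square[symmetric]) (simp add: power2_eq_square)
  finally have "cinner (scaleC u x) y = complex_of_real (cmod (cinner x y))" .
  then have "cmod (cinner x y) = Re (cinner (scaleC u x) y)" by simp
  also have "\<dots> \<le> norm (scaleC u x) * norm y"
    unfolding Re_cinner by (rule norm_cauchy_schwarz)
  finally show ?thesis by (simp add: norm_scaleC u)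
qed simp

lemma cmod_cinner_commute: "cmod (cinner x y) = cmod (cinner y (x::'a::complex_hilbert))"
  by (metis cinner_commute complex_mod_cnj)

lemma bounded_bilinear_cinner:
  "bounded_bilinear (cinner :: 'a::complex_hilbert \<Rightarrow> 'a \<Rightarrow> complex)"
proof
  fix r :: real and a b :: 'a
  show "cinner (r *\<^sub>R a) b = r *\<^sub>R cinner a b"
    by (metis cinner_scaleC_left scaleC_of_real scaleR_conv_of_real)
  show "cinner a (r *\<^sub>R b) = r *\<^sub>R cinner a b"
    by (metis cinner_scaleC_right complex_cnj_complex_of_real scaleC_of_real scaleR_conv_of_real)
  show "\<exists>K. \<forall>a b::'a. norm (cinner a b) \<le> norm a * norm b * K"
    by (rule exI[of _ 1]) (simp add: norm_cinner_le)
qed (simp_all add: cinner_add_left cinner_add_right)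

lemma bounded_bilinear_scaleC:
  "bounded_bilinear (scaleC :: complex \<Rightarrow> 'a::complex_hilbert \<Rightarrow> 'a)"
proof
  fix r :: real and a :: complex and b :: 'a
  show "scaleC (r *\<^sub>R a) b = r *\<^sub>R scaleC a b"
    by (metis scaleC_of_real scaleC_scaleC scaleR_conv_of_real)
  show "scaleC a (r *\<^sub>R b) = r *\<^sub>R scaleC a b"
    by (metis mult.commute scaleC_of_real scaleC_scaleC)
  show "\<exists>K. \<forall>(a::complex) (b::'a). norm (scaleC a b) \<le> norm a * norm b * K"
    by (rule exI[of _ 1]) (simp add: norm_scaleC)
qed (simp_all add: scaleC_add_left scaleC_add_right)

lemmas tendsto_cinner = bounded_bilinear.tendsto[OF bounded_bilinear_cinner]

lemma cinner_eqI: "(\<And>z. cinner z x = cinner z y) \<Longrightarrow> x = (y::'a::complex_hilbert)"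
  by (metis cinner_diff_right cinner_self_eq_zero eq_iff_diff_eq_0)

definition orthonormal :: "nat \<Rightarrow> (nat \<Rightarrow> 'a::complex_hilbert) \<Rightarrow> bool" where
  "orthonormal n v \<longleftrightarrow> (\<forall>i<n. \<forall>j<n. cinner (v i) (v j) = (if i = j then 1 else 0))"

definition proj :: "nat \<Rightarrow> (nat \<Rightarrow> 'a::complex_hilbert) \<Rightarrow> 'a \<Rightarrow> 'a" where
  "proj n v x = (\<Sum>i<n. scaleC (cinner x (v i)) (v i))"

lemma orthonormal_norm: "orthonormal n v \<Longrightarrow> i < n \<Longrightarrow> norm (v i) = 1"
proof -
  assume "orthonormal n v" "i < n"
  then have "cinner (v i) (v i) = 1" by (simp add: orthonormal_def)
  then have "(norm (v i))\<^sup>2 = 1"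
    by (metis cinner_self of_real_eq_1_iff)
  then show ?thesis using norm_ge_zero[of "v i"] unfolding power2_eq_1_iff by linarith
qed

lemma orthonormal_mono: "orthonormal n v \<Longrightarrow> m \<le> n \<Longrightarrow> orthonormal m v"
  by (simp add: orthonormal_def)

lemma cinner_orthonormal_sum_left:
  assumes "orthonormal n v" "j < n"
  shows "cinner (\<Sum>i<n. scaleC (c i) (v i)) (v j) = c j"
proof -
  have "cinner (\<Sum>i<n. scaleC (c i) (v i)) (v j) = (\<Sum>i<n. if i = j then c i else 0)"
    unfolding cinner_sum_left using assms
    by (intro sum.cong) (auto simp: cinner_scaleC_left orthonormal_def)
  also have "\<dots> = c j" using assms(2) by simp
  finally show ?thesis .
qed

lemma cinner_proj: "orthonormal n v \<Longrightarrow> j < n \<Longrightarrow> cinner (proj n v x) (v j) = cinner x (v j)"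
  unfolding proj_def by (rule cinner_orthonormal_sum_left)

lemma norm_orthonormal_sum:
  assumes "orthonormal n v"
  shows "(norm (\<Sum>i<n. scaleC (c i) (v i)))\<^sup>2 = (\<Sum>i<n. (cmod (c i))\<^sup>2)"
proof -
  let ?s = "\<Sum>i<n. scaleC (c i) (v i)"
  have "complex_of_real ((norm ?s)\<^sup>2) = (\<Sum>j<n. cnj (c j) * cinner ?s (v j))"
    by (simp only: cinner_self[symmetric] cinner_sum_right cinner_scaleC_right)
  also have "\<dots> = (\<Sum>j<n. cnj (c j) * c j)"
    using assms by (intro sum.cong) (auto simp: cinner_orthonormal_sum_left)
  also have "\<dots> = complex_of_real (\<Sum>i<n. (cmod (c i))\<^sup>2)"
    by (simp only: of_real_sum complex_norm_square mult.commute)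
  finally show ?thesis using of_real_eq_iff by blast
qed

lemma norm_proj: "orthonormal n v \<Longrightarrow> (norm (proj n v x))\<^sup>2 = (\<Sum>i<n. (cmod (cinner x (v i)))\<^sup>2)"
  unfolding proj_def by (rule norm_orthonormal_sum)

lemma norm_minus_proj:
  assumes "orthonormal n v"
  shows "(norm (x - proj n v x))\<^sup>2 = (norm x)\<^sup>2 - (\<Sum>i<n. (cmod (cinner x (v i)))\<^sup>2)"
proof -
  have "cinner (x - proj n v x) (proj n v x) = 0"
    by (subst (2) proj_def)
      (simp add: cinner_sum_right cinner_scaleC_right cinner_diff_left cinner_proj[OF assms])
  then have "inner (x - proj n v x) (proj n v x) = 0" by (metis Re_cinner zero_complex.simps(1))
  then have "(norm (x - proj n v x))\<^sup>2 = (norm x)\<^sup>2 - (norm (proj n v x))\<^sup>2"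
    by (simp add: power2_norm_eq_inner inner_diff_left inner_diff_right inner_commute)
  then show ?thesis by (simp add: norm_proj[OF assms])
qed

lemma bessel:
  assumes "orthonormal n v"
  shows "(\<Sum>i<n. (cmod (cinner x (v i)))\<^sup>2) \<le> (norm x)\<^sup>2"
  using norm_minus_proj[OF assms, of x] zero_le_power2[of "norm (x - proj n v x)"] by linarith

text \<open>The equation \<open>proj n v x = x\<close> serves throughout as "\<open>x\<close> lies
  in the span of \<open>v 0\<close>, ..., \<open>v (n - 1)\<close>". Equality in Bessel's inequality
  turns it into an equation between numbers that can be summed and compared.\<close>

lemma proj_eq_iff:
  assumes "orthonormal n v"
  shows "proj n v x = x \<longleftrightarrow> (\<Sum>i<n. (cmod (cinner x (v i)))\<^sup>2) = (norm x)\<^sup>2"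
  using norm_minus_proj[OF assms, of x] by auto

lemma proj_member: "orthonormal n v \<Longrightarrow> i < n \<Longrightarrow> proj n v (v i) = v i"
proof -
  assume o: "orthonormal n v" and i: "i < n"
  have "proj n v (v i) = (\<Sum>j<n. scaleC (if j = i then 1 else 0) (v j))"
    unfolding proj_def using o i by (intro sum.cong) (auto simp: orthonormal_def)
  also have "\<dots> = (\<Sum>j<n. if j = i then v j else 0)" by (intro sum.cong) auto
  also have "\<dots> = v i" using i by simp
  finally show ?thesis .
qed

lemma proj_add: "proj n v (x + y) = proj n v x + proj n v y"
  by (simp add: proj_def cinner_add_left scaleC_add_left sum.distrib)

lemma proj_scaleC: "proj n v (scaleC a x) = scaleC a (proj n v x)"
  by (simp add: proj_def cinner_scaleC_left complex_vector.scale_sum_right scaleC_scaleC)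

lemma proj_sum: "proj n v (\<Sum>i\<in>I. f i) = (\<Sum>i\<in>I. proj n v (f i))"
  by (induction I rule: infinite_finite_induct) (auto simp: proj_add, auto simp: proj_def)

lemma proj_idem: "orthonormal n v \<Longrightarrow> proj n v (proj n v x) = proj n v x"
  by (subst (2 3) proj_def) (simp add: proj_sum proj_scaleC proj_member)

lemma cinner_proj_right: "cinner x (proj n v y) = cinner (proj n v x) y"
  unfolding proj_def cinner_sum_left cinner_sum_right cinner_scaleC_left cinner_scaleC_right
  by (intro sum.cong refl) (metis cinner_commute mult.commute)

lemma orthonormal_extend:
  assumes "orthonormal n v" "norm y = 1" "\<And>i. i < n \<Longrightarrow> cinner y (v i) = 0"
  shows "orthonormal (Suc n) (v(n := y))"
proof -
  have "cinner y y = 1" using assms(2) by (simp add: cinner_self)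
  moreover have "cinner (v i) y = 0" if "i < n" for i
    using assms(3)[OF that] by (subst cinner_commute) simp
  ultimately show ?thesis using assms by (auto simp: orthonormal_def less_Suc_eq)
qed

text \<open>One Gram-Schmidt step: the normalised residual of \<open>x\<close> is adjoined, after
  which \<open>x\<close> lies in the span.\<close>

lemma orthonormal_extend_residual:
  assumes "orthonormal n v" "proj n v x \<noteq> x"
  obtains y where "norm y = 1" "\<And>i. i < n \<Longrightarrow> cinner y (v i) = 0"
    "y = scaleC (complex_of_real (1 / norm (x - proj n v x))) (x - proj n v x)"
    "orthonormal (Suc n) (v(n := y))" "proj (Suc n) (v(n := y)) x = x"
proof -
  define z where "z = x - proj n v x"
  define y where "y = scaleC (complex_of_real (1 / norm z)) z"
  have z: "z \<noteq> 0" using assms(2) by (simp add: z_def)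
  have zi: "cinner z (v i) = 0" if "i < n" for i
    by (simp add: z_def cinner_diff_left cinner_proj[OF assms(1) that])
  have y1: "norm y = 1" using z by (simp add: y_def norm_scaleC norm_divide)
  have yi: "cinner y (v i) = 0" if "i < n" for i
    using zi[OF that] by (simp add: y_def cinner_scaleC_left)
  have o: "orthonormal (Suc n) (v(n := y))" by (rule orthonormal_extend[OF assms(1) y1 yi])
  have pzz: "cinner (proj n v x) z = 0"
    by (subst cinner_commute, subst proj_def)
      (simp add: cinner_sum_right cinner_scaleC_right zi)
  have "cinner x z = cinner z z"
    using pzz by (simp add: z_def cinner_diff_left cinner_diff_right)
  then have "scaleC (cinner x y) y = scaleC (complex_of_real (norm z)^2 / norm z / norm z) z"
    using z by (simp add: y_def cinner_scaleC_right cinner_self scaleC_scaleC power2_eq_square)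
  also have "\<dots> = z" using z by (simp add: power2_eq_square)
  finally have "proj (Suc n) (v(n := y)) x = proj n v x + z"
    by (simp add: proj_def)
  then have "proj (Suc n) (v(n := y)) x = x" by (simp add: z_def)
  with y1 yi o show thesis by (intro that[of y]) (auto simp: y_def z_def)
qed

text \<open>Double counting: the sum of all \<bar>\<open>cinner (v i) (w j)\<close>\<bar> squared
  equals \<open>n\<close> when summed over \<open>j\<close> first, and is at most \<open>m\<close>
  by Bessel when summed over \<open>i\<close> first. It plays the role of the exchange lemma for
  dimensions.\<close>

lemma orthonormal_card_le:
  assumes "orthonormal n v" "orthonormal m w" "\<And>i. i < n \<Longrightarrow> proj m w (v i) = v i"
  shows "n \<le> m"
proof -
  have "real n = (\<Sum>i<n. (norm (v i))\<^sup>2)" using orthonormal_norm[OF assms(1)] by simp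
  also have "\<dots> = (\<Sum>i<n. \<Sum>j<m. (cmod (cinner (v i) (w j)))\<^sup>2)"
    using assms(3) proj_eq_iff[OF assms(2)] by (intro sum.cong) auto
  also have "\<dots> = (\<Sum>j<m. \<Sum>i<n. (cmod (cinner (w j) (v i)))\<^sup>2)"
    by (subst sum.swap, intro sum.cong refl arg_cong[where f = "\<lambda>x. x\<^sup>2"] cmod_cinner_commute)
  also have "\<dots> \<le> (\<Sum>j<m. (norm (w j))\<^sup>2)" by (intro sum_mono bessel assms)
  also have "\<dots> = real m" using orthonormal_norm[OF assms(2)] by simp
  finally show ?thesis by simp
qed

text \<open>The same double count with equal cardinalities forces equality in Bessel's inequality
  for every \<open>v i\<close>.\<close>

lemma orthonormal_proj_eq:
  assumes "orthonormal n v" "orthonormal n w" "\<And>i. i < n \<Longrightarrow> proj n v (w i) = w i" "i < n"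
  shows "proj n w (v i) = v i"
proof -
  have "(\<Sum>i<n. (norm (v i - proj n w (v i)))\<^sup>2)
      = (\<Sum>i<n. (norm (v i))\<^sup>2) - (\<Sum>i<n. \<Sum>j<n. (cmod (cinner (v i) (w j)))\<^sup>2)"
    by (simp add: norm_minus_proj[OF assms(2)] sum_subtractf)
  also have "(\<Sum>i<n. \<Sum>j<n. (cmod (cinner (v i) (w j)))\<^sup>2) = (\<Sum>j<n. \<Sum>i<n. (cmod (cinner (w j) (v i)))\<^sup>2)"
    by (subst sum.swap, intro sum.cong refl arg_cong[where f = "\<lambda>x. x\<^sup>2"] cmod_cinner_commute)
  also have "\<dots> = (\<Sum>j<n. (norm (w j))\<^sup>2)"
    using assms(3) proj_eq_iff[OF assms(1)] by (intro sum.cong) auto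
  also have "(\<Sum>i<n. (norm (v i))\<^sup>2) - \<dots> = 0"
    using orthonormal_norm[OF assms(1)] orthonormal_norm[OF assms(2)] by simp
  finally have "\<forall>i\<in>{..<n}. (norm (v i - proj n w (v i)))\<^sup>2 = 0"
    by (subst (asm) sum_nonneg_eq_0_iff) auto
  then show ?thesis using assms(4) by auto
qed

lemma cinner_parseval:
  assumes "proj n v x = x"
  shows "cinner x y = (\<Sum>i<n. cinner x (v i) * cinner (v i) y)"
proof -
  have "cinner x y = cinner (proj n v x) y" using assms by simp
  then show ?thesis by (simp add: proj_def cinner_sum_left cinner_scaleC_left)
qed

section \<open>Singular systems of compact operators\<close>

text \<open>The representing vector is the minimiser of
  \<open>J x = (norm x)\<^sup>2 - 2 * f x\<close>. The parallelogram law makes a minimising sequence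
  Cauchy, and vanishing of the first variation at the limit is the claim.\<close>

lemma riesz_representation_real:
  fixes f :: "'a::{real_inner,complete_space} \<Rightarrow> real"
  assumes "linear f" and C: "\<And>x. \<bar>f x\<bar> \<le> C * norm x"
  shows "\<exists>y. \<forall>x. f x = inner x y"
proof -
  have bl: "bounded_linear f"
    using assms by (intro bounded_linear_intro[of f C]) (auto simp: linear_add linear_scale mult.commute)
  define J where "J x = (norm x)\<^sup>2 - 2 * f x" for x
  define m where "m = Inf (range J)"
  have J_lower: "J x \<ge> - C\<^sup>2" for x
  proof -
    have "0 \<le> (norm x - C)\<^sup>2" by simp
    then show ?thesis using C[of x] unfolding J_def by (simp add: power2_eq_square algebra_simps)
  qed
  have bdd: "bdd_below (range J)" using J_lower by (intro bdd_belowI[of _ "- C\<^sup>2"]) auto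
  have m_le: "m \<le> J x" for x unfolding m_def by (rule cInf_lower) (auto intro: bdd)
  have "\<exists>x. J x < m + 1 / real (Suc n)" for n
  proof -
    have "m < m + 1 / real (Suc n)" by simp
    then obtain z where "z \<in> range J" "z < m + 1 / real (Suc n)"
      unfolding m_def using cInf_lessD[of "range J"] by (metis empty_not_UNIV image_is_empty)
    then show ?thesis by auto
  qed
  then obtain X where X: "\<And>n. J (X n) < m + 1 / real (Suc n)" by metis
  have par: "(norm (x - y))\<^sup>2 / 4 \<le> (J x + J y) / 2 - m" for x y
  proof -
    have "J ((1/2) *\<^sub>R (x + y)) = (norm x)\<^sup>2 / 4 + (norm y)\<^sup>2 / 4 + inner x y / 2 - f x - f y"
      using assms(1)
      by (simp add: J_def power2_norm_eq_inner inner_add_left inner_add_right linear_add linear_scale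
          inner_commute field_simps)
    moreover have "(norm (x - y))\<^sup>2 = (norm x)\<^sup>2 + (norm y)\<^sup>2 - 2 * inner x y"
      by (simp add: power2_norm_eq_inner inner_diff_left inner_diff_right inner_commute)
    ultimately have "(norm (x - y))\<^sup>2 / 4 = (J x + J y) / 2 - J ((1/2) *\<^sub>R (x + y))"
      by (simp add: J_def field_simps)
    then show ?thesis using m_le by simp
  qed
  have aux: "p < d" if "p \<le> (a + b) / 2 - m" "a < m + d" "b < m + d" for p a b d :: real
    using that by argo
  have "Cauchy X"
  proof (rule CauchyI)
    fix e :: real assume e: "0 < e"
    obtain N :: nat where N: "4 / e\<^sup>2 < real N" using reals_Archimedean2 by blast
    show "\<exists>M. \<forall>m\<ge>M. \<forall>n\<ge>M. norm (X m - X n) < e"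
    proof (intro exI[of _ N] allI impI)
      fix i j assume ij: "i \<ge> N" "j \<ge> N"
      have le: "1 / real (Suc k) \<le> 1 / real (Suc N)" if "k \<ge> N" for k
        using that by (simp add: frac_le)
      have "(norm (X i - X j))\<^sup>2 / 4 < 1 / real (Suc N)"
        using aux[OF par[of "X i" "X j"]] less_le_trans[OF X[of i] add_left_mono[OF le[OF ij(1)]]]
          less_le_trans[OF X[of j] add_left_mono[OF le[OF ij(2)]]] by blast
      then have "(norm (X i - X j))\<^sup>2 < 4 / real (Suc N)" by simp
      also have "\<dots> < e\<^sup>2"
      proof -
        have "4 < real N * e\<^sup>2" using N e by (simp add: divide_less_eq)
        also have "\<dots> \<le> real (Suc N) * e\<^sup>2" by (intro mult_right_mono) auto
        finally show ?thesis by (simp add: divide_less_eq mult.commute del: of_nat_Suc)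
      qed
      finally show "norm (X i - X j) < e" using e by (meson less_eq_real_def power_less_imp_less_base)
    qed
  qed
  then obtain y where y: "X \<longlonglongrightarrow> y" by (auto simp: Cauchy_convergent_iff convergent_def)
  have "(\<lambda>n. J (X n)) \<longlonglongrightarrow> J y"
    unfolding J_def by (intro tendsto_intros y bounded_linear.tendsto[OF bl])
  moreover have "(\<lambda>n. m + 1 / real (Suc n)) \<longlonglongrightarrow> m + 0"
    by (intro tendsto_intros LIMSEQ_Suc[OF lim_1_over_n])
  ultimately have "J y \<le> m + 0"
    by (rule LIMSEQ_le) (use X less_imp_le in blast)
  then have Jy: "J y \<le> J x" for x using m_le[of x] by simp
  have "f x = inner x y" for x
  proof -
    define d where "d = inner x y - f x"
    \<comment> \<open>This \<open>s\<close> minimises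
      \<open>s\<^sup>2 * ((norm x)\<^sup>2 + 1) + 2 * s * d\<close>; the added \<open>1\<close>
      keeps the denominator positive also for \<open>x = 0\<close>.\<close>
    define s where "s = - d / ((norm x)\<^sup>2 + 1)"
    have pos: "(norm x)\<^sup>2 + 1 > 0" by (simp add: add_nonneg_pos)
    have "J (y + s *\<^sub>R x) = J y + s\<^sup>2 * (norm x)\<^sup>2 + 2 * s * d"
      using assms(1) by (simp add: J_def d_def power2_norm_eq_inner inner_add_left inner_add_right
          linear_add linear_scale inner_commute power2_eq_square[of s] algebra_simps)
    then have "0 \<le> s\<^sup>2 * (norm x)\<^sup>2 + 2 * s * d" using Jy[of "y + s *\<^sub>R x"] by simp
    also have "\<dots> \<le> s\<^sup>2 * ((norm x)\<^sup>2 + 1) + 2 * s * d" by (simp add: mult_left_mono)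
    also have "\<dots> = - d\<^sup>2 / ((norm x)\<^sup>2 + 1)"
      using pos unfolding s_def by (simp add: divide_simps) (simp add: power2_eq_square algebra_simps)
    finally have "d\<^sup>2 \<le> 0" using pos by (simp add: field_simps)
    then show ?thesis by (simp add: d_def)
  qed
  then show ?thesis by blast
qed

abbreviation clinear :: "('a::complex_hilbert \<Rightarrow> 'b::complex_hilbert) \<Rightarrow> bool" where
  "clinear \<equiv> Vector_Spaces.linear scaleC scaleC"

lemma clinearI:
  assumes "\<And>x y. A (x + y) = A x + A y" "\<And>c x. A (scaleC c x) = scaleC c (A x)"
  shows "clinear A"
  unfolding Vector_Spaces.linear_iff
  by (intro conjI allI assms complex_vector.vector_space_axioms)

lemma clinear_add: "clinear A \<Longrightarrow> A (x + y) = A x + A y"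
  and clinear_scaleC: "clinear A \<Longrightarrow> A (scaleC c x) = scaleC c (A x)"
  by (simp_all add: Vector_Spaces.linear_iff)

lemma clinear_zero: "clinear A \<Longrightarrow> A 0 = 0"
  using clinear_scaleC[of A 0 0] by simp

lemma clinear_diff: "clinear A \<Longrightarrow> A (x - y) = A x - A y"
  using clinear_add[of A "x - y" y] by simp

lemma clinear_sum: "clinear A \<Longrightarrow> A (\<Sum>i\<in>I. f i) = (\<Sum>i\<in>I. A (f i))"
  by (induction I rule: infinite_finite_induct) (auto simp: clinear_add clinear_zero)

lemma adjoint_exists:
  fixes A :: "'a::complex_hilbert \<Rightarrow> 'a"
  assumes A: "clinear A" and C: "\<And>x. norm (A x) \<le> C * norm x"
  shows "\<exists>B. \<forall>x y. cinner (A x) y = cinner x (B y)"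
proof -
  have "\<exists>z. \<forall>x. cinner (A x) y = cinner x z" for y
  proof -
    let ?f = "\<lambda>x. Re (cinner (A x) y)"
    have "linear ?f"
    proof
      fix r :: real and b :: 'a
      show "?f (r *\<^sub>R b) = r *\<^sub>R ?f b"
        by (simp add: scaleC_of_real[symmetric] clinear_scaleC[OF A] cinner_scaleC_left)
    qed (simp add: clinear_add[OF A] cinner_add_left)
    moreover have "\<bar>?f x\<bar> \<le> (C * norm y) * norm x" for x
    proof -
      have "\<bar>?f x\<bar> \<le> norm (A x) * norm y"
        using norm_cinner_le[of "A x" y] abs_Re_le_cmod order_trans by blast
      also have "\<dots> \<le> C * norm x * norm y" by (simp add: C mult_right_mono)
      finally show ?thesis by (simp add: mult_ac)
    qed
    ultimately obtain z where z: "\<And>x. ?f x = inner x z"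
      using riesz_representation_real by blast
    have "cinner (A x) y = cinner x z" for x
    proof (rule complex_eqI)
      show "Re (cinner (A x) y) = Re (cinner x z)" using z by (simp add: Re_cinner)
      \<comment> \<open>Complex linearity recovers the imaginary part from the real one, by testing
        with \<i> times \<open>x\<close>.\<close>
      show "Im (cinner (A x) y) = Im (cinner x z)"
        using z[of "scaleC \<i> x"]
        by (simp add: Re_cinner[symmetric] clinear_scaleC[OF A] cinner_scaleC_left)
    qed
    then show ?thesis by blast
  qed
  then show ?thesis by metis
qed

section \<open>Compact operators: boundedness, adjoints, linear combinations\<close>

lemma compact_operator_bounded:
  assumes "compact_operator A"
  obtains C where "C > 0" "\<And>x. norm (A x) \<le> C * norm x"
proof -
  have A: "clinear A" using assms by (simp add: compact_operator_def)
  have "bounded (A ` cball 0 1)"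
    using assms compact_imp_bounded bounded_subset closure_subset unfolding compact_operator_def by metis
  then obtain C where C: "C > 0" "\<And>x. norm x \<le> 1 \<Longrightarrow> norm (A x) \<le> C"
    by (auto simp: bounded_pos)
  have "norm (A x) \<le> C * norm x" for x
  proof (cases "x = 0")
    case False
    define u where "u = scaleC (complex_of_real (1 / norm x)) x"
    have "norm u \<le> 1" using False by (simp add: u_def norm_scaleC norm_divide)
    then have "norm (A u) \<le> C" by (rule C)
    then show ?thesis using False
      by (simp add: u_def clinear_scaleC[OF A] norm_scaleC norm_divide field_simps)
  qed (simp add: clinear_zero[OF A])
  with C show thesis using that by blast
qed

lemma compact_operator_clinear: "compact_operator A \<Longrightarrow> clinear A"
  by (simp add: compact_operator_def)

lemma cinner_hilbert_adjoint:
  assumes "compact_operator A"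
  shows "cinner (A x) y = cinner x (hilbert_adjoint A y)"
proof -
  obtain C where "\<And>x. norm (A x) \<le> C * norm x" using compact_operator_bounded[OF assms] by blast
  then have "\<exists>B. \<forall>x y. cinner (A x) y = cinner x (B y)"
    using adjoint_exists compact_operator_clinear[OF assms] by blast
  from someI_ex[OF this] show ?thesis unfolding hilbert_adjoint_def by blast
qed

lemma hilbert_adjoint_unique:
  assumes "\<And>x y. cinner (A x) y = cinner x (B y)"
  shows "hilbert_adjoint A = B"
proof -
  have "\<exists>B. \<forall>x y. cinner (A x) y = cinner x (B y)" by (intro exI[of _ B] allI assms)
  from someI_ex[OF this] have h: "cinner (A x) y = cinner x (hilbert_adjoint A y)" for x y
    unfolding hilbert_adjoint_def by blast
  show ?thesis
    proof (rule ext, rule cinner_eqI)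
    show "cinner z (hilbert_adjoint A y) = cinner z (B y)" for y z
      using h[of z y] assms[of z y] by simp
  qed
qed

lemma clinear_hilbert_adjoint:
  assumes "compact_operator A"
  shows "clinear (hilbert_adjoint A)"
  by (rule clinearI; rule cinner_eqI)
    (simp_all add: cinner_hilbert_adjoint[OF assms, symmetric] cinner_add_right cinner_scaleC_right)

lemma norm_hilbert_adjoint_le:
  assumes A: "compact_operator A" and C: "\<And>x. norm (A x) \<le> C * norm x"
  shows "norm (hilbert_adjoint A y) \<le> C * norm y"
proof (cases "hilbert_adjoint A y = 0")
  case True
  have "0 \<le> C * norm y" using order_trans[OF norm_ge_zero C] .
  with True show ?thesis by simp
next
  case False
  let ?z = "hilbert_adjoint A y"
  have "(norm ?z)\<^sup>2 = Re (cinner (A ?z) y)"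
    by (simp add: cinner_hilbert_adjoint[OF A] cinner_self)
  also have "\<dots> \<le> norm (A ?z) * norm y"
    using norm_cinner_le[of "A ?z" y] complex_Re_le_cmod order_trans by blast
  also have "\<dots> \<le> C * norm ?z * norm y" by (simp add: C mult_right_mono)
  finally have "norm ?z * norm ?z \<le> norm ?z * (C * norm y)" by (simp add: power2_eq_square mult_ac)
  then show ?thesis using False by simp
qed

lemma compact_closure_subset:
  fixes K :: "'a::metric_space set"
  assumes K: "compact K" and S: "S \<subseteq> K"
  shows "compact (closure S)"
proof -
  have "closure S \<subseteq> K" using S K by (intro closure_minimal compact_imp_closed)
  then have "K \<inter> closure S = closure S" by (rule Int_absorb1)
  then show ?thesis using compact_Int_closed[OF K closed_closure, of S] by simp
qed

lemma compact_operator_add_scaleC: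
  fixes A B :: "'a::complex_hilbert \<Rightarrow> 'a"
  assumes A: "compact_operator A" and B: "compact_operator B"
  shows "compact_operator (\<lambda>x. A x + scaleC t (B x))"
proof -
  note linA = compact_operator_clinear[OF A] and linB = compact_operator_clinear[OF B]
  let ?SA = "closure (A ` cball 0 1)" and ?SB = "closure (B ` cball 0 1)"
  let ?K = "(\<lambda>(x, y). x + scaleC t y) ` (?SA \<times> ?SB)"
  have "compact (?SA \<times> ?SB)" using A B by (intro compact_Times) (auto simp: compact_operator_def)
  moreover have "continuous_on (?SA \<times> ?SB) (\<lambda>(x, y). x + scaleC t y)"
    unfolding case_prod_beta
    by (intro continuous_intros bounded_bilinear.continuous_on[OF bounded_bilinear_scaleC])
  ultimately have K: "compact ?K" by (rule compact_continuous_image[rotated])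
  have "(\<lambda>x. A x + scaleC t (B x)) ` cball 0 1 \<subseteq> ?K"
  proof
    fix z assume "z \<in> (\<lambda>x. A x + scaleC t (B x)) ` cball 0 1"
    then obtain x where x: "x \<in> cball 0 1" "z = A x + scaleC t (B x)" by blast
    have "(A x, B x) \<in> ?SA \<times> ?SB" using x(1) by (intro SigmaI subsetD[OF closure_subset] imageI)
    then show "z \<in> ?K" using x(2) by (intro image_eqI[of _ _ "(A x, B x)"]) auto
  qed
  then have "compact (closure ((\<lambda>x. A x + scaleC t (B x)) ` cball 0 1))"
    by (rule compact_closure_subset[OF K])
  moreover have "clinear (\<lambda>x. A x + scaleC t (B x))"
    by (rule clinearI)
      (simp_all add: clinear_add[OF linA] clinear_add[OF linB] clinear_scaleC[OF linA]
        clinear_scaleC[OF linB] scaleC_add_right scaleC_scaleC mult.commute)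
  ultimately show ?thesis by (simp add: compact_operator_def)
qed

text \<open>Here \<open>l j\<close> is the square of a singular value. The last clause is the
  extremal property: on the complement of \<open>e 0\<close>, ..., \<open>e (j - 1)\<close> the
  operator norm is at most \<open>sqrt (l j)\<close>. It makes these the \<open>n\<close> largest
  singular values in decreasing order, and it is the only spectral information used for upper
  bounds.\<close>

definition singular_system ::
    "('a::complex_hilbert \<Rightarrow> 'a) \<Rightarrow> nat \<Rightarrow> (nat \<Rightarrow> 'a) \<Rightarrow> (nat \<Rightarrow> real) \<Rightarrow> bool" where
  "singular_system X n e l \<longleftrightarrow> orthonormal n e \<and>
     (\<forall>j<n. hilbert_adjoint X (X (e j)) = scaleC (complex_of_real (l j)) (e j) \<and> 0 \<le> l j \<and>
        (\<forall>y. (\<forall>i<j. cinner y (e i) = 0) \<longrightarrow> (norm (X y))\<^sup>2 \<le> l j * (norm y)\<^sup>2))"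

text \<open>The supremum of \<open>norm (X y)\<close> over unit vectors orthogonal to the
  \<open>e j\<close> is attained. Compactness makes \<open>X (Y n)\<close> converge along a
  subsequence of a maximising sequence; since \<open>X\<close> adjoint times \<open>X\<close> nearly
  multiplies \<open>Y n\<close> by the squared supremum, the sequence itself converges, and its
  limit is the eigenvector. If the supremum is \<open>0\<close>, any admissible unit vector will
  do.\<close>

lemma maximal_eigenvector:
  fixes X :: "'a::complex_hilbert \<Rightarrow> 'a"
  assumes X: "compact_operator X" and o: "orthonormal k e"
    and eig: "\<And>j. j < k \<Longrightarrow> hilbert_adjoint X (X (e j)) = scaleC (l j) (e j)"
    and y0: "norm y0 = 1" "\<And>j. j < k \<Longrightarrow> cinner y0 (e j) = 0"
  obtains w \<mu> where "norm w = 1" "\<And>j. j < k \<Longrightarrow> cinner w (e j) = 0" "0 \<le> (\<mu>::real)"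
    "hilbert_adjoint X (X w) = scaleC (complex_of_real \<mu>) w"
    "\<And>y. (\<And>j. j < k \<Longrightarrow> cinner y (e j) = 0) \<Longrightarrow> (norm (X y))\<^sup>2 \<le> \<mu> * (norm y)\<^sup>2"
proof -
  obtain C where C: "C > 0" "\<And>x. norm (X x) \<le> C * norm x"
    using compact_operator_bounded[OF X] by blast
  note lin = compact_operator_clinear[OF X]
  note lin' = clinear_hilbert_adjoint[OF X]
  define W where "W = {y. \<forall>j<k. cinner y (e j) = 0}"
  define T where "T y = hilbert_adjoint X (X y)" for y
  define S where "S = (\<lambda>y. norm (X y)) ` {y \<in> W. norm y = 1}"
  define \<mu> where "\<mu> = Sup S"
  have cT: "cinner (X x) (X y) = cinner x (T y)" for x y
    by (simp add: T_def cinner_hilbert_adjoint[OF X])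
  \<comment> \<open>\<open>T\<close> is self-adjoint and the \<open>e j\<close> are eigenvectors, so
    their orthogonal complement is invariant.\<close>
  have TW: "T y \<in> W" if "y \<in> W" for y
  proof -
    have "cinner (T y) (e j) = 0" if j: "j < k" for j
    proof -
      have "cinner (e j) (T y) = cnj (cinner y (T (e j)))"
        by (metis cT cinner_commute)
      also have "\<dots> = 0" using eig[OF j] \<open>y \<in> W\<close> j by (simp add: T_def cinner_scaleC_right W_def)
      finally show ?thesis by (metis cinner_commute complex_cnj_zero)
    qed
    then show ?thesis by (simp add: W_def)
  qed
  have bdd: "bdd_above S"
    proof (rule bdd_aboveI[of _ C])
    fix x assume "x \<in> S"
    then obtain y where "x = norm (X y)" "norm y = 1" by (auto simp: S_def)
    then show "x \<le> C" using C(2)[of y] by simp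
  qed
  have ne: "S \<noteq> {}" using y0 by (auto simp: S_def W_def)
  have \<mu>_ge: "norm (X y) \<le> \<mu>" if "y \<in> W" "norm y = 1" for y
    unfolding \<mu>_def by (rule cSup_upper[OF _ bdd]) (use that in \<open>auto simp: S_def\<close>)
  have \<mu>0: "\<mu> \<ge> 0" using order_trans[OF norm_ge_zero \<mu>_ge[of y0]] y0 by (simp add: W_def)
  have \<mu>_le: "norm (X y) \<le> \<mu> * norm y" if "y \<in> W" for y
  proof (cases "y = 0")
    case False
    define u where "u = scaleC (complex_of_real (1 / norm y)) y"
    have "norm (X u) \<le> \<mu>"
      using that False by (intro \<mu>_ge) (simp_all add: u_def W_def norm_scaleC norm_divide cinner_scaleC_left)
    then show ?thesis using False
      by (simp add: u_def clinear_scaleC[OF lin] norm_scaleC norm_divide field_simps)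
  qed (simp add: clinear_zero[OF lin])
  have \<mu>_le2: "(norm (X y))\<^sup>2 \<le> \<mu>\<^sup>2 * (norm y)\<^sup>2" if "y \<in> W" for y
    using \<mu>_le[OF that] by (metis norm_ge_zero power_mono power_mult_distrib)
  show thesis
  proof (cases "\<mu> = 0")
    case True
    then have "X y0 = 0" using \<mu>_ge[of y0] y0 by (auto simp: W_def)
    then have "hilbert_adjoint X (X y0) = scaleC (complex_of_real 0) y0"
      by (simp add: clinear_zero[OF lin'])
    then show thesis using y0 \<mu>_le2 True by (intro that[of y0 0]) (auto simp: W_def)
  next
    case False
    then have \<mu>: "\<mu> > 0" using \<mu>0 by simp
    have "\<exists>y. y \<in> W \<and> norm y = 1 \<and> norm (X y) > \<mu> - 1 / real (Suc n)" for n
    proof -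
      have "\<mu> - 1 / real (Suc n) < Sup S" by (simp add: \<mu>_def)
      from less_cSupD[OF ne this] show ?thesis by (auto simp: S_def)
    qed
    then obtain Y where Y: "\<And>n. Y n \<in> W" "\<And>n. norm (Y n) = 1" "\<And>n. norm (X (Y n)) > \<mu> - 1 / real (Suc n)"
      by metis
    have seq: "seq_compact (closure (X ` cball 0 1))"
      using X compact_imp_seq_compact by (auto simp: compact_operator_def)
    have "\<forall>n. (\<lambda>n. X (Y n)) n \<in> closure (X ` cball 0 1)"
    proof
      fix n
      have "X (Y n) \<in> X ` cball 0 1" using Y(2)[of n] by (intro imageI) simp
      then show "X (Y n) \<in> closure (X ` cball 0 1)" by (rule subsetD[OF closure_subset])
    qed
    then obtain z r where r: "strict_mono r" and z: "((\<lambda>n. X (Y n)) \<circ> r) \<longlonglongrightarrow> z"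
    proof (rule seq_compactE[OF seq])
      fix l r assume "strict_mono (r :: nat \<Rightarrow> nat)" "((\<lambda>n. X (Y n)) \<circ> r) \<longlonglongrightarrow> l"
      then show thesis by (rule that)
    qed
    have z: "(\<lambda>n. X (Y (r n))) \<longlonglongrightarrow> z" using z by (simp add: o_def)
    have nX: "(\<lambda>n. norm (X (Y n))) \<longlonglongrightarrow> \<mu>"
    proof (rule tendsto_sandwich)
      show "\<forall>\<^sub>F n in sequentially. \<mu> - 1 / real (Suc n) \<le> norm (X (Y n))"
        by (intro always_eventually allI less_imp_le Y(3))
      show "\<forall>\<^sub>F n in sequentially. norm (X (Y n)) \<le> \<mu>"
        using Y \<mu>_ge by auto
      have "(\<lambda>n. \<mu> - 1 / real (Suc n)) \<longlonglongrightarrow> \<mu> - 0"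
        by (intro tendsto_intros LIMSEQ_Suc[OF lim_1_over_n])
      then show "(\<lambda>n. \<mu> - 1 / real (Suc n)) \<longlonglongrightarrow> \<mu>" by simp
    qed simp
    have T_le: "norm (T y) \<le> \<mu> * norm (X y)" if "y \<in> W" for y
    proof (cases "T y = 0")
      case False
      have "(norm (T y))\<^sup>2 = Re (cinner (X (T y)) (X y))" by (simp add: cT cinner_self)
      also have "\<dots> \<le> norm (X (T y)) * norm (X y)"
        using norm_cinner_le[of "X (T y)" "X y"] complex_Re_le_cmod order_trans by blast
      also have "\<dots> \<le> \<mu> * norm (T y) * norm (X y)"
        by (intro mult_right_mono \<mu>_le TW that) simp
      finally have "norm (T y) * norm (T y) \<le> norm (T y) * (\<mu> * norm (X y))"
        by (simp add: power2_eq_square mult_ac)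
      then show ?thesis using False by simp
    qed (simp add: \<mu>0)
    \<comment> \<open>Expanding the square and using \<open>T_le\<close> leaves the gap between the
      squared supremum and \<open>(norm (X (Y n)))\<^sup>2\<close>, which tends to
      \<open>0\<close>.\<close>
    have dist_le: "(norm (T (Y n) - \<mu>\<^sup>2 *\<^sub>R Y n))\<^sup>2 \<le> \<mu>\<^sup>2 * (\<mu>\<^sup>2 - (norm (X (Y n)))\<^sup>2)" for n
    proof -
      have i: "inner (Y n) (T (Y n)) = (norm (X (Y n)))\<^sup>2"
        using arg_cong[OF cT[of "Y n" "Y n"], of Re] by (simp only: cinner_self Re_cinner Re_complex_of_real)
      have "(norm (T (Y n) - \<mu>\<^sup>2 *\<^sub>R Y n))\<^sup>2
          = (norm (T (Y n)))\<^sup>2 - 2 * \<mu>\<^sup>2 * (norm (X (Y n)))\<^sup>2 + \<mu>\<^sup>2 * \<mu>\<^sup>2 * (norm (Y n))\<^sup>2"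
        by (simp add: power2_norm_eq_inner inner_diff_left inner_diff_right inner_commute i[unfolded power2_norm_eq_inner] algebra_simps)
      also have "(norm (T (Y n)))\<^sup>2 \<le> (\<mu> * norm (X (Y n)))\<^sup>2"
        by (intro power_mono T_le Y) simp
      finally show ?thesis by (simp add: Y(2) power_mult_distrib algebra_simps)
    qed
    have "(\<lambda>n. \<mu>\<^sup>2 * (\<mu>\<^sup>2 - (norm (X (Y n)))\<^sup>2)) \<longlonglongrightarrow> \<mu>\<^sup>2 * (\<mu>\<^sup>2 - \<mu>\<^sup>2)"
      by (intro tendsto_intros nX)
    then have lim0: "(\<lambda>n. \<mu>\<^sup>2 * (\<mu>\<^sup>2 - (norm (X (Y n)))\<^sup>2)) \<longlonglongrightarrow> 0" by simp
    have "(\<lambda>n. (norm (T (Y n) - \<mu>\<^sup>2 *\<^sub>R Y n))\<^sup>2) \<longlonglongrightarrow> 0"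
      by (rule tendsto_sandwich[OF _ _ tendsto_const lim0]) (use dist_le in auto)
    then have "(\<lambda>n. norm (T (Y n) - \<mu>\<^sup>2 *\<^sub>R Y n)) \<longlonglongrightarrow> 0"
      using tendsto_real_sqrt[of "\<lambda>n. (norm (T (Y n) - \<mu>\<^sup>2 *\<^sub>R Y n))\<^sup>2" 0] by simp
    then have diff0: "(\<lambda>n. T (Y n) - \<mu>\<^sup>2 *\<^sub>R Y n) \<longlonglongrightarrow> 0" by (rule tendsto_norm_zero_cancel)
    have bl: "bounded_linear A" if "clinear A" "\<And>x. norm (A x) \<le> C * norm x" for A :: "'a \<Rightarrow> 'a"
    proof (rule bounded_linear_intro[of _ C])
      show "A (r *\<^sub>R x) = r *\<^sub>R A x" for r x
        using clinear_scaleC[OF that(1)] by (metis scaleC_of_real)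
    qed (use that clinear_add in \<open>auto simp: mult.commute\<close>)
    have blX: "bounded_linear X" by (rule bl[OF lin C(2)])
    have blA: "bounded_linear (hilbert_adjoint X)"
      by (rule bl[OF lin' norm_hilbert_adjoint_le[OF X C(2)]])
    have T_lim: "(\<lambda>n. T (Y (r n))) \<longlonglongrightarrow> hilbert_adjoint X z"
      unfolding T_def by (rule bounded_linear.tendsto[OF blA z])
    define w where "w = (1 / \<mu>\<^sup>2) *\<^sub>R hilbert_adjoint X z"
    have d0: "(\<lambda>n. T (Y (r n)) - \<mu>\<^sup>2 *\<^sub>R Y (r n)) \<longlonglongrightarrow> 0"
      using LIMSEQ_subseq_LIMSEQ[OF diff0 r] by (simp add: o_def)
    have "(\<lambda>n. (1 / \<mu>\<^sup>2) *\<^sub>R (T (Y (r n)) - (T (Y (r n)) - \<mu>\<^sup>2 *\<^sub>R Y (r n)))) \<longlonglongrightarrow> (1 / \<mu>\<^sup>2) *\<^sub>R (hilbert_adjoint X z - 0)"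
      by (intro tendsto_intros T_lim d0)
    then have w: "(\<lambda>n. Y (r n)) \<longlonglongrightarrow> w" using \<mu> by (simp add: w_def)
    have "(\<lambda>n. norm (Y (r n))) \<longlonglongrightarrow> norm w" by (intro tendsto_intros w)
    then have nw: "norm w = 1" using Y(2) by (simp add: LIMSEQ_const_iff)
    have cw: "cinner w (e j) = 0" if "j < k" for j
    proof -
      have "(\<lambda>n. cinner (Y (r n)) (e j)) \<longlonglongrightarrow> cinner w (e j)"
        by (intro tendsto_cinner w tendsto_const)
      moreover have "cinner (Y (r n)) (e j) = 0" for n using Y(1) that by (simp add: W_def)
      ultimately show ?thesis by (simp add: LIMSEQ_const_iff)
    qed
    have "(\<lambda>n. T (Y (r n)) - \<mu>\<^sup>2 *\<^sub>R Y (r n)) \<longlonglongrightarrow> T w - \<mu>\<^sup>2 *\<^sub>R w"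
      unfolding T_def
      by (intro tendsto_intros w bounded_linear.tendsto[OF blA] bounded_linear.tendsto[OF blX])
    then have "T w - \<mu>\<^sup>2 *\<^sub>R w = 0" using d0 LIMSEQ_unique by blast
    then have "hilbert_adjoint X (X w) = scaleC (complex_of_real (\<mu>\<^sup>2)) w"
      by (simp add: T_def scaleC_of_real del: of_real_power)
    then show thesis using nw cw \<mu>_le2 by (intro that[of w "\<mu>\<^sup>2"]) (auto simp: W_def)
  qed
qed

lemma singular_system_mono: "singular_system X n e l \<Longrightarrow> m \<le> n \<Longrightarrow> singular_system X m e l"
  by (auto simp: singular_system_def orthonormal_def)

lemma singular_system_exists:
  fixes X :: "'a::complex_hilbert \<Rightarrow> 'a" and v :: "nat \<Rightarrow> 'a"
  assumes X: "compact_operator X" and v: "orthonormal n v"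
  shows "\<exists>e l. singular_system X n e l"
  using v
proof (induction n)
  case 0
  then show ?case by (simp add: singular_system_def orthonormal_def)
next
  case (Suc n)
  then obtain e l where el: "singular_system X n e l"
    using orthonormal_mono by (metis le_SucI order_refl)
  then have o: "orthonormal n e" by (simp add: singular_system_def)
  \<comment> \<open>The \<open>n + 1\<close> orthonormal vectors \<open>v\<close> cannot all lie in
    the span of \<open>e\<close>; the residual of one of them supplies the unit vector that keeps
    the supremum from being taken over an empty set.\<close>
  have "\<not> Suc n \<le> n" by simp
  then obtain i where "i < Suc n" "proj n e (v i) \<noteq> v i"
    using orthonormal_card_le[OF Suc.prems o] by blast
  then obtain y0 where y0: "norm y0 = 1" "\<And>j. j < n \<Longrightarrow> cinner y0 (e j) = 0"
    using orthonormal_extend_residual[OF o] by metis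
  have eig: "hilbert_adjoint X (X (e j)) = scaleC (complex_of_real (l j)) (e j)" if "j < n" for j
    using el that by (simp add: singular_system_def)
  from maximal_eigenvector[where X = X and e = e and k = n and l = "\<lambda>j. complex_of_real (l j)" and ?y0.0 = y0, OF X o eig y0] obtain w \<mu> where w:
    "norm w = 1" "\<And>j. j < n \<Longrightarrow> cinner w (e j) = 0" "0 \<le> (\<mu>::real)"
    "hilbert_adjoint X (X w) = scaleC (complex_of_real \<mu>) w"
    "\<And>y. (\<And>j. j < n \<Longrightarrow> cinner y (e j) = 0) \<Longrightarrow> (norm (X y))\<^sup>2 \<le> \<mu> * (norm y)\<^sup>2"
    by blast
  have "singular_system X (Suc n) (e(n := w)) (l(n := \<mu>))"
    unfolding singular_system_def
  proof (intro conjI allI impI)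
    show "orthonormal (Suc n) (e(n := w))" by (rule orthonormal_extend[OF o w(1,2)])
  next
    fix j assume j: "j < Suc n"
    show "hilbert_adjoint X (X ((e(n := w)) j)) = scaleC (complex_of_real ((l(n := \<mu>)) j)) ((e(n := w)) j)"
      using w(4) eig j by (auto simp: less_Suc_eq)
    show "0 \<le> (l(n := \<mu>)) j" using j w(3) el by (auto simp: less_Suc_eq singular_system_def)
    fix y assume y: "\<forall>i<j. cinner y ((e(n := w)) i) = 0"
    show "(norm (X y))\<^sup>2 \<le> (l(n := \<mu>)) j * (norm y)\<^sup>2"
    proof (cases "j = n")
      case True
      then show ?thesis using y w(5) by auto
    next
      case False
      then have "j < n" using j by simp
      then have "\<forall>i<j. cinner y (e i) = 0" using y by auto
      then show ?thesis using \<open>j < n\<close> el by (simp add: singular_system_def)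
    qed
  qed
  then show ?case by blast
qed

section \<open>Schatten sums\<close>

definition singular_space :: "('a::complex_hilbert \<Rightarrow> 'a) \<Rightarrow> real \<Rightarrow> 'a set" where
  "singular_space X \<sigma> = {x. hilbert_adjoint X (X x) = scaleC (complex_of_real (\<sigma>\<^sup>2)) x}"

lemma
  assumes "compact_operator X"
  shows singular_space_add: "x \<in> singular_space X \<sigma> \<Longrightarrow> y \<in> singular_space X \<sigma> \<Longrightarrow> x + y \<in> singular_space X \<sigma>"
    and singular_space_scale: "x \<in> singular_space X \<sigma> \<Longrightarrow> scaleC c x \<in> singular_space X \<sigma>"
    and singular_space_zero: "0 \<in> singular_space X \<sigma>"
    and singular_space_diff: "x \<in> singular_space X \<sigma> \<Longrightarrow> y \<in> singular_space X \<sigma> \<Longrightarrow> x - y \<in> singular_space X \<sigma>"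
  using compact_operator_clinear[OF assms] clinear_hilbert_adjoint[OF assms]
  by (simp_all add: singular_space_def clinear_add clinear_scaleC clinear_zero clinear_diff
      scaleC_add_right scaleC_scaleC mult.commute complex_vector.scale_right_diff_distrib del: of_real_power)

lemma singular_space_sum:
  assumes "compact_operator X" "\<And>i. i \<in> I \<Longrightarrow> f i \<in> singular_space X \<sigma>"
  shows "(\<Sum>i\<in>I. f i) \<in> singular_space X \<sigma>"
  using assms(2)
  by (induction I rule: infinite_finite_induct)
    (auto simp: singular_space_zero[OF assms(1)] intro: singular_space_add[OF assms(1)])

lemma singular_space_proj:
  assumes "compact_operator X" "\<And>i. i < n \<Longrightarrow> v i \<in> singular_space X \<sigma>"
  shows "proj n v x \<in> singular_space X \<sigma>"
  unfolding proj_def using assms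
  by (intro singular_space_sum singular_space_scale) auto

lemma cinner_singular_space:
  assumes "compact_operator X" "x \<in> singular_space X \<sigma>"
  shows "cinner (X x) (X y) = complex_of_real (\<sigma>\<^sup>2) * cinner x y"
proof -
  have "cinner (X x) (X y) = cnj (cinner (X y) (X x))" by (rule cinner_commute)
  also have "\<dots> = cnj (cinner y (scaleC (complex_of_real (\<sigma>\<^sup>2)) x))"
    using assms by (simp add: cinner_hilbert_adjoint singular_space_def)
  also have "\<dots> = complex_of_real (\<sigma>\<^sup>2) * cinner x y"
    by (simp add: cinner_scaleC_right cinner_commute[of x y])
  finally show ?thesis .
qed

lemma norm_singular_space:
  assumes "compact_operator X" "x \<in> singular_space X \<sigma>" "\<sigma> \<ge> 0"
  shows "norm (X x) = \<sigma> * norm x"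
proof -
  have "complex_of_real ((norm (X x))\<^sup>2) = complex_of_real (\<sigma>\<^sup>2 * (norm x)\<^sup>2)"
    using cinner_singular_space[OF assms(1,2), of x] by (simp add: cinner_self)
  then have "(norm (X x))\<^sup>2 = (\<sigma> * norm x)\<^sup>2"
    unfolding of_real_eq_iff power_mult_distrib .
  then show ?thesis using assms(3) by (simp add: power2_eq_iff_nonneg)
qed

lemma singular_space_orthogonal:
  assumes X: "compact_operator X" and "x \<in> singular_space X \<sigma>" "y \<in> singular_space X \<tau>"
    and "\<sigma> \<noteq> \<tau>" "\<sigma> \<ge> 0" "\<tau> \<ge> 0"
  shows "cinner x y = 0"
proof -
  have "cinner (X x) (X y) = cnj (cinner (X y) (X x))" by (rule cinner_commute)
  then have "complex_of_real (\<sigma>\<^sup>2) * cinner x y = complex_of_real (\<tau>\<^sup>2) * cinner x y"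
    using assms by (simp add: cinner_singular_space[OF X] cinner_commute[of x y])
  moreover have "complex_of_real (\<sigma>\<^sup>2) \<noteq> complex_of_real (\<tau>\<^sup>2)"
    using assms by (simp only: of_real_eq_iff) (simp add: power2_eq_iff_nonneg)
  ultimately show ?thesis by (metis mult_cancel_right)
qed

text \<open>On this eigenspace \<open>X\<close> scales norms by \<sigma>, so the images of
  orthonormal eigenvectors are at distance at least \<sigma> from one another, whereas the totally
  bounded image of the unit ball is covered by finitely many balls of radius
  \<open>\<sigma> / 2\<close>.\<close>

lemma orthonormal_in_singular_space_bound:
  fixes X :: "'a::complex_hilbert \<Rightarrow> 'a"
  assumes X: "compact_operator X" and \<sigma>: "\<sigma> > 0"
  shows "\<exists>M. \<forall>n v. orthonormal n v \<longrightarrow> (\<forall>i<n. v i \<in> singular_space X \<sigma>) \<longrightarrow> n \<le> M"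
proof -
  have "compact (closure (X ` cball 0 1))" using X by (simp add: compact_operator_def)
  then obtain k where k: "finite k" "closure (X ` cball 0 1) \<subseteq> (\<Union>x\<in>k. ball x (\<sigma>/2))"
    using \<sigma> unfolding compact_eq_totally_bounded by (meson half_gt_zero)
  have "n \<le> card k" if v: "orthonormal n v" and vE: "\<forall>i<n. v i \<in> singular_space X \<sigma>" for n and v :: "nat \<Rightarrow> 'a"
  proof -
    have "\<exists>x\<in>k. dist x (X (v i)) < \<sigma>/2" if "i < n" for i
    proof -
      have "v i \<in> cball 0 1" using orthonormal_norm[OF v that] by simp
      then have "X (v i) \<in> closure (X ` cball 0 1)" by (intro subsetD[OF closure_subset] imageI)
      then have "X (v i) \<in> (\<Union>x\<in>k. ball x (\<sigma>/2))" by (rule subsetD[OF k(2)])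
      then show ?thesis by auto
    qed
    then obtain h where h: "\<And>i. i < n \<Longrightarrow> h i \<in> k" "\<And>i. i < n \<Longrightarrow> dist (h i) (X (v i)) < \<sigma>/2" by metis
    have "inj_on h {..<n}"
    proof (rule inj_onI, rule ccontr)
      fix i j assume ij: "i \<in> {..<n}" "j \<in> {..<n}" "h i = h j" "i \<noteq> j"
      have "cinner (v i - v j) (v i - v j) = 2"
        using v ij by (simp add: cinner_diff_left cinner_diff_right orthonormal_def)
      then have "(norm (v i - v j))\<^sup>2 = 2"
        by (metis cinner_self of_real_eq_iff of_real_numeral)
      then have "1\<^sup>2 \<le> (norm (v i - v j))\<^sup>2" by simp
      then have "1 \<le> norm (v i - v j)" by (rule power2_le_imp_le) simp
      then have "\<sigma> \<le> \<sigma> * norm (v i - v j)" using \<sigma> by simp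
      also have "\<dots> = norm (X (v i - v j))"
        using vE ij \<sigma> by (intro norm_singular_space[symmetric] X singular_space_diff) auto
      also have "\<dots> = dist (X (v i)) (X (v j))"
        by (simp add: clinear_diff[OF compact_operator_clinear[OF X]] dist_norm)
      also have "\<dots> \<le> dist (h i) (X (v i)) + dist (h i) (X (v j))"
        by (metis dist_commute dist_triangle)
      also have "\<dots> < \<sigma>" using h(2)[of i] h(2)[of j] ij by simp
      finally show False by simp
    qed
    then have "card {..<n} \<le> card k" by (rule card_inj_on_le) (use h k in auto)
    then show ?thesis by simp
  qed
  then show ?thesis by blast
qed

text \<open>An orthonormal family of maximal length in the eigenspace spans it, since the residual
  of a missed vector would again lie in the eigenspace and extend the family.\<close>

lemma singular_space_basis:
  fixes X :: "'a::complex_hilbert \<Rightarrow> 'a"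
  assumes X: "compact_operator X" and \<sigma>: "\<sigma> > 0"
  obtains n v where "orthonormal n v" "\<And>i. i < n \<Longrightarrow> v i \<in> singular_space X \<sigma>"
    "\<And>x. x \<in> singular_space X \<sigma> \<Longrightarrow> proj n v x = x"
proof -
  obtain M where M: "\<forall>n v. orthonormal n v \<longrightarrow> (\<forall>i<n. v i \<in> singular_space X \<sigma>) \<longrightarrow> n \<le> M"
    using orthonormal_in_singular_space_bound[OF X \<sigma>] by blast
  define P where "P n = (\<exists>v. orthonormal n v \<and> (\<forall>i<n. v i \<in> singular_space X \<sigma>))" for n
  have "P 0" by (simp add: P_def orthonormal_def)
  have PM: "\<And>n. P n \<Longrightarrow> n \<le> M" using M by (auto simp: P_def)
  define n where "n = (GREATEST n. P n)"
  have "P n" unfolding n_def by (rule GreatestI_nat[where P = P, OF \<open>P 0\<close> PM])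
  then obtain v where v: "orthonormal n v" "\<And>i. i < n \<Longrightarrow> v i \<in> singular_space X \<sigma>"
    by (auto simp: P_def)
  have max: "\<not> P (Suc n)"
    using Greatest_le_nat[where P = P, OF _ PM, of "Suc n"] unfolding n_def by auto
  have "proj n v x = x" if x: "x \<in> singular_space X \<sigma>" for x
  proof (rule ccontr)
    assume "proj n v x \<noteq> x"
    then obtain y where y: "y = scaleC (complex_of_real (1 / norm (x - proj n v x))) (x - proj n v x)"
      "orthonormal (Suc n) (v(n := y))"
      using orthonormal_extend_residual[OF v(1)] by metis
    have "y \<in> singular_space X \<sigma>" unfolding y(1)
      by (intro singular_space_scale singular_space_diff X x singular_space_proj v)
    then have "P (Suc n)" unfolding P_def using y(2) v(2)
      by (intro exI[of _ "v(n := y)"]) (auto simp: less_Suc_eq)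
    with max show False by simp
  qed
  with v show thesis by (rule that)
qed

lemma orthonormal_inj: "orthonormal n v \<Longrightarrow> inj_on v {..<n}"
proof (rule inj_onI, rule ccontr)
  fix i j assume a: "orthonormal n v" "i \<in> {..<n}" "j \<in> {..<n}" "v i = v j" "i \<noteq> j"
  then have "cinner (v i) (v i) = 1" "cinner (v i) (v j) = 0" unfolding orthonormal_def lessThan_iff by metis+
  with \<open>v i = v j\<close> show False by simp
qed

lemma orthonormal_independent:
  assumes v: "orthonormal n v"
  shows "complex_vector.independent (v ` {..<n})"
proof
  assume "complex_vector.dependent (v ` {..<n})"
  then obtain u where u: "\<exists>x\<in>v ` {..<n}. u x \<noteq> 0" "(\<Sum>x\<in>v ` {..<n}. scaleC (u x) x) = 0"
    using complex_vector.dependent_finite[of "v ` {..<n}"] by auto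
  from u(2) have s: "(\<Sum>i<n. scaleC (u (v i)) (v i)) = 0"
    by (simp add: sum.reindex[OF orthonormal_inj[OF v]])
  have "u (v j) = 0" if "j < n" for j
    using cinner_orthonormal_sum_left[OF v that, of "\<lambda>i. u (v i)"] s by simp
  with u(1) show False by auto
qed

lemma singular_value_mult_eq:
  assumes v: "orthonormal n v" "\<And>i. i < n \<Longrightarrow> v i \<in> singular_space X \<sigma>"
    "\<And>x. x \<in> singular_space X \<sigma> \<Longrightarrow> proj n v x = x"
  shows "singular_value_mult X \<sigma> = n"
  unfolding singular_value_mult_def singular_space_def[symmetric]
proof (rule complex_vector.dim_unique[of "v ` {..<n}"])
  show "v ` {..<n} \<subseteq> singular_space X \<sigma>" using v(2) by auto
  show "singular_space X \<sigma> \<subseteq> complex_vector.span (v ` {..<n})"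
  proof
    fix x assume "x \<in> singular_space X \<sigma>"
    then have "x = (\<Sum>i<n. scaleC (cinner x (v i)) (v i))" using v(3)[of x] by (simp add: proj_def)
    also have "\<dots> \<in> complex_vector.span (v ` {..<n})"
      by (intro complex_vector.span_sum complex_vector.span_scale complex_vector.span_base) auto
    finally show "x \<in> complex_vector.span (v ` {..<n})" .
  qed
  show "card (v ` {..<n}) = n" by (simp add: card_image orthonormal_inj[OF v(1)])
qed (rule orthonormal_independent[OF v(1)])

lemma orthonormal_reindex:
  assumes "orthonormal n v" "inj_on h {..<m}" "h ` {..<m} \<subseteq> {..<n}"
  shows "orthonormal m (\<lambda>i. v (h i))"
  unfolding orthonormal_def
proof (intro allI impI)
  fix i j assume ij: "i < m" "j < m"
  then have "h i < n" "h j < n" "h i = h j \<longleftrightarrow> i = j" using assms(2,3) by (auto simp: inj_on_def)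
  then show "cinner (v (h i)) (v (h j)) = (if i = j then 1 else 0)"
    using assms(1) by (simp add: orthonormal_def)
qed

lemma card_le_singular_value_mult:
  fixes X :: "'a::complex_hilbert \<Rightarrow> 'a"
  assumes X: "compact_operator X" and \<sigma>: "\<sigma> > 0" and v: "orthonormal n v"
    and J: "J \<subseteq> {..<n}" "\<And>j. j \<in> J \<Longrightarrow> v j \<in> singular_space X \<sigma>"
  shows "card J \<le> singular_value_mult X \<sigma>"
proof -
  obtain m w where w: "orthonormal m w" "\<And>i. i < m \<Longrightarrow> w i \<in> singular_space X \<sigma>"
    "\<And>x. x \<in> singular_space X \<sigma> \<Longrightarrow> proj m w x = x"
    using singular_space_basis[OF X \<sigma>] by blast
  have "finite J" using J(1) finite_subset by blast
  then obtain h where h: "bij_betw h {..<card J} J"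
    using ex_bij_betw_nat_finite atLeast0LessThan by metis
  have "orthonormal (card J) (\<lambda>i. v (h i))"
    using h J(1) by (intro orthonormal_reindex[OF v]) (auto simp: bij_betw_def)
  moreover have "proj m w (v (h i)) = v (h i)" if "i < card J" for i
    using that h by (intro w J) (auto simp: bij_betw_def)
  ultimately have "card J \<le> m" using orthonormal_card_le[OF _ w(1)] by blast
  then show ?thesis using singular_value_mult_eq[OF w] by simp
qed

definition schatten_sum :: "real \<Rightarrow> ('a::complex_hilbert \<Rightarrow> 'a) \<Rightarrow> real" where
  "schatten_sum p X = (\<Sum>\<^sub>\<infinity>\<sigma>\<in>{0<..}. real (singular_value_mult X \<sigma>) * \<sigma> powr p)"

lemma schatten_sum_eq_norm:
  assumes "p > 0"
  shows "schatten_sum p X = schatten_norm (ereal p) X powr p"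
proof -
  have "0 \<le> schatten_sum p X" unfolding schatten_sum_def by (intro infsum_nonneg) simp
  then show ?thesis using assms by (simp add: schatten_norm_def schatten_sum_def[symmetric] powr_powr)
qed

lemma sqrt_powr: "0 \<le> x \<Longrightarrow> sqrt x powr p = x powr (p / 2)"
  by (simp add: powr_half_sqrt[symmetric] powr_powr)

text \<open>A singular system lists values with repetition, while the Schatten sum runs over
  distinct values weighted by multiplicity. Grouping equal values connects the two; zeros drop out
  because \<open>0 powr (p / 2)\<close> is \<open>0\<close>.\<close>

lemma sum_singular_values_image:
  fixes l :: "nat \<Rightarrow> real"
  assumes l: "\<And>j. j < n \<Longrightarrow> 0 \<le> l j"
  defines "S \<equiv> (\<lambda>j. sqrt (l j)) ` {j. j < n \<and> 0 < l j}"
  shows "(\<Sum>j<n. l j powr (p / 2)) = (\<Sum>\<sigma>\<in>S. real (card {j. j < n \<and> sqrt (l j) = \<sigma>}) * \<sigma> powr p)"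
    and "finite S" and "S \<subseteq> {0<..}"
proof -
  let ?J = "{j. j < n \<and> 0 < l j}"
  show "finite S" "S \<subseteq> {0<..}" by (auto simp: S_def)
  have "(\<Sum>j<n. l j powr (p / 2)) = (\<Sum>j\<in>?J. l j powr (p / 2))"
    using l by (intro sum.mono_neutral_right) (auto simp: order_less_le)
  also have "\<dots> = (\<Sum>\<sigma>\<in>S. \<Sum>j\<in>{j \<in> ?J. sqrt (l j) = \<sigma>}. l j powr (p / 2))"
    unfolding S_def by (rule sum.image_gen) simp
  also have "\<dots> = (\<Sum>\<sigma>\<in>S. real (card {j. j < n \<and> sqrt (l j) = \<sigma>}) * \<sigma> powr p)"
  proof (rule sum.cong[OF refl])
    fix \<sigma> assume "\<sigma> \<in> S"
    then have "\<sigma> > 0" by (auto simp: S_def)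
    have eq: "{j \<in> ?J. sqrt (l j) = \<sigma>} = {j. j < n \<and> sqrt (l j) = \<sigma>}"
      using \<open>\<sigma> > 0\<close> by auto
    have "(\<Sum>j\<in>{j \<in> ?J. sqrt (l j) = \<sigma>}. l j powr (p / 2)) = (\<Sum>j\<in>{j \<in> ?J. sqrt (l j) = \<sigma>}. \<sigma> powr p)"
      using l by (intro sum.cong) (auto simp: sqrt_powr)
    also have "\<dots> = real (card {j \<in> ?J. sqrt (l j) = \<sigma>}) * \<sigma> powr p" by simp
    finally show "(\<Sum>j\<in>{j \<in> ?J. sqrt (l j) = \<sigma>}. l j powr (p / 2))
      = real (card {j. j < n \<and> sqrt (l j) = \<sigma>}) * \<sigma> powr p"
      using eq by simp
  qed
  finally show "(\<Sum>j<n. l j powr (p / 2)) = (\<Sum>\<sigma>\<in>S. real (card {j. j < n \<and> sqrt (l j) = \<sigma>}) * \<sigma> powr p)" .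
qed

lemma singular_system_in_singular_space:
  "singular_system X n e l \<Longrightarrow> j < n \<Longrightarrow> sqrt (l j) = \<sigma> \<Longrightarrow> e j \<in> singular_space X \<sigma>"
  by (auto simp: singular_system_def singular_space_def simp del: of_real_power)

lemma schatten_class_iff:
  "X \<in> schatten_class (ereal p) \<longleftrightarrow> compact_operator X \<and>
    (\<lambda>\<sigma>. real (singular_value_mult X \<sigma>) * \<sigma> powr p) summable_on {0<..}"
  by (simp add: schatten_class_def)

text \<open>Only an inequality can hold: a system of length \<open>n\<close> may stop before all
  singular values are listed and may cut through an eigenspace, so each value occurs at most as
  often as its multiplicity.\<close>

lemma sum_singular_values_le_schatten_sum:
  fixes X :: "'a::complex_hilbert \<Rightarrow> 'a"
  assumes X: "X \<in> schatten_class (ereal p)" and sys: "singular_system X n e l"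
  shows "(\<Sum>j<n. l j powr (p / 2)) \<le> schatten_sum p X"
proof -
  define S where "S = (\<lambda>j. sqrt (l j)) ` {j. j < n \<and> 0 < l j}"
  have l: "\<And>j. j < n \<Longrightarrow> 0 \<le> l j" and o: "orthonormal n e" using sys by (auto simp: singular_system_def)
  have S: "finite S" "S \<subseteq> {0<..}" using sum_singular_values_image[where l = l and n = n] l by (auto simp: S_def)
  have "(\<Sum>j<n. l j powr (p / 2)) = (\<Sum>\<sigma>\<in>S. real (card {j. j < n \<and> sqrt (l j) = \<sigma>}) * \<sigma> powr p)"
    unfolding S_def by (rule sum_singular_values_image(1)) (rule l)
  also have "\<dots> \<le> (\<Sum>\<sigma>\<in>S. real (singular_value_mult X \<sigma>) * \<sigma> powr p)"
  proof (intro sum_mono mult_right_mono of_nat_mono)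
    fix \<sigma> assume "\<sigma> \<in> S"
    then show "card {j. j < n \<and> sqrt (l j) = \<sigma>} \<le> singular_value_mult X \<sigma>"
      using X S singular_system_in_singular_space[OF sys]
      by (intro card_le_singular_value_mult[OF _ _ o]) (auto simp: schatten_class_iff)
  qed simp
  also have "\<dots> \<le> schatten_sum p X"
    unfolding schatten_sum_def using X S by (intro finite_sum_le_infsum) (auto simp: schatten_class_iff)
  finally show ?thesis .
qed

lemma schatten_sum_finite_dim:
  fixes X :: "'a::complex_hilbert \<Rightarrow> 'a"
  assumes X: "compact_operator X" and sys: "singular_system X n e l" and full: "\<And>x. proj n e x = x"
  shows "schatten_sum p X = (\<Sum>j<n. l j powr (p / 2))"
proof -
  define S where "S = (\<lambda>j. sqrt (l j)) ` {j. j < n \<and> 0 < l j}"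
  have l: "\<And>j. j < n \<Longrightarrow> 0 \<le> l j" and o: "orthonormal n e" using sys by (auto simp: singular_system_def)
  have S: "finite S" "S \<subseteq> {0<..}" using sum_singular_values_image[where l = l and n = n] l by (auto simp: S_def)
  have mult: "singular_value_mult X \<sigma> = card {j. j < n \<and> sqrt (l j) = \<sigma>}" if \<sigma>: "\<sigma> > 0" for \<sigma>
  proof (rule antisym)
    let ?J = "{j. j < n \<and> sqrt (l j) = \<sigma>}"
    show "card ?J \<le> singular_value_mult X \<sigma>"
      using singular_system_in_singular_space[OF sys]
      by (intro card_le_singular_value_mult[OF X \<sigma> o]) auto
    obtain m w where w: "orthonormal m w" "\<And>i. i < m \<Longrightarrow> w i \<in> singular_space X \<sigma>"
      "\<And>x. x \<in> singular_space X \<sigma> \<Longrightarrow> proj m w x = x"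
      using singular_space_basis[OF X \<sigma>] by blast
    obtain h where h: "bij_betw h {..<card ?J} ?J"
      using ex_bij_betw_nat_finite[of ?J] by (auto simp: atLeast0LessThan)
    have "proj (card ?J) (\<lambda>i. e (h i)) x = x" if x: "x \<in> singular_space X \<sigma>" for x
    proof -
      \<comment> \<open>Eigenvectors for different values are orthogonal, so expanding
        \<open>x\<close> in the full system \<open>e\<close> leaves only the indices with value
        \<sigma>. These therefore span the eigenspace.\<close>
      have "cinner x (e j) = 0" if "j < n" "sqrt (l j) \<noteq> \<sigma>" for j
        using that l[of j] \<sigma> by (intro singular_space_orthogonal[OF X x singular_system_in_singular_space[OF sys that(1) refl]]) auto
      then have "proj n e x = (\<Sum>j\<in>?J. scaleC (cinner x (e j)) (e j))"
        unfolding proj_def by (intro sum.mono_neutral_right) auto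
      also have "\<dots> = proj (card ?J) (\<lambda>i. e (h i)) x"
        unfolding proj_def by (rule sum.reindex_bij_betw[OF h, symmetric])
      finally show ?thesis using full by simp
    qed
    moreover have "orthonormal (card ?J) (\<lambda>i. e (h i))"
      using h by (intro orthonormal_reindex[OF o]) (auto simp: bij_betw_def)
    ultimately have "m \<le> card ?J" using w(2) orthonormal_card_le[OF w(1)] by blast
    then show "singular_value_mult X \<sigma> \<le> card ?J" using singular_value_mult_eq[OF w] by simp
  qed
  have "schatten_sum p X = infsum (\<lambda>\<sigma>. real (card {j. j < n \<and> sqrt (l j) = \<sigma>}) * \<sigma> powr p) S"
    unfolding schatten_sum_def
  proof (rule infsum_cong_neutral)
    fix \<sigma> assume "\<sigma> \<in> {0<..} - S"
    then have \<sigma>: "\<sigma> > 0" "{j. j < n \<and> sqrt (l j) = \<sigma>} = {}" by (auto simp: S_def)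
    then show "real (singular_value_mult X \<sigma>) * \<sigma> powr p = 0" by (simp only: mult[OF \<sigma>(1)] \<sigma>(2)) simp
  qed (use S mult in auto)
  also have "\<dots> = (\<Sum>\<sigma>\<in>S. real (card {j. j < n \<and> sqrt (l j) = \<sigma>}) * \<sigma> powr p)"
    using S by simp
  also have "\<dots> = (\<Sum>j<n. l j powr (p / 2))"
    unfolding S_def by (rule sum_singular_values_image(1)[symmetric]) (rule l)
  finally show ?thesis .
qed

lemma finite_singular_vectors:
  fixes A :: "'a::complex_hilbert \<Rightarrow> 'a"
  assumes A: "A \<in> schatten_class (ereal p)" and \<epsilon>: "\<epsilon> > 0"
  obtains n v a where "orthonormal n v" "\<And>i. i < n \<Longrightarrow> a i > 0"
    "\<And>i. i < n \<Longrightarrow> v i \<in> singular_space A (a i)" "\<And>i. Suc i < n \<Longrightarrow> a (Suc i) \<le> a i"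
    "schatten_sum p A - \<epsilon> \<le> (\<Sum>i<n. a i powr p)"
proof -
  have cA: "compact_operator A" using A by (simp add: schatten_class_iff)
  let ?f = "\<lambda>\<sigma>. real (singular_value_mult A \<sigma>) * \<sigma> powr p"
  have "schatten_sum p A = (SUP F\<in>{F. finite F \<and> F \<subseteq> {0<..}}. sum ?f F)"
    unfolding schatten_sum_def using A by (intro infsum_nonneg_is_SUPREMUM_real) (auto simp: schatten_class_iff)
  then have "schatten_sum p A - \<epsilon> < Sup (sum ?f ` {F. finite F \<and> F \<subseteq> {0<..}})" using \<epsilon> by simp
  then obtain F where F: "finite F" "F \<subseteq> {0<..}" "schatten_sum p A - \<epsilon> < sum ?f F"
    using less_cSupD[of "sum ?f ` {F. finite F \<and> F \<subseteq> {0<..}}" "schatten_sum p A - \<epsilon>"] by blast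
  have "\<forall>\<sigma>. \<sigma> > 0 \<longrightarrow> (\<exists>n v. orthonormal n v \<and> (\<forall>i<n. v i \<in> singular_space A \<sigma>) \<and> singular_value_mult A \<sigma> = n)"
  proof (intro allI impI)
    fix \<sigma> :: real assume "\<sigma> > 0"
    from singular_space_basis[OF cA this]
    obtain n v where w: "orthonormal n v" "\<And>i. i < n \<Longrightarrow> v i \<in> singular_space A \<sigma>"
      "\<And>x. x \<in> singular_space A \<sigma> \<Longrightarrow> proj n v x = x" by blast
    then show "\<exists>n v. orthonormal n v \<and> (\<forall>i<n. v i \<in> singular_space A \<sigma>) \<and> singular_value_mult A \<sigma> = n"
      using singular_value_mult_eq[OF w] by blast
  qed
  then obtain b where b: "\<And>\<sigma>. \<sigma> > 0 \<Longrightarrow> orthonormal (singular_value_mult A \<sigma>) (b \<sigma>)"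
    "\<And>\<sigma> i. \<sigma> > 0 \<Longrightarrow> i < singular_value_mult A \<sigma> \<Longrightarrow> b \<sigma> i \<in> singular_space A \<sigma>" by metis
  \<comment> \<open>Each pair consists of a singular value and an index into the chosen basis of its
    eigenspace, so the values appear with multiplicity. Sorting the pairs by decreasing value gives
    the order that summation by parts needs later.\<close>
  define G where "G = (SIGMA \<sigma>:F. {..<singular_value_mult A \<sigma>})"
  have "finite G" using F by (auto simp: G_def)
  then obtain ys where ys: "set ys = G" "distinct ys" using finite_distinct_list by blast
  define xs where "xs = sort_key (\<lambda>g. - fst g) ys"
  have xs: "set xs = G" "distinct xs" using ys by (auto simp: xs_def)
  define n where "n = length xs"
  define v where "v k = b (fst (xs ! k)) (snd (xs ! k))" for k
  define a where "a k = fst (xs ! k)" for k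
  have mem: "xs ! k \<in> G" if "k < n" for k using that xs nth_mem unfolding n_def by metis
  have pos: "a k > 0" if "k < n" for k using mem[OF that] F by (auto simp: G_def a_def)
  have vin: "v k \<in> singular_space A (a k)" if "k < n" for k
    using mem[OF that] F by (auto simp: G_def a_def v_def intro!: b)
  have "orthonormal n v"
    unfolding orthonormal_def
  proof (intro allI impI)
    fix i j assume ij: "i < n" "j < n"
    show "cinner (v i) (v j) = (if i = j then 1 else 0)"
    proof (cases "a i = a j")
      case False
      then have "cinner (v i) (v j) = 0"
        using singular_space_orthogonal[OF cA vin vin] ij pos less_imp_le by blast
      then show ?thesis using False by auto
    next
      case True
      have "i = j \<longleftrightarrow> xs ! i = xs ! j" using ij xs by (simp add: n_def nth_eq_iff_index_eq)
      also have "\<dots> \<longleftrightarrow> snd (xs ! i) = snd (xs ! j)" using True by (simp add: a_def prod_eq_iff)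
      finally have eq: "i = j \<longleftrightarrow> snd (xs ! i) = snd (xs ! j)" .
      have "snd (xs ! i) < singular_value_mult A (a i)" "snd (xs ! j) < singular_value_mult A (a i)"
        using mem[OF ij(1)] mem[OF ij(2)] True by (auto simp: G_def a_def)
      then show ?thesis using b(1)[OF pos[OF ij(1)]] eq True
        by (auto simp: orthonormal_def v_def a_def)
    qed
  qed
  moreover have "a (Suc i) \<le> a i" if "Suc i < n" for i
  proof -
    have "sorted (map (\<lambda>g. - fst g) xs)" by (simp add: xs_def)
    then have "(map (\<lambda>g. - fst g) xs) ! i \<le> (map (\<lambda>g. - fst g) xs) ! Suc i"
      using that by (intro sorted_nth_mono) (auto simp: n_def)
    then show ?thesis using that by (simp add: n_def a_def)
  qed
  moreover have "schatten_sum p A - \<epsilon> \<le> (\<Sum>i<n. a i powr p)"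
  proof -
    have "(\<Sum>i<n. a i powr p) = sum_list (map (\<lambda>g. fst g powr p) xs)"
      by (simp add: sum_list_sum_nth a_def n_def atLeast0LessThan)
    also have "\<dots> = (\<Sum>g\<in>G. fst g powr p)"
      using sum.distinct_set_conv_list[OF xs(2), of "\<lambda>g. fst g powr p"] xs(1) by simp
    also have "\<dots> = (\<Sum>\<sigma>\<in>F. \<Sum>i<singular_value_mult A \<sigma>. \<sigma> powr p)"
      unfolding G_def using F by (subst sum.Sigma) (auto simp: case_prod_beta)
    also have "\<dots> = sum ?f F" by simp
    finally show ?thesis using F by simp
  qed
  ultimately show thesis using pos vin that by blast
qed

section \<open>Minors and singular values\<close>

text \<open>Gram-Schmidt applied to the projections of \<open>y 0\<close>, \<open>y 1\<close>, ...
  onto the span of \<open>v\<close>. It is used twice: with singular vectors for \<open>y\<close>,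
  to exploit their extremal property, and with the images of a basis for \<open>y\<close>, to make a
  matrix triangular.\<close>

lemma flag_basis:
  fixes v :: "nat \<Rightarrow> 'a::complex_hilbert"
  assumes v: "orthonormal k v"
  obtains \<xi> where "orthonormal k \<xi>" "\<And>j. j < k \<Longrightarrow> proj k v (\<xi> j) = \<xi> j"
    "\<And>i j. i < j \<Longrightarrow> j < k \<Longrightarrow> cinner (y i) (\<xi> j) = 0"
proof -
  \<comment> \<open>The fourth clause is the invariant that drives the induction: the vectors found
    so far span the projections of the earlier \<open>y i\<close>, so anything orthogonal to them
    inside the span of \<open>v\<close> is orthogonal to these \<open>y i\<close>.\<close>
  have "\<exists>\<xi>. orthonormal j \<xi> \<and> (\<forall>i<j. proj k v (\<xi> i) = \<xi> i) \<and>
      (\<forall>l<j. \<forall>i<l. cinner (y i) (\<xi> l) = 0) \<and>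
      (\<forall>i<j. proj j \<xi> (proj k v (y i)) = proj k v (y i))" if "j \<le> k" for j
    using that
  proof (induction j)
    case 0
    then show ?case by (simp add: orthonormal_def)
  next
    case (Suc j)
    then obtain \<xi> where \<xi>: "orthonormal j \<xi>" "\<And>i. i < j \<Longrightarrow> proj k v (\<xi> i) = \<xi> i"
      "\<And>i l. l < j \<Longrightarrow> i < l \<Longrightarrow> cinner (y i) (\<xi> l) = 0"
      "\<And>i. i < j \<Longrightarrow> proj j \<xi> (proj k v (y i)) = proj k v (y i)" by auto
    have "\<not> k \<le> j" using Suc.prems by simp
    then obtain i0 where i0: "i0 < k" "proj j \<xi> (v i0) \<noteq> v i0"
      using orthonormal_card_le[OF v \<xi>(1)] by blast
    let ?y = "proj k v (y j)"
    \<comment> \<open>If the projection of \<open>y j\<close> adds nothing new, some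
      \<open>v i0\<close> outside the current span still lengthens the family.\<close>
    define x where "x = (if proj j \<xi> ?y \<noteq> ?y then ?y else v i0)"
    have x: "proj j \<xi> x \<noteq> x" "proj k v x = x"
      using i0 proj_member[OF v i0(1)] proj_idem[OF v] by (auto simp: x_def)
    obtain w where w: "\<And>i. i < j \<Longrightarrow> cinner w (\<xi> i) = 0"
      "w = scaleC (complex_of_real (1 / norm (x - proj j \<xi> x))) (x - proj j \<xi> x)"
      "orthonormal (Suc j) (\<xi>(j := w))" "proj (Suc j) (\<xi>(j := w)) x = x"
      using orthonormal_extend_residual[OF \<xi>(1) x(1)] by metis
    have "proj k v (proj j \<xi> x) = proj j \<xi> x"
      using \<xi>(2) by (subst (1 2) proj_def[of j]) (simp add: proj_sum proj_scaleC)
    moreover have "proj k v (a - b) = proj k v a - proj k v b" for a b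
      using proj_add[of k v "a - b" b] by simp
    ultimately have wV: "proj k v w = w" using x(2) by (simp add: w(2) proj_scaleC)
    have pw: "proj (Suc j) (\<xi>(j := w)) z = proj j \<xi> z + scaleC (cinner z w) w" for z
      by (simp add: proj_def)
    have orth: "cinner z w = 0" if "proj j \<xi> z = z" for z
    proof -
      have "cinner (\<xi> i) w = 0" if "i < j" for i
        using w(1)[OF that] by (subst cinner_commute) simp
      then have "cinner (proj j \<xi> z) w = 0"
        by (simp add: proj_def cinner_sum_left cinner_scaleC_left)
      then show ?thesis using that by simp
    qed
    have yw: "cinner (y i) w = 0" if "i < j" for i
    proof -
      have "cinner (y i) w = cinner (proj k v (y i)) w"
        using wV cinner_proj_right[of "y i" k v w] by simp
      then show ?thesis using orth[OF \<xi>(4)[OF that]] by simp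
    qed
    have last: "proj (Suc j) (\<xi>(j := w)) ?y = ?y"
    proof (cases "proj j \<xi> ?y = ?y")
      case True
      then show ?thesis using orth[OF True] by (simp add: pw)
    next
      case False
      then show ?thesis using w(4) by (simp add: x_def)
    qed
    have "proj (Suc j) (\<xi>(j := w)) (proj k v (y i)) = proj k v (y i)" if "i < j" for i
      using orth[OF \<xi>(4)[OF that]] \<xi>(4)[OF that] by (simp add: pw)
    moreover obtain \<xi>' where \<xi>': "\<xi>' = \<xi>(j := w)" by blast
    moreover have "\<xi>' j = w" "\<And>i. i < j \<Longrightarrow> \<xi>' i = \<xi> i" by (auto simp: \<xi>')
    ultimately have "orthonormal (Suc j) \<xi>'" "\<forall>i<Suc j. proj k v (\<xi>' i) = \<xi>' i"
      "\<forall>l<Suc j. \<forall>i<l. cinner (y i) (\<xi>' l) = 0"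
      "\<forall>i<Suc j. proj (Suc j) \<xi>' (proj k v (y i)) = proj k v (y i)"
      using w(3) wV \<xi>(2,3) yw last by (simp_all add: less_Suc_eq)
    then show ?case by blast
  qed
  from this[of k] show thesis using that by blast
qed

lemma flag_basis_singular_system:
  fixes v :: "nat \<Rightarrow> 'a::complex_hilbert"
  assumes sys: "singular_system X k e l" and v: "orthonormal k v"
  obtains \<xi> where "orthonormal k \<xi>" "\<And>j. j < k \<Longrightarrow> proj k v (\<xi> j) = \<xi> j"
    "\<And>j. j < k \<Longrightarrow> (norm (X (\<xi> j)))\<^sup>2 \<le> l j"
proof -
  obtain \<xi> where \<xi>: "orthonormal k \<xi>" "\<And>j. j < k \<Longrightarrow> proj k v (\<xi> j) = \<xi> j"
    "\<And>i j. i < j \<Longrightarrow> j < k \<Longrightarrow> cinner (e i) (\<xi> j) = 0"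
    using flag_basis[OF v, of e] by metis
  have "(norm (X (\<xi> j)))\<^sup>2 \<le> l j" if j: "j < k" for j
  proof -
    have "cinner (\<xi> j) (e i) = 0" if "i < j" for i
      using \<xi>(3)[OF that j] by (subst cinner_commute) simp
    then have "(norm (X (\<xi> j)))\<^sup>2 \<le> l j * (norm (\<xi> j))\<^sup>2"
      using sys j by (simp add: singular_system_def)
    then show ?thesis using orthonormal_norm[OF \<xi>(1) j] by simp
  qed
  with \<xi>(1,2) show thesis by (rule that)
qed

text \<open>A matrix coefficient of the \<open>k\<close>-th exterior power of
  \<open>X\<close>.\<close>

definition minor :: "nat \<Rightarrow> ('a::complex_hilbert \<Rightarrow> 'a) \<Rightarrow> (nat \<Rightarrow> 'a) \<Rightarrow> (nat \<Rightarrow> 'a) \<Rightarrow> complex" where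
  "minor k X v u = Determinant.det (Matrix.mat k k (\<lambda>(i, j). cinner (X (v i)) (u j)))"

lemma cmod_det_change_of_basis:
  assumes v: "orthonormal k v" and \<xi>: "orthonormal k \<xi>" and eq: "\<And>i. i < k \<Longrightarrow> proj k \<xi> (v i) = v i"
  shows "cmod (Determinant.det (Matrix.mat k k (\<lambda>(i, j). cinner (v i) (\<xi> j)))) = 1"
proof -
  let ?W = "Matrix.mat k k (\<lambda>(i, j). cinner (v i) (\<xi> j))"
  let ?W' = "map_mat cnj (transpose_mat ?W)"
  have W: "?W \<in> carrier_mat k k" "?W' \<in> carrier_mat k k" by auto
  have "?W * ?W' = 1\<^sub>m k"
  proof (rule eq_matI)
    fix i j assume "i < dim_row (1\<^sub>m k :: complex mat)" "j < dim_col (1\<^sub>m k :: complex mat)"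
    then have ij: "i < k" "j < k" by auto
    have "(?W * ?W') $$ (i, j) = (\<Sum>l<k. cinner (v i) (\<xi> l) * cnj (cinner (v j) (\<xi> l)))"
      using ij by (simp add: scalar_prod_def atLeast0LessThan)
    also have "\<dots> = (\<Sum>l<k. cinner (v i) (\<xi> l) * cinner (\<xi> l) (v j))"
      by (simp add: cinner_commute[symmetric])
    also have "\<dots> = cinner (v i) (v j)" by (rule cinner_parseval[symmetric]) (rule eq[OF ij(1)])
    finally show "(?W * ?W') $$ (i, j) = 1\<^sub>m k $$ (i, j)" using v ij by (simp add: orthonormal_def)
  qed auto
  then have "Determinant.det ?W * Determinant.det ?W' = 1"
    using Determinant.det_mult[OF W] by simp
  moreover interpret cnj_hom: comm_ring_hom cnj by standard auto
  have "Determinant.det ?W' = cnj (Determinant.det ?W)"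
    using Determinant.det_transpose[OF W(1)] by simp
  ultimately have "complex_of_real ((cmod (Determinant.det ?W))\<^sup>2) = 1"
    unfolding complex_norm_square by simp
  then have "(cmod (Determinant.det ?W))\<^sup>2 = 1" by (metis of_real_eq_1_iff)
  then show ?thesis using norm_ge_zero[of "Determinant.det ?W"] unfolding power2_eq_1_iff by linarith
qed

text \<open>Changing to flag bases multiplies the determinant by factors of modulus 1 and makes the
  matrix triangular. Its diagonal entries are at most \<open>norm (X (\<xi> j))\<close>, and \<xi>
  is adapted to the singular system so that this is at most the \<open>j\<close>-th singular
  value.\<close>

lemma cmod_minor_le:
  fixes X :: "'a::complex_hilbert \<Rightarrow> 'a"
  assumes lin: "clinear X" and sys: "singular_system X k e l" and v: "orthonormal k v" and u: "orthonormal k u"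
  shows "cmod (minor k X v u) \<le> (\<Prod>j<k. sqrt (l j))"
proof -
  obtain \<xi> where \<xi>: "orthonormal k \<xi>" "\<And>j. j < k \<Longrightarrow> proj k v (\<xi> j) = \<xi> j"
    "\<And>j. j < k \<Longrightarrow> (norm (X (\<xi> j)))\<^sup>2 \<le> l j"
    using flag_basis_singular_system[OF sys v] by metis
  obtain \<eta> where \<eta>: "orthonormal k \<eta>" "\<And>j. j < k \<Longrightarrow> proj k u (\<eta> j) = \<eta> j"
    "\<And>i j. i < j \<Longrightarrow> j < k \<Longrightarrow> cinner (X (\<xi> i)) (\<eta> j) = 0"
    using flag_basis[OF u, of "\<lambda>i. X (\<xi> i)"] by metis
  note v_\<xi> = orthonormal_proj_eq[OF v \<xi>(1) \<xi>(2)]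
  note u_\<eta> = orthonormal_proj_eq[OF u \<eta>(1) \<eta>(2)]
  let ?V = "Matrix.mat k k (\<lambda>(i, j). cinner (v i) (\<xi> j))"
  let ?M = "Matrix.mat k k (\<lambda>(i, j). cinner (X (\<xi> i)) (\<eta> j))"
  let ?U = "Matrix.mat k k (\<lambda>(i, j). cinner (\<eta> i) (u j))"
  have c: "?V \<in> carrier_mat k k" "?M \<in> carrier_mat k k" "?U \<in> carrier_mat k k" by auto
  have "Matrix.mat k k (\<lambda>(i, j). cinner (X (v i)) (u j)) = ?V * (?M * ?U)"
  proof (rule eq_matI)
    fix i j assume "i < dim_row (?V * (?M * ?U))" "j < dim_col (?V * (?M * ?U))"
    then have ij: "i < k" "j < k" by auto
    have "cinner (X (v i)) (u j) = cinner (X (proj k \<xi> (v i))) (u j)" using v_\<xi>[OF _ ij(1)] by simp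
    also have "\<dots> = (\<Sum>a<k. cinner (v i) (\<xi> a) * cinner (X (\<xi> a)) (u j))"
      by (simp add: proj_def clinear_sum[OF lin] clinear_scaleC[OF lin] cinner_sum_left cinner_scaleC_left)
    also have "\<dots> = (\<Sum>a<k. cinner (v i) (\<xi> a) * (\<Sum>b<k. cinner (X (\<xi> a)) (\<eta> b) * cinner (\<eta> b) (u j)))"
    proof (intro sum.cong refl arg_cong2[where f = times])
      fix a
      have "cinner (X (\<xi> a)) (u j) = cinner (X (\<xi> a)) (proj k \<eta> (u j))" using u_\<eta>[OF _ ij(2)] by simp
      also have "\<dots> = cinner (proj k \<eta> (X (\<xi> a))) (u j)" by (rule cinner_proj_right)
      finally show "cinner (X (\<xi> a)) (u j) = (\<Sum>b<k. cinner (X (\<xi> a)) (\<eta> b) * cinner (\<eta> b) (u j))"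
        by (simp add: proj_def cinner_sum_left cinner_scaleC_left)
    qed
    finally show "Matrix.mat k k (\<lambda>(i, j). cinner (X (v i)) (u j)) $$ (i, j) = (?V * (?M * ?U)) $$ (i, j)"
      using ij by (simp add: scalar_prod_def atLeast0LessThan)
  qed auto
  then have "minor k X v u = Determinant.det ?V * (Determinant.det ?M * Determinant.det ?U)"
    unfolding minor_def using Determinant.det_mult[OF c(1), of "?M * ?U"] Determinant.det_mult[OF c(2,3)] c by simp
  moreover have "cmod (Determinant.det ?V) = 1"
    by (rule cmod_det_change_of_basis[OF v \<xi>(1)]) (rule v_\<xi>)
  moreover have "cmod (Determinant.det ?U) = 1"
    by (rule cmod_det_change_of_basis[OF \<eta>(1) u]) (rule \<eta>(2))
  moreover have "Determinant.det ?M = (\<Prod>j<k. cinner (X (\<xi> j)) (\<eta> j))"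
  proof -
    have "Determinant.det ?M = prod_list (diag_mat ?M)"
      by (rule Determinant.det_lower_triangular[OF _ c(2)]) (use \<eta>(3) in auto)
    also have "\<dots> = (\<Prod>j<k. cinner (X (\<xi> j)) (\<eta> j))"
      by (simp add: diag_mat_def prod.distinct_set_conv_list[symmetric] atLeast0LessThan)
    finally show ?thesis .
  qed
  ultimately have "cmod (minor k X v u) = (\<Prod>j<k. cmod (cinner (X (\<xi> j)) (\<eta> j)))"
    by (simp add: norm_mult prod_norm)
  also have "\<dots> \<le> (\<Prod>j<k. sqrt (l j))"
  proof (rule prod_mono)
    fix j assume "j \<in> {..<k}"
    then have j: "j < k" by simp
    have "cmod (cinner (X (\<xi> j)) (\<eta> j)) \<le> norm (X (\<xi> j)) * norm (\<eta> j)" by (rule norm_cinner_le)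
    also have "\<dots> = norm (X (\<xi> j))" using orthonormal_norm[OF \<eta>(1) j] by simp
    also have "\<dots> \<le> sqrt (l j)" by (rule real_le_rsqrt[OF \<xi>(3)[OF j]])
    finally show "0 \<le> cmod (cinner (X (\<xi> j)) (\<eta> j)) \<and> cmod (cinner (X (\<xi> j)) (\<eta> j)) \<le> sqrt (l j)" by simp
  qed
  finally show ?thesis .
qed

lemma minor_diagonal:
  assumes "\<And>i j. i < k \<Longrightarrow> j < k \<Longrightarrow> cinner (X (v i)) (u j) = (if i = j then a i else 0)"
  shows "minor k X v u = (\<Prod>j<k. a j)"
proof -
  let ?M = "Matrix.mat k k (\<lambda>(i, j). cinner (X (v i)) (u j))"
  have "Determinant.det ?M = prod_list (diag_mat ?M)"
    by (rule Determinant.det_lower_triangular[of k]) (use assms in auto)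
  also have "\<dots> = (\<Prod>j<k. cinner (X (v j)) (u j))"
    by (simp add: diag_mat_def prod.distinct_set_conv_list[symmetric] atLeast0LessThan)
  also have "\<dots> = (\<Prod>j<k. a j)" by (intro prod.cong) (use assms in auto)
  finally show ?thesis by (simp add: minor_def)
qed

text \<open>The determinant is taken over the polynomial ring, with affine entries; evaluation at
  \<open>t\<close> is a ring homomorphism and commutes with it.\<close>

lemma minor_affine_poly:
  "\<exists>P. \<forall>t. minor k (\<lambda>x. A x + scaleC t (B x)) v u = poly P t"
proof (intro exI allI)
  fix t
  interpret comm_ring_hom "\<lambda>p :: complex poly. poly p t" by standard auto
  let ?M = "Matrix.mat k k (\<lambda>(i, j). [:cinner (A (v i)) (u j), cinner (B (v i)) (u j):])"
  have "map_mat (\<lambda>p. poly p t) ?M = Matrix.mat k k (\<lambda>(i, j). cinner (A (v i) + scaleC t (B (v i))) (u j))"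
    by (rule eq_matI) (auto simp: cinner_add_left cinner_scaleC_left)
  then show "minor k (\<lambda>x. A x + scaleC t (B x)) v u = poly (Determinant.det ?M) t"
    unfolding minor_def using hom_det[of ?M] by simp
qed

section \<open>Traces and Ky Fan's inequality\<close>

lemma sum_norm_square_change_of_basis:
  assumes lin: "clinear X" and v: "orthonormal k v" and \<xi>: "orthonormal k \<xi>"
    and eq: "\<And>i. i < k \<Longrightarrow> proj k v (\<xi> i) = \<xi> i"
  shows "(\<Sum>i<k. (norm (X (v i)))\<^sup>2) = (\<Sum>i<k. (norm (X (\<xi> i)))\<^sup>2)"
proof -
  note v_\<xi> = orthonormal_proj_eq[OF v \<xi> eq]
  have n: "cinner (X (v i)) (X (v i)) = (\<Sum>l<k. \<Sum>m<k. cinner (\<xi> m) (v i) * cinner (v i) (\<xi> l) * cinner (X (\<xi> l)) (X (\<xi> m)))"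
    if i: "i < k" for i
  proof -
    have "X (v i) = (\<Sum>l<k. scaleC (cinner (v i) (\<xi> l)) (X (\<xi> l)))"
    proof -
      have "X (v i) = X (proj k \<xi> (v i))" using v_\<xi>[OF _ i] by simp
      then show ?thesis by (simp add: proj_def clinear_sum[OF lin] clinear_scaleC[OF lin])
    qed
    then show ?thesis
      by (simp add: cinner_sum_left cinner_sum_right cinner_scaleC_left cinner_scaleC_right
          cinner_commute[symmetric] sum_distrib_left mult_ac) (rule sum.swap)
  qed
  have "(\<Sum>i<k. cinner (X (v i)) (X (v i)))
      = (\<Sum>i<k. \<Sum>l<k. \<Sum>m<k. cinner (\<xi> m) (v i) * cinner (v i) (\<xi> l) * cinner (X (\<xi> l)) (X (\<xi> m)))"
    by (intro sum.cong) (auto simp: n)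
  also have "\<dots> = (\<Sum>l<k. \<Sum>i<k. \<Sum>m<k. cinner (\<xi> m) (v i) * cinner (v i) (\<xi> l) * cinner (X (\<xi> l)) (X (\<xi> m)))"
    by (rule sum.swap)
  also have "\<dots> = (\<Sum>l<k. \<Sum>m<k. \<Sum>i<k. cinner (\<xi> m) (v i) * cinner (v i) (\<xi> l) * cinner (X (\<xi> l)) (X (\<xi> m)))"
    by (intro sum.cong refl sum.swap)
  also have "\<dots> = (\<Sum>l<k. \<Sum>m<k. cinner (\<xi> m) (\<xi> l) * cinner (X (\<xi> l)) (X (\<xi> m)))"
    by (intro sum.cong refl) (simp add: sum_distrib_right[symmetric] cinner_parseval[OF eq, symmetric])
  also have "\<dots> = (\<Sum>l<k. \<Sum>m<k. if m = l then cinner (X (\<xi> l)) (X (\<xi> m)) else 0)"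
    using \<xi> by (intro sum.cong refl) (auto simp: orthonormal_def)
  also have "\<dots> = (\<Sum>l<k. cinner (X (\<xi> l)) (X (\<xi> l)))" by simp
  finally have "complex_of_real (\<Sum>i<k. (norm (X (v i)))\<^sup>2) = complex_of_real (\<Sum>i<k. (norm (X (\<xi> i)))\<^sup>2)"
    by (simp only: cinner_self of_real_sum)
  then show ?thesis by (simp only: of_real_eq_iff)
qed

text \<open>The left side is a trace over the span of \<open>v\<close> and may be computed in the
  flag basis adapted to the singular system, where the inequality holds term by term.\<close>

lemma sum_norm_square_le_singular_values:
  assumes lin: "clinear X" and sys: "singular_system X k e l" and v: "orthonormal k v"
  shows "(\<Sum>i<k. (norm (X (v i)))\<^sup>2) \<le> (\<Sum>j<k. l j)"
proof -
  obtain \<xi> where \<xi>: "orthonormal k \<xi>" "\<And>j. j < k \<Longrightarrow> proj k v (\<xi> j) = \<xi> j"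
    "\<And>j. j < k \<Longrightarrow> (norm (X (\<xi> j)))\<^sup>2 \<le> l j"
    using flag_basis_singular_system[OF sys v] by metis
  have "(\<Sum>i<k. (norm (X (v i)))\<^sup>2) = (\<Sum>i<k. (norm (X (\<xi> i)))\<^sup>2)"
    by (rule sum_norm_square_change_of_basis[OF lin v \<xi>(1,2)])
  also have "\<dots> \<le> (\<Sum>j<k. l j)" by (rule sum_mono) (simp add: \<xi>(3))
  finally show ?thesis .
qed

section \<open>Maximum principle and log-convexity\<close>

lemma exists_on_sphere_norm_ge:
  assumes f: "f holomorphic_on UNIV" and r: "r > 0"
  shows "\<exists>t. cmod t = r \<and> cmod (f 0) \<le> cmod (f t)"
proof -
  have cont: "continuous_on S f" for S using f holomorphic_on_imp_continuous_on continuous_on_subset by blast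
  have "compact (sphere 0 r :: complex set)" "sphere (0::complex) r \<noteq> {}" using r by auto
  then obtain t where t: "t \<in> sphere 0 r" "\<And>s. s \<in> sphere 0 r \<Longrightarrow> cmod (f s) \<le> cmod (f t)"
    using continuous_attains_sup[of "sphere 0 r" "\<lambda>s. cmod (f s)"] continuous_on_norm[OF cont] by blast
  have "cmod (f 0) \<le> cmod (f t)"
  proof (rule maximum_modulus_frontier[of f "ball 0 r"])
    show "f holomorphic_on interior (ball 0 r)" using f holomorphic_on_subset by blast
    show "\<And>z. z \<in> frontier (ball 0 r) \<Longrightarrow> cmod (f z) \<le> cmod (f t)"
      using t(2) r by (simp add: frontier_ball)
  qed (use r cont in auto)
  with t show ?thesis by auto
qed

lemma ln_prod_pos:
  fixes f :: "'i \<Rightarrow> real"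
  assumes "finite I" "\<And>i. i \<in> I \<Longrightarrow> 0 < f i"
  shows "ln (prod f I) = (\<Sum>i\<in>I. ln (f i))"
proof (rule ln_prod[OF assms(1)])
  show "f i \<noteq> 0" if "i \<in> I" for i using assms(2)[OF that] by simp
qed

text \<open>A discrete substitute for the mean value inequality of the subharmonic function
  \<open>\<Sum>i. w i * ln \<bar>f i\<bar>\<close>: approximate the weights by rationals and apply the maximum
  principle to a product of powers of the \<open>f i\<close>.\<close>

lemma exists_on_sphere_weighted_log_ge:
  fixes f :: "'i \<Rightarrow> complex \<Rightarrow> complex"
  assumes I: "finite I" and f: "\<And>i. i \<in> I \<Longrightarrow> f i holomorphic_on UNIV"
    and f0: "\<And>i. i \<in> I \<Longrightarrow> f i 0 \<noteq> 0" and w: "\<And>i. i \<in> I \<Longrightarrow> w i \<ge> 0"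
    and r: "r > 0" and \<epsilon>: "\<epsilon> > 0"
  shows "\<exists>t. cmod t = r \<and> (\<forall>i\<in>I. f i t \<noteq> 0) \<and>
    (\<Sum>i\<in>I. w i * ln (cmod (f i t) / cmod (f i 0))) \<ge> - \<epsilon>"
proof -
  have "\<exists>K\<ge>1. \<forall>t. cmod t = r \<longrightarrow> cmod (f i t) / cmod (f i 0) \<le> K" if i: "i \<in> I" for i
  proof -
    have "continuous_on (sphere 0 r) (f i)"
      using f[OF i] holomorphic_on_imp_continuous_on continuous_on_subset by blast
    then have "bounded (f i ` sphere 0 r)" by (intro compact_imp_bounded compact_continuous_image) auto
    then obtain B where "\<forall>x\<in>sphere 0 r. cmod (f i x) \<le> B"
      by (auto simp: bounded_iff)
    then have B: "cmod (f i t) \<le> B" if "cmod t = r" for t using that by auto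
    have "cmod (f i t) / cmod (f i 0) \<le> max 1 (B / cmod (f i 0))" if "cmod t = r" for t
      using B[OF that] f0[OF i] by (simp add: divide_right_mono le_max_iff_disj)
    then show ?thesis by (meson max.cobounded1)
  qed
  then obtain K where K: "\<And>i. i \<in> I \<Longrightarrow> K i \<ge> 1"
    "\<And>i t. i \<in> I \<Longrightarrow> cmod t = r \<Longrightarrow> cmod (f i t) / cmod (f i 0) \<le> K i"
    by metis
  define L where "L = (\<Sum>i\<in>I. ln (K i))"
  have L: "L \<ge> 0" unfolding L_def by (intro sum_nonneg) (simp add: K)
  obtain M :: nat where M: "2 * L / \<epsilon> + 1 < real M" using reals_Archimedean2 by blast
  have M0: "real M > 0" using M L \<epsilon> by (smt (verit) divide_nonneg_pos mult_nonneg_nonneg)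
  \<comment> \<open>The extra \<open>1\<close> makes every exponent positive, so that
    \<open>F t \<noteq> 0\<close> forces all \<open>f i t \<noteq> 0\<close>, even those of weight
    \<open>0\<close>. Rounding up and adding \<open>1\<close> exceeds \<open>M * w i\<close> by at
    most \<open>2\<close>, which costs at most \<open>2 * L\<close> in total, and \<open>M\<close>
    was chosen to make this at most \<open>M * \<epsilon>\<close>.\<close>
  define m where "m i = nat \<lceil>real M * w i\<rceil> + 1" for i
  have m: "real M * w i \<le> real (m i)" "real (m i) \<le> real M * w i + 2" if "i \<in> I" for i
    using w[OF that] M0 unfolding m_def by (auto simp: of_nat_nat) linarith+
  define F where "F t = (\<Prod>i\<in>I. f i t ^ m i)" for t
  have "F holomorphic_on UNIV" unfolding F_def by (intro holomorphic_intros f)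
  then obtain t where t: "cmod t = r" "cmod (F 0) \<le> cmod (F t)"
    using exists_on_sphere_norm_ge r by blast
  have F0: "F 0 \<noteq> 0" using f0 I by (simp add: F_def)
  then have "F t \<noteq> 0" using t by auto
  then have nz: "f i t \<noteq> 0" if "i \<in> I" for i
    using that I by (auto simp: F_def m_def)
  define q where "q i = cmod (f i t) / cmod (f i 0)" for i
  have q: "q i > 0" if "i \<in> I" for i using nz f0 that by (simp add: q_def)
  have "1 \<le> cmod (F t) / cmod (F 0)" using t F0 by simp
  also have "\<dots> = (\<Prod>i\<in>I. q i ^ m i)"
    by (simp add: F_def q_def prod_norm[symmetric] norm_power power_divide prod_dividef)
  finally have "0 \<le> ln (\<Prod>i\<in>I. q i ^ m i)" by simp
  also have "\<dots> = (\<Sum>i\<in>I. real (m i) * ln (q i))"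
  proof -
    have "ln (\<Prod>i\<in>I. q i ^ m i) = (\<Sum>i\<in>I. ln (q i ^ m i))"
      by (rule ln_prod_pos[OF I]) (simp add: q)
    also have "\<dots> = (\<Sum>i\<in>I. real (m i) * ln (q i))"
      by (intro sum.cong refl ln_realpow q)
    finally show ?thesis .
  qed
  finally have S: "0 \<le> (\<Sum>i\<in>I. real (m i) * ln (q i))" .
  have "(\<Sum>i\<in>I. real (m i) * ln (q i)) - 2 * L \<le> (\<Sum>i\<in>I. real M * w i * ln (q i))"
  proof -
    have "real (m i) * ln (q i) - 2 * ln (K i) \<le> real M * w i * ln (q i)" if i: "i \<in> I" for i
    proof -
      have "ln (q i) \<le> ln (K i)" using K(2)[OF i t(1)] q[OF i] K(1)[OF i] by (simp add: q_def)
      moreover have "0 \<le> ln (K i)" using K(1)[OF i] by simp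
      moreover have "0 \<le> real (m i) - real M * w i" "real (m i) - real M * w i \<le> 2"
        using m[OF i] by auto
      ultimately have "(real (m i) - real M * w i) * ln (q i) \<le> 2 * ln (K i)"
        by (meson mult_left_mono mult_right_mono order_trans)
      then show ?thesis by (simp add: algebra_simps)
    qed
    then have "(\<Sum>i\<in>I. real (m i) * ln (q i) - 2 * ln (K i)) \<le> (\<Sum>i\<in>I. real M * w i * ln (q i))"
      by (rule sum_mono)
    then show ?thesis by (simp add: sum_subtractf L_def sum_distrib_left)
  qed
  then have "- 2 * L \<le> real M * (\<Sum>i\<in>I. w i * ln (q i))"
    using S by (simp add: sum_distrib_left mult.assoc)
  moreover have "real M * \<epsilon> \<ge> 2 * L"
    using M \<epsilon> by (simp add: field_simps)
  ultimately have "real M * (- \<epsilon>) \<le> real M * (\<Sum>i\<in>I. w i * ln (q i))" by simp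
  then have "- \<epsilon> \<le> (\<Sum>i\<in>I. w i * ln (q i))" using M0 by (rule mult_left_le_imp_le)
  with t(1) nz show ?thesis unfolding q_def by blast
qed

section \<open>Convexity in the logarithm\<close>

lemma sum_by_parts:
  fixes w d :: "nat \<Rightarrow> real"
  shows "(\<Sum>k<n. w k * d k) = (\<Sum>k<n. (w k - w (Suc k)) * (\<Sum>j\<le>k. d j)) + w n * (\<Sum>j<n. d j)"
proof (induction n)
  case (Suc n)
  have "(\<Sum>j\<le>n. d j) = (\<Sum>j<n. d j) + d n" by (simp add: lessThan_Suc_atMost[symmetric])
  then show ?case using Suc by (simp add: algebra_simps)
qed simp

text \<open>With \<open>x = exp s\<close> the function is \<open>exp (a * s) - c * exp s\<close>.
  Its second derivative is nonnegative as long as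
  \<open>c \<le> a\<^sup>2 * exp ((a - 1) * s)\<close>; since \<open>a < 1\<close> the strongest
  requirement is at \<open>s = ln \<Lambda>\<close>, which is the hypothesis on
  \<open>c\<close>.\<close>

lemma tangent_in_log:
  fixes a c \<Lambda> x y :: real
  assumes x: "0 < x" "x \<le> \<Lambda>" and y: "0 < y" "y \<le> \<Lambda>" and c: "0 \<le> c" "c \<le> a\<^sup>2 * \<Lambda> powr (a - 1)"
    and a: "0 < a" "a < 1"
  shows "x powr a - c * x \<ge> y powr a - c * y + (a * y powr a - c * y) * (ln x - ln y)"
proof -
  have "(a * exp (a * ln y) - c * exp (ln y)) * (ln x - ln y)
    \<le> (exp (a * ln x) - c * exp (ln x)) - (exp (a * ln y) - c * exp (ln y))"
  proof (rule f''_imp_f'[of "{..ln \<Lambda>}" "\<lambda>s. exp (a * s) - c * exp s"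
        "\<lambda>s. a * exp (a * s) - c * exp s" "\<lambda>s. a\<^sup>2 * exp (a * s) - c * exp s"])
    fix s assume s: "s \<in> {..ln \<Lambda>}"
    show "((\<lambda>s. exp (a * s) - c * exp s) has_real_derivative a * exp (a * s) - c * exp s) (at s)"
      by (auto intro!: derivative_eq_intros)
    show "((\<lambda>s. a * exp (a * s) - c * exp s) has_real_derivative a\<^sup>2 * exp (a * s) - c * exp s) (at s)"
      by (auto intro!: derivative_eq_intros simp: power2_eq_square)
    have "c \<le> a\<^sup>2 * exp ((a - 1) * ln \<Lambda>)" using c x by (simp add: powr_def)
    also have "\<dots> \<le> a\<^sup>2 * exp ((a - 1) * s)"
      using s a by (intro mult_left_mono) (auto simp: mult_left_mono_neg)
    finally have "c * exp s \<le> a\<^sup>2 * exp ((a - 1) * s) * exp s" by (simp add: mult_right_mono)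
    also have "\<dots> = a\<^sup>2 * exp (a * s)" by (simp add: mult.assoc exp_add[symmetric] algebra_simps)
    finally show "0 \<le> a\<^sup>2 * exp (a * s) - c * exp s" by simp
  qed (use x y in auto)
  then show ?thesis using x y by (simp add: powr_def)
qed

text \<open>The derivative of a convex function is monotone: add the tangent inequalities at the two
  points.\<close>

lemma powr_log_derivative_mono:
  fixes a c \<Lambda> x y :: real
  assumes xy: "0 < x" "x \<le> y" "y \<le> \<Lambda>" and c: "0 \<le> c" "c \<le> a\<^sup>2 * \<Lambda> powr (a - 1)" and a: "0 < a" "a < 1"
  shows "a * x powr a - c * x \<le> a * y powr a - c * y"
proof -
  have "(a * x powr a - c * x) * (ln y - ln x) \<le> (y powr a - c * y) - (x powr a - c * x)"
    using tangent_in_log[of y \<Lambda> x c a] assms by simp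
  moreover have "(a * y powr a - c * y) * (ln x - ln y) \<le> (x powr a - c * x) - (y powr a - c * y)"
    using tangent_in_log[of x \<Lambda> y c a] assms by simp
  ultimately have "0 \<le> ((a * y powr a - c * y) - (a * x powr a - c * x)) * (ln y - ln x)"
    by (simp add: algebra_simps)
  moreover have "ln y - ln x > 0" if "x \<noteq> y" using that xy by simp
  ultimately show ?thesis by (cases "x = y") (auto simp: zero_le_mult_iff)
qed

text \<open>For \<open>0 < x \<le> \<Lambda>\<close> the bound on \<open>c\<close> gives
  \<open>c * x \<le> a\<^sup>2 * x powr a\<close>, and \<open>a < 1\<close> does the rest.\<close>

lemma powr_log_derivative_nonneg:
  fixes a c \<Lambda> x :: real
  assumes x: "0 \<le> x" "x \<le> \<Lambda>" and c: "0 \<le> c" "c \<le> a\<^sup>2 * \<Lambda> powr (a - 1)" and a: "0 < a" "a < 1"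
  shows "0 \<le> a * x powr a - c * x" "0 \<le> x powr a - c * x"
proof -
  have "c * x \<le> a * x powr a"
  proof (cases "x = 0")
    case False
    then have x0: "x > 0" using x by simp
    have "c \<le> a\<^sup>2 * x powr (a - 1)"
      using c(2) powr_mono2'[of "a - 1" x \<Lambda>] x x0 a mult_left_mono[of "\<Lambda> powr (a-1)" "x powr (a-1)" "a\<^sup>2"]
      by (smt (verit) zero_le_power2)
    also have "\<dots> \<le> a * x powr (a - 1)"
      using a by (intro mult_right_mono) (auto simp: power2_eq_square)
    finally have "c * x \<le> a * x powr (a - 1) * x" using x0 by simp
    also have "\<dots> = a * x powr a" using x0 by (simp add: powr_diff)
    finally show ?thesis .
  qed simp
  moreover have "a * x powr a \<le> x powr a" using a by (simp add: mult_left_le_one_le)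
  ultimately show "0 \<le> a * x powr a - c * x" "0 \<le> x powr a - c * x" by auto
qed

text \<open>Karamata's argument for a function that is convex in \<open>ln x\<close>, by summation by parts.\<close>

lemma log_majorisation_sum_ge:
  fixes l \<beta> s :: "nat \<Rightarrow> real"
  assumes l: "\<And>k. k < n \<Longrightarrow> 0 < l k" "\<And>k. k < n \<Longrightarrow> l k \<le> \<Lambda>"
    and \<beta>: "\<And>k. k < n \<Longrightarrow> 0 < \<beta> k" "\<And>k. k < n \<Longrightarrow> \<beta> k \<le> \<Lambda>"
      "\<And>k. Suc k < n \<Longrightarrow> \<beta> (Suc k) \<le> \<beta> k"
    and c: "0 \<le> c" "c \<le> a\<^sup>2 * \<Lambda> powr (a - 1)" and a: "0 < a" "a < 1"
    and s: "\<And>k. k < n \<Longrightarrow> s k \<le> (\<Sum>j\<le>k. ln (l j) - ln (\<beta> j))"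
    and w: "\<And>k. w k = (if k < n then a * \<beta> k powr a - c * \<beta> k else 0)"
  shows "(\<Sum>k<n. l k powr a - c * l k) \<ge>
    (\<Sum>k<n. \<beta> k powr a - c * \<beta> k) + (\<Sum>k<n. (w k - w (Suc k)) * s k)"
    and "w (Suc k) \<le> w k"
proof -
  show w_mono: "w (Suc k) \<le> w k" for k
  proof (cases "Suc k < n")
    case True
    then show ?thesis unfolding w using \<beta> c a
      by (auto intro!: powr_log_derivative_mono[of _ _ \<Lambda>])
  next
    case False
    then show ?thesis unfolding w
      using \<beta>[of k] powr_log_derivative_nonneg(1)[OF _ _ c a, of "\<beta> k"] by auto
  qed
  have "(\<Sum>k<n. (w k - w (Suc k)) * s k) \<le> (\<Sum>k<n. (w k - w (Suc k)) * (\<Sum>j\<le>k. ln (l j) - ln (\<beta> j)))"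
    by (intro sum_mono mult_left_mono s) (auto simp: w_mono)
  \<comment> \<open>The value \<open>w n = 0\<close> removes the boundary term. In exchange the last
    difference of weights is \<open>w (n - 1)\<close> itself, which is why the logarithmic
    derivative has to be nonnegative and not only monotone.\<close>
  also have "\<dots> = (\<Sum>k<n. w k * (ln (l k) - ln (\<beta> k)))"
    by (subst sum_by_parts) (simp add: w)
  also have "\<dots> \<le> (\<Sum>k<n. (l k powr a - c * l k) - (\<beta> k powr a - c * \<beta> k))"
  proof (rule sum_mono)
    fix k assume "k \<in> {..<n}"
    then have k: "k < n" by simp
    show "w k * (ln (l k) - ln (\<beta> k)) \<le> (l k powr a - c * l k) - (\<beta> k powr a - c * \<beta> k)"
      using tangent_in_log[OF l(1,2)[OF k] \<beta>(1,2)[OF k] c a] k by (simp add: w)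
  qed
  finally show "(\<Sum>k<n. l k powr a - c * l k) \<ge>
    (\<Sum>k<n. \<beta> k powr a - c * \<beta> k) + (\<Sum>k<n. (w k - w (Suc k)) * s k)"
    by (simp add: sum_subtractf)
qed

section \<open>Pointwise maxima of moduli of polynomials\<close>

lemma cmod_poly_le_on_disc:
  assumes "\<And>t. cmod t = 1 \<Longrightarrow> cmod (poly P t) \<le> K" and "cmod t \<le> 1"
  shows "cmod (poly P t) \<le> K"
proof (rule maximum_modulus_frontier[of "poly P" "cball 0 1"])
  show "poly P holomorphic_on interior (cball 0 1)" by (intro holomorphic_intros)
  show "continuous_on (closure (cball 0 1)) (poly P)" by (intro continuous_intros)
qed (use assms in \<open>auto simp: frontier_cball\<close>)

text \<open>As in Schwarz's lemma, \<open>(P - P 0) / t\<close> is a polynomial bounded by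
  \<open>2 * K\<close> on the unit circle, hence on the disc.\<close>

lemma cmod_poly_diff_le:
  assumes K: "\<And>t. cmod t = 1 \<Longrightarrow> cmod (poly P t) \<le> K" and t: "cmod t \<le> 1"
  shows "cmod (poly P t - poly P 0) \<le> 2 * K * cmod t"
proof -
  obtain c Q where P: "P = pCons c Q" by (cases P)
  have c: "cmod c \<le> K" using cmod_poly_le_on_disc[OF K, where t = 0] by (simp add: P)
  have "cmod (poly Q s) \<le> 2 * K" if "cmod s = 1" for s
  proof -
    have "poly P s - c = s * poly Q s" by (simp add: P)
    then have "cmod (poly Q s) = cmod (poly P s - c)" using that by (simp add: norm_mult)
    also have "\<dots> \<le> cmod (poly P s) + cmod c" by (rule norm_triangle_ineq4)
    finally show ?thesis using K[OF that] c by simp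
  qed
  then have "cmod (poly Q t) \<le> 2 * K" using cmod_poly_le_on_disc t by blast
  then have "cmod t * cmod (poly Q t) \<le> cmod t * (2 * K)" by (rule mult_left_mono) simp
  then show ?thesis by (simp add: P norm_mult mult_ac)
qed

text \<open>The exponent \<open>m\<close> is the least order of vanishing at \<open>0\<close> within
  the family, and \<open>C\<close> is the supremum of the moduli of the coefficients of
  \<open>t ^ m\<close>. That supremum need not be attained, hence the \<epsilon> in the conclusion.
  The limit exists although the maximising polynomial varies with \<open>t\<close>, because all
  members share one Lipschitz bound at \<open>0\<close>.\<close>

lemma poly_envelope_asymptotic:
  fixes F :: "complex poly set" and g :: "complex \<Rightarrow> real"
  assumes le: "\<And>P t. P \<in> F \<Longrightarrow> cmod (poly P t) \<le> g t"
    and att: "\<And>t. g t > 0 \<Longrightarrow> \<exists>P\<in>F. cmod (poly P t) = g t"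
    and bd: "\<And>t. cmod t \<le> 1 \<Longrightarrow> g t \<le> K" and nz: "P0 \<in> F" "P0 \<noteq> 0"
  obtains m C where "C > 0" "((\<lambda>t. g t / cmod t ^ m) \<longlongrightarrow> C) (at 0)"
    "\<And>\<epsilon>. \<epsilon> > 0 \<Longrightarrow> \<exists>P\<in>F. \<exists>Q. P = monom 1 m * Q \<and> cmod (poly Q 0) > C - \<epsilon>"
    "m = 0 \<Longrightarrow> g 0 = C" "m > 0 \<Longrightarrow> g 0 = 0"
proof -
  define m where "m = (LEAST m. \<exists>P\<in>F. coeff P m \<noteq> 0)"
  have "\<exists>m. \<exists>P\<in>F. coeff P m \<noteq> 0" using nz by (metis leading_coeff_0_iff)
  from LeastI_ex[OF this] obtain P1 where P1: "P1 \<in> F" "coeff P1 m \<noteq> 0"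
    unfolding m_def[symmetric] by blast
  have low: "coeff P k = 0" if "P \<in> F" "k < m" for P k
    using that not_less_Least[of k "\<lambda>m. \<exists>P\<in>F. coeff P m \<noteq> 0"] unfolding m_def by blast
  have fac: "\<exists>Q. P = monom 1 m * Q" if "P \<in> F" for P
    using low[OF that] monom_1_dvd_iff'[of m P] by (auto simp: dvd_def)
  have g0: "0 \<le> g t" for t using order_trans[OF norm_ge_zero le[OF nz(1)]] .
  have K0: "0 \<le> K" using order_trans[OF g0 bd[of 0]] by simp
  \<comment> \<open>On the unit circle division by \<open>t ^ m\<close> leaves the modulus
    unchanged, so the quotients inherit the bound \<open>K\<close> and with it the common Lipschitz
    constant \<open>2 * K\<close>.\<close>
  have Q_le: "cmod (poly Q t) \<le> K" if "monom 1 m * Q \<in> F" "cmod t = 1" for Q t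
    using le[OF that(1), of t] bd[of t] that(2) by (simp add: poly_monom norm_mult norm_power)
  define S where "S = {cmod (poly Q 0) |Q. monom 1 m * Q \<in> F}"
  define C where "C = Sup S"
  have S_le: "x \<le> K" if "x \<in> S" for x
    using that cmod_poly_le_on_disc[OF Q_le, of _ 0] by (auto simp: S_def)
  then have bddS: "bdd_above S" by (rule bdd_aboveI)
  have C_ge: "cmod (poly Q 0) \<le> C" if "monom 1 m * Q \<in> F" for Q
    unfolding C_def by (rule cSup_upper[OF _ bddS]) (use that in \<open>auto simp: S_def\<close>)
  obtain Q1 where Q1: "P1 = monom 1 m * Q1" using fac P1 by blast
  have "coeff Q1 0 \<noteq> 0" using P1(2) by (simp add: Q1 coeff_monom_mult)
  then have "cmod (poly Q1 0) > 0" by (simp add: poly_0_coeff_0)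
  have Q1F: "monom 1 m * Q1 \<in> F" using P1(1) unfolding Q1 .
  have C: "C > 0" using \<open>cmod (poly Q1 0) > 0\<close> C_ge[OF Q1F] by (rule less_le_trans)
  have Sne: "S \<noteq> {}" using Q1F by (auto simp: S_def)
  have ex: "\<exists>Q. monom 1 m * Q \<in> F \<and> cmod (poly Q 0) > C - \<epsilon>" if "\<epsilon> > 0" for \<epsilon>
    using less_cSupD[OF Sne, of "C - \<epsilon>"] that by (auto simp: C_def S_def)
  have up: "g t \<le> cmod t ^ m * (C + 2 * K * cmod t)" if t: "cmod t \<le> 1" for t
  proof (cases "g t > 0")
    case True
    then obtain P where P: "P \<in> F" "cmod (poly P t) = g t" using att by blast
    then obtain Q where Q: "P = monom 1 m * Q" using fac by blast
    have "cmod (poly Q t) \<le> cmod (poly Q 0) + cmod (poly Q t - poly Q 0)"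
      by (metis add_diff_cancel_left' diff_add_cancel norm_triangle_ineq add.commute)
    also have "\<dots> \<le> C + 2 * K * cmod t"
      using P Q by (intro add_mono C_ge cmod_poly_diff_le t Q_le) auto
    finally have "cmod t ^ m * cmod (poly Q t) \<le> cmod t ^ m * (C + 2 * K * cmod t)"
      by (intro mult_left_mono) auto
    then show ?thesis using P(2) by (simp add: Q poly_monom norm_mult norm_power)
  next
    case False
    have "0 \<le> cmod t ^ m * (C + 2 * K * cmod t)" using C K0 by simp
    with False show ?thesis by linarith
  qed
  have lo: "cmod t ^ m * (C - \<epsilon> - 2 * K * cmod t) \<le> g t" if t: "cmod t \<le> 1" and "\<epsilon> > 0" for t \<epsilon>
  proof -
    obtain Q where Q: "monom 1 m * Q \<in> F" "cmod (poly Q 0) > C - \<epsilon>" using ex \<open>\<epsilon> > 0\<close> by blast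
    have "C - \<epsilon> - 2 * K * cmod t \<le> cmod (poly Q 0) - cmod (poly Q t - poly Q 0)"
      using Q cmod_poly_diff_le[OF Q_le[OF Q(1)] t] by simp
    also have "\<dots> \<le> cmod (poly Q t)"
      by (metis norm_minus_commute norm_triangle_ineq2 diff_le_eq add.commute le_diff_eq)
    finally have "cmod t ^ m * (C - \<epsilon> - 2 * K * cmod t) \<le> cmod t ^ m * cmod (poly Q t)"
      by (intro mult_left_mono) auto
    also have "\<dots> \<le> g t" using le[OF Q(1), of t] by (simp add: poly_monom norm_mult norm_power)
    finally show ?thesis .
  qed
  have lim: "((\<lambda>t. g t / cmod t ^ m) \<longlongrightarrow> C) (at 0)"
  proof (rule LIM_I)
    fix e :: real assume e: "0 < e"
    define \<delta> where "\<delta> = min 1 (e / (4 * (K + 1)))"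
    have "dist (g t / cmod t ^ m) C < e" if t: "t \<noteq> 0" "cmod t < \<delta>" for t
    proof -
      have t1: "cmod t \<le> 1" using t by (simp add: \<delta>_def)
      have p: "cmod t ^ m > 0" using t by simp
      have "2 * K * cmod t \<le> 2 * (K + 1) * cmod t" by (simp add: mult_right_mono)
      also have "\<dots> < 2 * (K + 1) * (e / (4 * (K + 1)))"
        using t K0 by (intro mult_strict_left_mono) (auto simp: \<delta>_def)
      also have "\<dots> = e / 2" using K0 by (simp add: field_simps)
      finally have *: "2 * K * cmod t < e / 2" .
      have "g t / cmod t ^ m \<le> C + 2 * K * cmod t"
        using up[OF t1] p by (simp add: divide_le_eq mult.commute)
      moreover have "C - e / 2 - 2 * K * cmod t \<le> g t / cmod t ^ m"
        using lo[OF t1, of "e/2"] p e by (simp add: le_divide_eq mult.commute)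
      ultimately show ?thesis using * by (simp add: dist_real_def)
    qed
    moreover have "\<delta> > 0" using e K0 by (simp add: \<delta>_def)
    ultimately show "\<exists>s>0. \<forall>x. x \<noteq> 0 \<and> norm (x - 0) < s \<longrightarrow> norm (g x / cmod x ^ m - C) < e"
      by (intro exI[of _ \<delta>]) (auto simp: dist_real_def)
  qed
  show thesis
  proof (rule that[OF C lim])
    show "\<exists>P\<in>F. \<exists>Q. P = monom 1 m * Q \<and> cmod (poly Q 0) > C - \<epsilon>" if "\<epsilon> > 0" for \<epsilon>
      using ex[OF that] by blast
    show "g 0 = C" if "m = 0"
    proof (rule antisym)
      show "g 0 \<le> C" using up[of 0] that by simp
      show "C \<le> g 0"
        by (rule field_le_epsilon) (use lo[of 0] that in \<open>simp add: algebra_simps\<close>)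
    qed
    show "g 0 = 0" if "m > 0" using up[of 0] g0[of 0] that by (simp add: power_0_left)
  qed
qed

section \<open>Quadratic growth of the Schatten sum along a complex line\<close>

lemma singular_system_value:
  assumes X: "compact_operator X" and sys: "singular_system X n e l" and ij: "i < n" "j < n"
  shows "cinner (X (e i)) (X (e j)) = (if i = j then complex_of_real (l i) else 0)"
proof -
  have "cinner (X (e i)) (X (e j)) = cnj (cinner (X (e j)) (X (e i)))" by (rule cinner_commute)
  also have "\<dots> = cnj (cinner (e j) (scaleC (complex_of_real (l i)) (e i)))"
    using sys ij by (simp add: cinner_hilbert_adjoint[OF X] singular_system_def)
  also have "\<dots> = (if i = j then complex_of_real (l i) else 0)"
    using sys ij by (simp add: cinner_scaleC_right singular_system_def orthonormal_def)
  finally show ?thesis .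
qed

lemma singular_system_norm:
  assumes "compact_operator X" "singular_system X n e l" "i < n"
  shows "(norm (X (e i)))\<^sup>2 = l i"
  using singular_system_value[OF assms(1,2) assms(3,3)] by (simp add: cinner_self del: of_real_power)

lemma singular_system_antimono:
  assumes X: "compact_operator X" and sys: "singular_system X n e l" and ij: "i \<le> j" "j < n"
  shows "l j \<le> l i"
proof -
  have o: "orthonormal n e" using sys by (simp add: singular_system_def)
  have "\<forall>k<i. cinner (e j) (e k) = 0" using o ij by (auto simp: orthonormal_def)
  then have "(norm (X (e j)))\<^sup>2 \<le> l i * (norm (e j))\<^sup>2" using sys ij by (auto simp: singular_system_def)
  then show ?thesis using singular_system_norm[OF X sys ij(2)] orthonormal_norm[OF o ij(2)] by simp
qed

lemma norm_add_scaleC_square: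
  fixes x y :: "'a::complex_hilbert"
  shows "(norm (x + scaleC t y))\<^sup>2 = (norm x)\<^sup>2 + 2 * Re (t * cinner y x) + (cmod t)\<^sup>2 * (norm y)\<^sup>2"
proof -
  have "(norm (x + scaleC t y))\<^sup>2 = (norm x)\<^sup>2 + 2 * inner (scaleC t y) x + (norm (scaleC t y))\<^sup>2"
    by (simp add: power2_norm_eq_inner inner_add_left inner_add_right inner_commute)
  then show ?thesis
    by (simp add: Re_cinner[symmetric] cinner_scaleC_left norm_scaleC power_mult_distrib)
qed

lemma orthonormal_extend_to:
  assumes v: "orthonormal n v"
  obtains N v' where "n \<le> N" "orthonormal N v'" "\<And>i. i < n \<Longrightarrow> v' i = v i" "proj N v' x = x"
proof (cases "proj n v x = x")
  case True
  then show thesis using v by (intro that[of n v]) auto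
next
  case False
  from orthonormal_extend_residual[OF v this] obtain y where
    "orthonormal (Suc n) (v(n := y))" "proj (Suc n) (v(n := y)) x = x" by blast
  then show thesis by (intro that[of "Suc n" "v(n := y)"]) auto
qed

text \<open>Turns \<open>B x0 \<noteq> 0\<close> into a lower bound for the trace of
  \<open>B\<close> adjoint times \<open>B\<close> over any span containing \<open>x0\<close>, with a
  constant that does not depend on the family.\<close>

lemma norm_square_le_sum_orthonormal:
  fixes B :: "'a::complex_hilbert \<Rightarrow> 'a"
  assumes B: "clinear B" and v: "orthonormal n v" and x: "proj n v x = x"
  shows "(norm (B x))\<^sup>2 \<le> (norm x)\<^sup>2 * (\<Sum>i<n. (norm (B (v i)))\<^sup>2)"
proof -
  have "B x = (\<Sum>i<n. scaleC (cinner x (v i)) (B (v i)))"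
    using x by (metis (no_types, lifting) proj_def clinear_sum[OF B] clinear_scaleC[OF B] sum.cong)
  then have "norm (B x) \<le> (\<Sum>i<n. cmod (cinner x (v i)) * norm (B (v i)))"
    by (metis (no_types, lifting) norm_sum norm_scaleC sum.cong)
  then have "(norm (B x))\<^sup>2 \<le> (\<Sum>i<n. cmod (cinner x (v i)) * norm (B (v i)))\<^sup>2"
    by (intro power_mono) auto
  also have "\<dots> \<le> (\<Sum>i<n. (cmod (cinner x (v i)))\<^sup>2) * (\<Sum>i<n. (norm (B (v i)))\<^sup>2)"
    by (rule Cauchy_Schwarz_ineq_sum)
  also have "(\<Sum>i<n. (cmod (cinner x (v i)))\<^sup>2) = (norm x)\<^sup>2" using x proj_eq_iff[OF v] by blast
  finally show ?thesis .
qed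

lemma left_singular_vectors:
  fixes A :: "'a::complex_hilbert \<Rightarrow> 'a"
  assumes eq: "\<And>i j. i < n \<Longrightarrow> j < n \<Longrightarrow>
      cinner (A (v i)) (A (v j)) = (if i = j then complex_of_real ((s i)\<^sup>2) else 0)"
    and s: "\<And>i. i < n \<Longrightarrow> s i > 0"
  defines "u \<equiv> \<lambda>i. scaleC (complex_of_real (1 / s i)) (A (v i))"
  shows "orthonormal n u"
    and "\<And>i j. i < n \<Longrightarrow> j < n \<Longrightarrow> cinner (A (v i)) (u j) = (if i = j then complex_of_real (s i) else 0)"
proof -
  show 1: "cinner (A (v i)) (u j) = (if i = j then complex_of_real (s i) else 0)" if "i < n" "j < n" for i j
    using s[OF that(1)] eq[OF that] by (simp add: u_def cinner_scaleC_right power2_eq_square)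
  show "orthonormal n u" unfolding orthonormal_def
  proof (intro allI impI)
    fix i j assume ij: "i < n" "j < n"
    have "cinner (u i) (u j) = complex_of_real (1 / s i) * cinner (A (v i)) (u j)"
      by (simp add: u_def cinner_scaleC_left)
    then show "cinner (u i) (u j) = (if i = j then 1 else 0)"
      using 1[OF ij] s[OF ij(1)] by (cases "i = j") auto
  qed
qed

text \<open>A two-uniform PL-convexity estimate at the point \<open>A\<close>. The term \<open>\<kappa> * r\<^sup>2\<close> is obtained by splitting
  \<open>x powr (p/2)\<close> into \<open>c * x\<close>, whose trace grows quadratically along \<open>A + t B\<close>, and a remainder
  that is still convex in \<open>ln x\<close> on the relevant range, so that the minors of \<open>A + t B\<close>, being
  polynomials in \<open>t\<close>, bound it from below by the maximum principle.\<close>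

lemma schatten_sum_circle_lower_bound:
  fixes A B :: "'a::complex_hilbert \<Rightarrow> 'a"
  defines "X \<equiv> \<lambda>t x. A x + scaleC t (B x)"
  assumes p: "0 < p" "p < 2" and cB: "compact_operator B" and B: "B x0 \<noteq> 0"
    and cX: "\<And>t. cmod t < 1 \<Longrightarrow> X t \<in> schatten_class (ereal p)"
  shows "\<exists>\<kappa>>0. \<forall>r \<epsilon>. 0 < r \<longrightarrow> r < 1 \<longrightarrow> 0 < \<epsilon> \<longrightarrow>
    (\<exists>t. cmod t = r \<and> schatten_sum p A + \<kappa> * r\<^sup>2 - \<epsilon> \<le> schatten_sum p (X t))"
proof -
  have X0: "X 0 = A" by (simp add: X_def)
  have A: "A \<in> schatten_class (ereal p)" using cX[of 0] X0 by simp
  then have cA: "compact_operator A" by (simp add: schatten_class_iff)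
  note linA = compact_operator_clinear[OF cA] and linB = compact_operator_clinear[OF cB]
  obtain CA where CA: "CA > 0" "\<And>x. norm (A x) \<le> CA * norm x" using compact_operator_bounded[OF cA] by blast
  obtain CB where CB: "CB > 0" "\<And>x. norm (B x) \<le> CB * norm x" using compact_operator_bounded[OF cB] by blast
  define a where "a = p / 2"
  have a: "0 < a" "a < 1" using p by (auto simp: a_def)
  \<comment> \<open>A common bound for the squared singular values of all \<open>X t\<close> with
    \<bar>t\<bar> \<open>< 1\<close>; \<open>c\<close> is then the largest constant allowed by the
    convexity estimate up to \<Lambda>.\<close>
  define \<Lambda> where "\<Lambda> = (CA + CB)\<^sup>2"
  define c where "c = a\<^sup>2 * \<Lambda> powr (a - 1)"
  have \<Lambda>: "\<Lambda> > 0" using CA CB by (simp add: \<Lambda>_def)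
  have c: "0 < c" "0 \<le> c" "c \<le> a\<^sup>2 * \<Lambda> powr (a - 1)" using a \<Lambda> by (auto simp: c_def)
  have x0: "x0 \<noteq> 0" using B clinear_zero[OF linB] by auto
  define \<kappa> where "\<kappa> = c * ((norm (B x0))\<^sup>2 / (norm x0)\<^sup>2)"
  have \<kappa>: "\<kappa> > 0" using c B x0 by (simp add: \<kappa>_def)
  have linX: "clinear (X t)" for t
    unfolding X_def by (rule compact_operator_clinear[OF compact_operator_add_scaleC[OF cA cB]])
  have normX: "norm (X t x) \<le> (CA + CB) * norm x" if "cmod t < 1" for t x
  proof -
    have "norm (X t x) \<le> norm (A x) + cmod t * norm (B x)"
      unfolding X_def by (metis norm_triangle_ineq norm_scaleC)
    also have "\<dots> \<le> CA * norm x + 1 * (CB * norm x)"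
      using that CA CB by (intro add_mono mult_mono) auto
    finally show ?thesis by (simp add: algebra_simps)
  qed
  have main: "\<exists>t. cmod t = r \<and> schatten_sum p A + \<kappa> * r\<^sup>2 - \<epsilon> \<le> schatten_sum p (X t)"
    if r: "0 < r" "r < 1" and \<epsilon>: "0 < \<epsilon>" for r \<epsilon>
  proof -
    obtain n v \<alpha> where v: "orthonormal n v" and \<alpha>: "\<And>i. i < n \<Longrightarrow> \<alpha> i > 0"
      and v\<alpha>: "\<And>i. i < n \<Longrightarrow> v i \<in> singular_space A (\<alpha> i)" and \<alpha>_mono: "\<And>i. Suc i < n \<Longrightarrow> \<alpha> (Suc i) \<le> \<alpha> i"
      and \<alpha>_sum: "schatten_sum p A - \<epsilon> / 2 \<le> (\<Sum>i<n. \<alpha> i powr p)"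
      using finite_singular_vectors[OF A half_gt_zero[OF \<epsilon>]] by metis
    have cAv: "cinner (A (v i)) (A (v j)) = (if i = j then complex_of_real ((\<alpha> i)\<^sup>2) else 0)"
      if "i < n" "j < n" for i j
      using cinner_singular_space[OF cA v\<alpha>[OF that(1)], of "v j"] v that
      by (simp add: orthonormal_def del: of_real_power)
    have nAv: "norm (A (v i)) = \<alpha> i" if "i < n" for i
      using norm_singular_space[OF cA v\<alpha>[OF that]] \<alpha>[OF that] orthonormal_norm[OF v that] by simp
    define u where "u = (\<lambda>i. scaleC (complex_of_real (1 / \<alpha> i)) (A (v i)))"
    have u: "orthonormal n u" and Au: "\<And>i j. i < n \<Longrightarrow> j < n \<Longrightarrow>
        cinner (A (v i)) (u j) = (if i = j then complex_of_real (\<alpha> i) else 0)"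
      using left_singular_vectors[where A = A and v = v and n = n and s = \<alpha>, OF cAv \<alpha>]
      unfolding u_def by blast+
    \<comment> \<open>At most one vector is adjoined, so that \<open>x0\<close> lies in the span and
      the trace over \<open>v'\<close> grows at least by the rate hidden in \<kappa>, however small
      the part of \<open>A\<close> captured by \<open>v\<close> is.\<close>
    obtain N v' where N: "n \<le> N" and v': "orthonormal N v'" and v'v: "\<And>i. i < n \<Longrightarrow> v' i = v i"
      and px: "proj N v' x0 = x0" using orthonormal_extend_to[OF v, of x0] by metis
    define \<beta> where "\<beta> = (\<Sum>i<N. cinner (B (v' i)) (A (v' i)))"
    have "\<forall>k. \<exists>P. \<forall>t. minor (Suc k) (X t) v u = poly P t"
      unfolding X_def using minor_affine_poly by blast
    then obtain P where P: "\<And>k t. minor (Suc k) (X t) v u = poly (P k) t" by metis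
    have P0: "poly (P k) 0 = (\<Prod>j<Suc k. complex_of_real (\<alpha> j))" if "k < n" for k
      using minor_diagonal[of "Suc k" A v u "\<lambda>i. complex_of_real (\<alpha> i)"] Au that P[of k 0] X0 by simp
    have P0nz: "poly (P k) 0 \<noteq> 0" if k: "k < n" for k
    proof -
      have "\<alpha> j \<noteq> 0" if "j < Suc k" for j using \<alpha>[of j] that k by simp
      then show ?thesis unfolding P0[OF k] by (simp add: prod_zero_iff)
    qed
    define w where "w k = (if k < n then a * ((\<alpha> k)\<^sup>2) powr a - c * (\<alpha> k)\<^sup>2 else 0)" for k
    \<comment> \<open>The trace of \<open>X t\<close> has a linear term
      \<open>2 * Re (t * \<beta>)\<close> of unknown sign. Adjoining
      \<open>exp (t * \<beta>)\<close>, whose logarithmic modulus is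
      \<open>Re (t * \<beta>)\<close>, to the minors lets one application of the maximum principle
      control the minors and this term at the same \<open>t\<close>. The factor \<open>2\<close> in
      the weights \<open>W\<close> of the minors occurs because minors bound products of singular
      values and \<open>l\<close> holds their squares.\<close>
    define f where "f k = (if k < n then poly (P k) else (\<lambda>t. exp (t * \<beta>)))" for k
    define W where "W k = (if k < n then 2 * (w k - w (Suc k)) else 2 * c)" for k
    have \<alpha>\<Lambda>: "(\<alpha> k)\<^sup>2 \<le> \<Lambda>" if "k < n" for k
    proof -
      have "\<alpha> k \<le> CA" using CA(2)[of "v k"] nAv[OF that] orthonormal_norm[OF v that] by simp
      then show ?thesis unfolding \<Lambda>_def using \<alpha>[OF that] CA CB by (intro power_mono) auto
    qed
    have \<alpha>2_mono: "(\<alpha> (Suc k))\<^sup>2 \<le> (\<alpha> k)\<^sup>2" if "Suc k < n" for k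
      using \<alpha>_mono[OF that] \<alpha>[OF that] by (intro power_mono) auto
    have w_mono: "w (Suc k) \<le> w k" for k
    proof (cases "Suc k < n")
      case True
      then show ?thesis unfolding w_def
        using powr_log_derivative_mono[OF _ \<alpha>2_mono[OF True] \<alpha>\<Lambda> c(2,3) a] \<alpha>[OF True] by simp
    next
      case False
      then show ?thesis unfolding w_def
        using powr_log_derivative_nonneg(1)[OF _ _ c(2,3) a, of "(\<alpha> k)\<^sup>2"] \<alpha>\<Lambda>[of k] by auto
    qed
    have "\<exists>t. cmod t = r \<and> (\<forall>i\<in>{..n}. f i t \<noteq> 0) \<and>
        (\<Sum>i\<in>{..n}. W i * ln (cmod (f i t) / cmod (f i 0))) \<ge> - (\<epsilon> / 2)"
    proof (rule exists_on_sphere_weighted_log_ge)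
      show "f i holomorphic_on UNIV" for i unfolding f_def by (auto intro!: holomorphic_intros)
      show "f i 0 \<noteq> 0" for i using P0nz by (simp add: f_def)
      show "0 \<le> W i" for i using w_mono c by (simp add: W_def)
    qed (use r \<epsilon> in auto)
    then obtain t where t: "cmod t = r" "\<And>i. i \<le> n \<Longrightarrow> f i t \<noteq> 0"
      "(\<Sum>i\<le>n. W i * ln (cmod (f i t) / cmod (f i 0))) \<ge> - (\<epsilon> / 2)" by auto
    have Xt: "X t \<in> schatten_class (ereal p)" using cX t r by simp
    then have cXt: "compact_operator (X t)" by (simp add: schatten_class_iff)
    obtain e l where sys: "singular_system (X t) N e l" using singular_system_exists[OF cXt v'] by blast
    have e: "orthonormal N e" and l0: "\<And>j. j < N \<Longrightarrow> 0 \<le> l j" using sys by (auto simp: singular_system_def)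
    have l\<Lambda>: "l j \<le> \<Lambda>" if "j < N" for j
    proof -
      have "norm (X t (e j)) \<le> CA + CB" using normX[of t "e j"] t r orthonormal_norm[OF e that] by simp
      then have "(norm (X t (e j)))\<^sup>2 \<le> \<Lambda>" unfolding \<Lambda>_def by (intro power_mono) auto
      then show ?thesis using singular_system_norm[OF cXt sys that] by simp
    qed
    have Ple: "cmod (poly (P k) t) \<le> (\<Prod>j<Suc k. sqrt (l j))" if "k < n" for k
      unfolding P[symmetric]
      by (rule cmod_minor_le[OF linX singular_system_mono[OF sys]])
        (use that N v u in \<open>auto intro: orthonormal_mono\<close>)
    have Pt: "poly (P k) t \<noteq> 0" if "k < n" for k using t(2)[of k] that by (simp add: f_def)
    have lpos: "0 < l k" if "k < n" for k
    proof -
      have "0 < (\<Prod>j<Suc k. sqrt (l j))" using Pt[OF that] by (intro less_le_trans[OF _ Ple[OF that]]) simp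
      then have "l k \<noteq> 0" by auto
      then show ?thesis using l0[of k] that N by simp
    qed
    define s where "s k = 2 * ln (cmod (poly (P k) t) / cmod (poly (P k) 0))" for k
    have s_le: "s k \<le> (\<Sum>j\<le>k. ln (l j) - ln ((\<alpha> j)\<^sup>2))" if k: "k < n" for k
    proof -
      have lk: "\<And>j. j \<in> {..k} \<Longrightarrow> 0 < l j" "\<And>j. j \<in> {..k} \<Longrightarrow> 0 < \<alpha> j" using lpos \<alpha> k by auto
      have pos: "0 < cmod (poly (P k) 0)" using P0nz[OF k] by simp
      have "ln (cmod (poly (P k) t)) \<le> ln (\<Prod>j\<le>k. sqrt (l j))"
        using Ple[OF k] Pt[OF k] lk by (intro ln_mono) (auto simp: lessThan_Suc_atMost intro!: prod_pos)
      also have "\<dots> = (\<Sum>j\<le>k. ln (l j) / 2)"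
      proof -
        have "ln (\<Prod>j\<le>k. sqrt (l j)) = (\<Sum>j\<le>k. ln (sqrt (l j)))"
          by (rule ln_prod_pos) (use lk(1) in auto)
        also have "\<dots> = (\<Sum>j\<le>k. ln (l j) / 2)"
          by (intro sum.cong refl ln_sqrt less_imp_le lk)
        finally show ?thesis .
      qed
      finally have 1: "ln (cmod (poly (P k) t)) \<le> (\<Sum>j\<le>k. ln (l j) / 2)" .
      have "cmod (poly (P k) 0) = (\<Prod>j\<le>k. \<alpha> j)"
        unfolding P0[OF k] prod_norm[symmetric] lessThan_Suc_atMost
        using lk(2) by (intro prod.cong refl) (simp add: abs_of_pos)
      then have "ln (cmod (poly (P k) 0)) = (\<Sum>j\<le>k. ln (\<alpha> j))"
        using ln_prod_pos[of "{..k}" \<alpha>] lk(2) by simp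
      then have "s k \<le> 2 * ((\<Sum>j\<le>k. ln (l j) / 2) - (\<Sum>j\<le>k. ln (\<alpha> j)))"
        using 1 pos Pt[OF k] by (simp add: s_def ln_div)
      also have "\<dots> = (\<Sum>j\<le>k. ln (l j) - ln ((\<alpha> j)\<^sup>2))"
        unfolding sum_subtractf[symmetric] sum_distrib_left
        by (intro sum.cong refl) (simp add: ln_realpow)
      finally show ?thesis .
    qed
    have maj: "(\<Sum>k<n. ((\<alpha> k)\<^sup>2) powr a - c * (\<alpha> k)\<^sup>2) + (\<Sum>k<n. (w k - w (Suc k)) * s k)
        \<le> (\<Sum>k<n. l k powr a - c * l k)"
    proof (rule log_majorisation_sum_ge(1)[where \<Lambda> = \<Lambda> and w = w, OF lpos _ _ \<alpha>\<Lambda> \<alpha>2_mono c(2,3) a s_le])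
      show "l k \<le> \<Lambda>" if "k < n" for k using l\<Lambda> N that by simp
      show "0 < (\<alpha> k)\<^sup>2" if "k < n" for k using \<alpha>[OF that] by simp
    qed (auto simp: w_def)
    have "(\<Sum>i\<le>n. W i * ln (cmod (f i t) / cmod (f i 0)))
        = (\<Sum>i<n. W i * ln (cmod (f i t) / cmod (f i 0))) + W n * ln (cmod (f n t) / cmod (f n 0))"
      by (simp add: lessThan_Suc_atMost[symmetric])
    also have "(\<Sum>i<n. W i * ln (cmod (f i t) / cmod (f i 0))) = (\<Sum>k<n. (w k - w (Suc k)) * s k)"
      by (intro sum.cong) (auto simp: W_def f_def s_def)
    also have "W n * ln (cmod (f n t) / cmod (f n 0)) = 2 * c * Re (t * \<beta>)"
      by (simp add: W_def f_def)
    finally have log_ge: "- (\<epsilon> / 2) \<le> (\<Sum>k<n. (w k - w (Suc k)) * s k) + 2 * c * Re (t * \<beta>)"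
      using t(3) by simp
    \<comment> \<open>The remainder \<open>x powr a - c * x\<close> is nonnegative up to \<Lambda>,
      so the sum may be prolonged to the length \<open>N\<close> over which the trace is
      taken.\<close>
    have "(\<Sum>k<n. l k powr a - c * l k) \<le> (\<Sum>k<N. l k powr a - c * l k)"
      using N powr_log_derivative_nonneg(2)[OF l0 l\<Lambda> c(2,3) a] by (intro sum_mono2) auto
    also have "\<dots> = (\<Sum>k<N. l k powr a) - c * (\<Sum>k<N. l k)"
      by (simp add: sum_subtractf sum_distrib_left)
    finally have split: "(\<Sum>k<n. l k powr a - c * l k) + c * (\<Sum>k<N. l k) \<le> (\<Sum>k<N. l k powr a)" by simp
    have "(\<Sum>i<N. (norm (A (v' i)))\<^sup>2) + 2 * Re (t * \<beta>) + r\<^sup>2 * (\<Sum>i<N. (norm (B (v' i)))\<^sup>2)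
        = (\<Sum>i<N. (norm (X t (v' i)))\<^sup>2)"
      by (simp add: X_def norm_add_scaleC_square sum.distrib \<beta>_def sum_distrib_left t(1))
    also have "\<dots> \<le> (\<Sum>k<N. l k)" by (rule sum_norm_square_le_singular_values[OF linX sys v'])
    finally have kf: "(\<Sum>i<N. (norm (A (v' i)))\<^sup>2) + 2 * Re (t * \<beta>) + r\<^sup>2 * (\<Sum>i<N. (norm (B (v' i)))\<^sup>2)
        \<le> (\<Sum>k<N. l k)" .
    have "(\<Sum>k<n. (\<alpha> k)\<^sup>2) = (\<Sum>k<n. (norm (A (v' k)))\<^sup>2)" by (intro sum.cong) (auto simp: nAv v'v)
    also have "\<dots> \<le> (\<Sum>i<N. (norm (A (v' i)))\<^sup>2)" using N by (intro sum_mono2) auto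
    finally have An: "(\<Sum>k<n. (\<alpha> k)\<^sup>2) \<le> (\<Sum>i<N. (norm (A (v' i)))\<^sup>2)" .
    have Bx0: "(norm (B x0))\<^sup>2 / (norm x0)\<^sup>2 \<le> (\<Sum>i<N. (norm (B (v' i)))\<^sup>2)"
      using norm_square_le_sum_orthonormal[OF linB v' px] x0 by (simp add: divide_le_eq mult.commute)
    have "\<kappa> * r\<^sup>2 = c * (r\<^sup>2 * ((norm (B x0))\<^sup>2 / (norm x0)\<^sup>2))" by (simp add: \<kappa>_def)
    also have "\<dots> \<le> c * (r\<^sup>2 * (\<Sum>i<N. (norm (B (v' i)))\<^sup>2))"
      using c Bx0 by (intro mult_left_mono) auto
    finally have Bn: "\<kappa> * r\<^sup>2 \<le> c * (r\<^sup>2 * (\<Sum>i<N. (norm (B (v' i)))\<^sup>2))" .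
    have "c * ((\<Sum>k<n. (\<alpha> k)\<^sup>2) + 2 * Re (t * \<beta>) + r\<^sup>2 * (\<Sum>i<N. (norm (B (v' i)))\<^sup>2)) \<le> c * (\<Sum>k<N. l k)"
      using kf An c by (intro mult_left_mono) auto
    moreover have "c * ((\<Sum>k<n. (\<alpha> k)\<^sup>2) + 2 * Re (t * \<beta>) + r\<^sup>2 * (\<Sum>i<N. (norm (B (v' i)))\<^sup>2))
        = c * (\<Sum>k<n. (\<alpha> k)\<^sup>2) + 2 * c * Re (t * \<beta>) + c * (r\<^sup>2 * (\<Sum>i<N. (norm (B (v' i)))\<^sup>2))"
      by (simp only: distrib_left mult_ac)
    moreover have "(\<Sum>k<n. ((\<alpha> k)\<^sup>2) powr a) - c * (\<Sum>k<n. (\<alpha> k)\<^sup>2) + (\<Sum>k<n. (w k - w (Suc k)) * s k)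
        \<le> (\<Sum>k<n. l k powr a - c * l k)"
      using maj unfolding sum_subtractf sum_distrib_left .
    ultimately have "(\<Sum>k<n. ((\<alpha> k)\<^sup>2) powr a) + \<kappa> * r\<^sup>2 - \<epsilon> / 2 \<le> (\<Sum>k<N. l k powr a)"
      using split log_ge Bn by linarith
    moreover have "(\<Sum>k<n. ((\<alpha> k)\<^sup>2) powr a) = (\<Sum>k<n. \<alpha> k powr p)"
    proof (rule sum.cong[OF refl])
      fix k assume "k \<in> {..<n}"
      then show "((\<alpha> k)\<^sup>2) powr a = \<alpha> k powr p"
        using \<alpha>[of k] by (simp add: a_def powr_powr flip: powr_numeral)
    qed
    moreover have "(\<Sum>k<N. l k powr a) \<le> schatten_sum p (X t)"
      unfolding a_def by (rule sum_singular_values_le_schatten_sum[OF Xt sys])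
    ultimately show ?thesis using \<alpha>_sum t(1) by (intro exI[of _ t]) auto
  qed
  then show ?thesis using \<kappa> by blast
qed

section \<open>Diagonal operators of rank two\<close>

definition diag_operator :: "'a::complex_hilbert \<Rightarrow> 'a \<Rightarrow> complex \<Rightarrow> complex \<Rightarrow> 'a \<Rightarrow> 'a" where
  "diag_operator e f x y z = scaleC (x * cinner z e) e + scaleC (y * cinner z f) f"

context
  fixes e f :: "'a::complex_hilbert"
  assumes ef: "cinner e e = 1" "cinner f f = 1" "cinner e f = 0"
begin

lemma fe: "cinner f e = 0"
  using ef(3) by (subst cinner_commute) simp

lemma orthonormal_pair: "orthonormal 2 (\<lambda>i. if i = 0 then e else f)"
  using ef fe by (auto simp: orthonormal_def less_2_cases_iff)

lemma cinner_diag_operator: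
  "cinner (diag_operator e f x y z) e = x * cinner z e"
  "cinner (diag_operator e f x y z) f = y * cinner z f"
  using ef fe by (simp_all add: diag_operator_def cinner_add_left cinner_scaleC_left)

lemma norm_diag_operator:
  "(norm (diag_operator e f x y z))\<^sup>2 = (cmod x * cmod (cinner z e))\<^sup>2 + (cmod y * cmod (cinner z f))\<^sup>2"
  using norm_orthonormal_sum[OF orthonormal_pair, of "\<lambda>i. if i = 0 then x * cinner z e else y * cinner z f"]
  by (simp add: diag_operator_def numeral_2_eq_2 norm_mult)

lemma bessel_pair: "(cmod (cinner z e))\<^sup>2 + (cmod (cinner z f))\<^sup>2 \<le> (norm z)\<^sup>2"
  using bessel[OF orthonormal_pair, of z] by (simp add: numeral_2_eq_2)

lemma norm_diag_operator_le: "norm (diag_operator e f x y z) \<le> max (cmod x) (cmod y) * norm z"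
proof (rule power2_le_imp_le)
  let ?M = "max (cmod x) (cmod y)"
  have "(norm (diag_operator e f x y z))\<^sup>2 \<le> (?M * cmod (cinner z e))\<^sup>2 + (?M * cmod (cinner z f))\<^sup>2"
    unfolding norm_diag_operator by (intro add_mono power_mono mult_right_mono) auto
  also have "\<dots> = ?M\<^sup>2 * ((cmod (cinner z e))\<^sup>2 + (cmod (cinner z f))\<^sup>2)"
    by (simp add: power_mult_distrib distrib_left)
  also have "\<dots> \<le> ?M\<^sup>2 * (norm z)\<^sup>2" by (intro mult_left_mono bessel_pair) simp
  finally show "(norm (diag_operator e f x y z))\<^sup>2 \<le> (?M * norm z)\<^sup>2" by (simp add: power_mult_distrib)
qed (simp add: le_max_iff_disj)

lemma clinear_diag_operator: "clinear (diag_operator e f x y)"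
  by (rule clinearI)
    (simp_all add: diag_operator_def cinner_add_left cinner_scaleC_left scaleC_add_left
      scaleC_add_right scaleC_scaleC algebra_simps)

lemma compact_diag_operator: "compact_operator (diag_operator e f x y)"
proof -
  let ?K = "(\<lambda>(a, b). scaleC a e + scaleC b f) ` (cball 0 (cmod x) \<times> cball 0 (cmod y))"
  have "compact (cball 0 (cmod x) \<times> cball (0::complex) (cmod y) :: (complex \<times> complex) set)"
    by (intro compact_Times compact_cball)
  moreover have "continuous_on (cball 0 (cmod x) \<times> cball 0 (cmod y)) (\<lambda>(a, b). scaleC a e + scaleC b f)"
    unfolding case_prod_beta
    by (intro continuous_intros bounded_bilinear.continuous_on[OF bounded_bilinear_scaleC])
  ultimately have K: "compact ?K" by (rule compact_continuous_image[rotated])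
  have ef1: "norm e = 1" "norm f = 1"
    using orthonormal_norm[OF orthonormal_pair, of 0] orthonormal_norm[OF orthonormal_pair, of 1] by simp_all
  have "diag_operator e f x y ` cball 0 1 \<subseteq> ?K"
  proof
    fix w assume "w \<in> diag_operator e f x y ` cball 0 1"
    then obtain z where z: "norm z \<le> 1" "w = diag_operator e f x y z" by auto
    have "cmod (cinner z e) \<le> 1" "cmod (cinner z f) \<le> 1"
      using norm_cinner_le[of z e] norm_cinner_le[of z f] z(1) ef1 by auto
    then have "(x * cinner z e, y * cinner z f) \<in> cball 0 (cmod x) \<times> cball 0 (cmod y)"
      by (auto simp: norm_mult mult_left_le)
    then show "w \<in> ?K" unfolding z(2) diag_operator_def
      by (intro image_eqI[of _ _ "(x * cinner z e, y * cinner z f)"]) auto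
  qed
  then have "compact (closure (diag_operator e f x y ` cball 0 1))"
    by (rule compact_closure_subset[OF K])
  then show ?thesis using clinear_diag_operator by (simp add: compact_operator_def)
qed

lemma hilbert_adjoint_diag_operator:
  "hilbert_adjoint (diag_operator e f x y) = diag_operator e f (cnj x) (cnj y)"
proof (rule hilbert_adjoint_unique)
  fix z w
  show "cinner (diag_operator e f x y z) w = cinner z (diag_operator e f (cnj x) (cnj y) w)"
    using cinner_commute[of w e] cinner_commute[of w f]
    by (simp add: diag_operator_def cinner_simps mult_ac)
qed

lemma singular_space_diag_operator:
  assumes "\<sigma> > 0"
  shows "z \<in> singular_space (diag_operator e f x y) \<sigma> \<longleftrightarrow>
    (\<sigma> = cmod x \<or> cinner z e = 0) \<and> (\<sigma> = cmod y \<or> cinner z f = 0) \<and>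
    z = scaleC (cinner z e) e + scaleC (cinner z f) f"
proof -
  have a: "hilbert_adjoint (diag_operator e f x y) (diag_operator e f x y z)
      = scaleC (complex_of_real ((cmod x)\<^sup>2) * cinner z e) e + scaleC (complex_of_real ((cmod y)\<^sup>2) * cinner z f) f"
    unfolding hilbert_adjoint_diag_operator diag_operator_def[of e f "cnj x"] cinner_diag_operator complex_norm_square
    by (simp add: mult_ac)
  have s: "complex_of_real (\<sigma>\<^sup>2) \<noteq> 0" using assms by simp
  have eq: "complex_of_real (\<tau>\<^sup>2) * c = complex_of_real (\<sigma>\<^sup>2) * c \<longleftrightarrow> \<sigma> = \<tau> \<or> c = 0" if "\<tau> \<ge> 0" for \<tau> c
    using assms that by (simp only: mult_cancel_right of_real_eq_iff) (auto simp: power2_eq_iff_nonneg)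
  show ?thesis
  proof
    assume z: "z \<in> singular_space (diag_operator e f x y) \<sigma>"
    then have e1: "scaleC (complex_of_real ((cmod x)\<^sup>2) * cinner z e) e + scaleC (complex_of_real ((cmod y)\<^sup>2) * cinner z f) f
        = scaleC (complex_of_real (\<sigma>\<^sup>2)) z" (is "?l = ?r")
      by (simp only: singular_space_def mem_Collect_eq a)
    have "cinner ?l e = cinner ?r e" "cinner ?l f = cinner ?r f" using e1 by simp_all
    then have c: "complex_of_real ((cmod x)\<^sup>2) * cinner z e = complex_of_real (\<sigma>\<^sup>2) * cinner z e"
      "complex_of_real ((cmod y)\<^sup>2) * cinner z f = complex_of_real (\<sigma>\<^sup>2) * cinner z f"
      using ef fe by (simp_all add: cinner_add_left cinner_scaleC_left del: of_real_power)
    have "scaleC (complex_of_real (\<sigma>\<^sup>2)) (scaleC (cinner z e) e + scaleC (cinner z f) f) = scaleC (complex_of_real (\<sigma>\<^sup>2)) z"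
      using e1 unfolding c by (simp only: scaleC_add_right scaleC_scaleC)
    then have "z = scaleC (cinner z e) e + scaleC (cinner z f) f"
      using s complex_vector.scale_left_imp_eq by metis
    then show "(\<sigma> = cmod x \<or> cinner z e = 0) \<and> (\<sigma> = cmod y \<or> cinner z f = 0) \<and>
      z = scaleC (cinner z e) e + scaleC (cinner z f) f"
      using c eq[of "cmod x"] eq[of "cmod y"] by simp
  next
    assume z: "(\<sigma> = cmod x \<or> cinner z e = 0) \<and> (\<sigma> = cmod y \<or> cinner z f = 0) \<and>
      z = scaleC (cinner z e) e + scaleC (cinner z f) f"
    then have c: "complex_of_real ((cmod x)\<^sup>2) * cinner z e = complex_of_real (\<sigma>\<^sup>2) * cinner z e"
      "complex_of_real ((cmod y)\<^sup>2) * cinner z f = complex_of_real (\<sigma>\<^sup>2) * cinner z f"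
      using eq[of "cmod x"] eq[of "cmod y"] by simp_all
    have "scaleC (complex_of_real (\<sigma>\<^sup>2)) z = scaleC (complex_of_real (\<sigma>\<^sup>2)) (scaleC (cinner z e) e + scaleC (cinner z f) f)"
      using z by simp
    also have "\<dots> = scaleC (complex_of_real (\<sigma>\<^sup>2) * cinner z e) e + scaleC (complex_of_real (\<sigma>\<^sup>2) * cinner z f) f"
      by (simp only: scaleC_add_right scaleC_scaleC)
    finally show "z \<in> singular_space (diag_operator e f x y) \<sigma>"
      unfolding singular_space_def mem_Collect_eq a c by simp
  qed
qed

text \<open>Entries of different modulus keep both eigenspaces one-dimensional. This is what
  confines the later argument to \<bar>t\<bar> \<open>< 1\<close> for the entries \<open>1\<close>
  and \<open>t\<close>; an entry \<open>0\<close> is allowed, because \<sigma> is positive.\<close>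

lemma singular_value_mult_diag_operator:
  assumes xy: "cmod x \<noteq> cmod y" and \<sigma>: "\<sigma> > 0"
  shows "singular_value_mult (diag_operator e f x y) \<sigma> = (if \<sigma> \<in> {cmod x, cmod y} then 1 else 0)"
proof -
  let ?E = "singular_space (diag_operator e f x y) \<sigma>"
  note S = singular_space_diag_operator[OF \<sigma>, where x = x and y = y]
  have z: "(cinner z e = 0 \<or> \<sigma> = cmod x)" "(cinner z f = 0 \<or> \<sigma> = cmod y)"
    "scaleC (cinner z e) e + scaleC (cinner z f) f = z" if "z \<in> ?E" for z
    using that unfolding S by auto
  consider "\<sigma> = cmod x" "\<sigma> \<noteq> cmod y" | "\<sigma> = cmod y" "\<sigma> \<noteq> cmod x" | "\<sigma> \<noteq> cmod x" "\<sigma> \<noteq> cmod y"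
    using xy by auto
  then show ?thesis
  proof cases
    case 1
    have "singular_value_mult (diag_operator e f x y) \<sigma> = 1"
    proof (rule singular_value_mult_eq[of _ "\<lambda>_. e"])
      show "e \<in> ?E" using 1 ef unfolding S by simp
      show "proj 1 (\<lambda>_. e) w = w" if "w \<in> ?E" for w
        using z[OF that] 1 by (simp add: proj_def)
    qed (use ef in \<open>simp add: orthonormal_def\<close>)
    then show ?thesis using 1 by simp
  next
    case 2
    have "singular_value_mult (diag_operator e f x y) \<sigma> = 1"
    proof (rule singular_value_mult_eq[of _ "\<lambda>_. f"])
      show "f \<in> ?E" using 2 ef fe unfolding S by simp
      show "proj 1 (\<lambda>_. f) w = w" if "w \<in> ?E" for w
        using z[OF that] 2 by (simp add: proj_def)
    qed (use ef in \<open>simp add: orthonormal_def\<close>)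
    then show ?thesis using 2 by simp
  next
    case 3
    have "singular_value_mult (diag_operator e f x y) \<sigma> = 0"
    proof (rule singular_value_mult_eq[of _ "\<lambda>_. f"])
      show "proj 0 (\<lambda>_. f) w = w" if "w \<in> ?E" for w
        using z[OF that] 3 by (simp add: proj_def)
    qed (simp_all add: orthonormal_def)
    then show ?thesis using 3 by simp
  qed
qed

lemma schatten_class_diag_operator:
  assumes xy: "cmod x \<noteq> cmod y"
  shows "diag_operator e f x y \<in> schatten_class q"
proof -
  have "(\<lambda>\<sigma>. real (singular_value_mult (diag_operator e f x y) \<sigma>) * \<sigma> powr real_of_ereal q) summable_on {0<..}"
  proof (rule finite_nonzero_values_imp_summable_on)
    show "finite {\<sigma> \<in> {0<..}. real (singular_value_mult (diag_operator e f x y) \<sigma>) * \<sigma> powr real_of_ereal q \<noteq> 0}"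
      by (rule finite_subset[of _ "{cmod x, cmod y}"])
        (auto simp: singular_value_mult_diag_operator[OF xy] split: if_splits)
  qed
  then show ?thesis using compact_diag_operator by (simp add: schatten_class_def)
qed

lemma schatten_sum_diag_operator:
  assumes xy: "cmod x \<noteq> cmod y"
  shows "schatten_sum q (diag_operator e f x y) = cmod x powr q + cmod y powr q"
proof -
  \<comment> \<open>The two-point set may contain \<open>0\<close>, which is outside the range of
    summation; its term is \<open>0 powr q = 0\<close>.\<close>
  have "schatten_sum q (diag_operator e f x y) = infsum (\<lambda>\<sigma>. \<sigma> powr q) {cmod x, cmod y}"
    unfolding schatten_sum_def
    by (rule infsum_cong_neutral) (auto simp: singular_value_mult_diag_operator[OF xy])
  also have "\<dots> = cmod x powr q + cmod y powr q" using xy by simp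
  finally show ?thesis .
qed

lemma schatten_norm_diag_operator:
  assumes xy: "cmod x \<noteq> cmod y" and q: "q > 0"
  shows "schatten_norm (ereal q) (diag_operator e f x y) = (cmod x powr q + cmod y powr q) powr (1 / q)"
  using schatten_sum_diag_operator[OF xy] by (simp add: schatten_norm_def schatten_sum_def)

lemma schatten_norm_infinity_diag_operator:
  "schatten_norm \<infinity> (diag_operator e f x y) = max (cmod x) (cmod y)"
proof -
  let ?D = "diag_operator e f x y"
  have bl: "bounded_linear ?D"
  proof (rule bounded_linear_intro[of _ "max (cmod x) (cmod y)"])
    show "?D (r *\<^sub>R z) = r *\<^sub>R ?D z" for r z
      using clinear_scaleC[OF clinear_diag_operator] by (metis scaleC_of_real)
  qed (use norm_diag_operator_le clinear_add[OF clinear_diag_operator] in \<open>auto simp: mult.commute\<close>)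
  have ef1: "norm e = 1" "norm f = 1"
    using orthonormal_norm[OF orthonormal_pair, of 0] orthonormal_norm[OF orthonormal_pair, of 1] by simp_all
  have "?D e = scaleC x e" "?D f = scaleC y f" using ef fe by (simp_all add: diag_operator_def)
  then have "cmod x \<le> onorm ?D" "cmod y \<le> onorm ?D"
    using onorm[OF bl, of e] onorm[OF bl, of f] ef1 by (simp_all add: norm_scaleC)
  moreover have "onorm ?D \<le> max (cmod x) (cmod y)"
    by (rule onorm_bound) (auto simp: le_max_iff_disj norm_diag_operator_le)
  ultimately show ?thesis by (simp add: schatten_norm_def)
qed

lemma diag_operator_add_scale:
  "diag_operator e f x y = (\<lambda>z. diag_operator e f x 0 z + scaleC y (diag_operator e f 0 1 z))"
  by (auto simp: diag_operator_def scaleC_scaleC)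

lemma diag_operator_scale:
  "diag_operator e f 0 y = (\<lambda>z. scaleC y (diag_operator e f 0 1 z))"
  by (auto simp: diag_operator_def scaleC_scaleC)

end

section \<open>Singular values of a pencil in finite dimension\<close>

lemma tendsto_asymptotic_compare:
  fixes f g :: "complex \<Rightarrow> real"
  assumes le: "\<forall>\<^sub>F t in at 0. f t \<le> g t"
    and f: "((\<lambda>t. f t / cmod t powr x) \<longlongrightarrow> \<tau>) (at 0)" and \<tau>: "\<tau> > 0"
    and g: "((\<lambda>t. g t / cmod t powr y) \<longlongrightarrow> \<sigma>) (at 0)"
  shows "y \<le> x" and "x = y \<Longrightarrow> \<tau> \<le> \<sigma>"
proof -
  have norm0: "((\<lambda>t::complex. cmod t) \<longlongrightarrow> 0) (at 0)" using tendsto_norm_zero[OF tendsto_ident_at] .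
  show "x = y \<Longrightarrow> \<tau> \<le> \<sigma>"
    using le by (intro tendsto_le[OF _ g f]) (auto elim!: eventually_mono intro!: divide_right_mono)
  show "y \<le> x"
  proof (rule ccontr)
    assume "\<not> y \<le> x"
    then have xy: "y - x > 0" by simp
    have pw: "((\<lambda>t::complex. cmod t powr (y - x)) \<longlongrightarrow> 0) (at 0)"
      using tendsto_powr'[OF norm0 tendsto_const, of "y - x"] xy by simp
    have "((\<lambda>t. g t / cmod t powr y * cmod t powr (y - x)) \<longlongrightarrow> \<sigma> * 0) (at 0)"
      by (intro tendsto_mult g pw)
    then have lim: "((\<lambda>t. g t / cmod t powr y * cmod t powr (y - x)) \<longlongrightarrow> 0) (at 0)" by simp
    have "\<forall>\<^sub>F t in at (0::complex). t \<noteq> 0" by (simp add: eventually_at_filter)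
    with le have "\<forall>\<^sub>F t in at 0. f t / cmod t powr x \<le> g t / cmod t powr y * cmod t powr (y - x)"
    proof eventually_elim
      case (elim t)
      then have "g t / cmod t powr y * cmod t powr (y - x) = g t / cmod t powr x" by (simp add: powr_diff)
      then show ?case using elim by (simp add: divide_right_mono)
    qed
    then have "\<tau> \<le> 0" by (rule tendsto_le[OF _ lim f, rotated]) simp
    with \<tau> show False by simp
  qed
qed

lemma powr_tendsto_0_at_right:
  assumes "e > 0"
  shows "((\<lambda>r::real. r powr e) \<longlongrightarrow> 0) (at_right 0)"
proof -
  have "((\<lambda>r::real. r powr e) \<longlongrightarrow> 0 powr e) (at_right 0)"
    by (rule tendsto_powr') (use assms in \<open>auto intro: tendsto_ident_at simp: eventually_at_filter\<close>)
  then show ?thesis by simp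
qed

lemma powr_comparison_eventually:
  fixes \<tau> \<sigma> x y :: real
  assumes "\<sigma> > 0" "y \<le> x" "x = y \<Longrightarrow> \<tau> \<le> \<sigma>"
  shows "\<forall>\<^sub>F r in at_right 0. \<tau> * r powr x \<le> \<sigma> * r powr y"
proof (cases "x = y")
  case True
  then show ?thesis using assms by (auto intro!: always_eventually mult_right_mono)
next
  case False
  then have xy: "x - y > 0" using assms by simp
  have "((\<lambda>r::real. \<tau> * r powr (x - y)) \<longlongrightarrow> \<tau> * 0) (at_right 0)"
    by (intro tendsto_mult tendsto_const powr_tendsto_0_at_right xy)
  then have "\<forall>\<^sub>F r in at_right 0. \<tau> * r powr (x - y) < \<sigma>"
    using assms(1) by (intro order_tendstoD) auto
  moreover have "\<forall>\<^sub>F r in at_right (0::real). r > 0" by (simp add: eventually_at_filter)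
  ultimately show ?thesis
  proof eventually_elim
    case (elim r)
    then have "\<tau> * r powr (x - y) * r powr y \<le> \<sigma> * r powr y" by (intro mult_right_mono) auto
    then show ?case using elim by (simp add: powr_diff)
  qed
qed

text \<open>The mean value theorem gives a strict inequality for each positive \<open>r\<close>.
  Strictness is essential, since the two sides agree to first order at \<open>r = 0\<close>.\<close>

lemma one_plus_powr_less:
  fixes r p :: real
  assumes "0 < r" "0 < p" "p < 1"
  shows "(1 + r) powr p < 1 + p * r"
proof -
  have "\<exists>z. 1 < z \<and> z < 1 + r \<and> (1 + r) powr p - 1 powr p = (1 + r - 1) * (p * z powr (p - 1))"
    using assms by (intro MVT2) (auto intro!: derivative_eq_intros)
  then obtain z where z: "1 < z" "(1 + r) powr p - 1 = r * (p * z powr (p - 1))" by auto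
  have "z powr (p - 1) < 1" using z(1) assms by (intro powr_less_one) auto
  then have "r * (p * z powr (p - 1)) < r * (p * 1)" using assms by (intro mult_strict_left_mono) auto
  with z(2) show ?thesis by (simp add: mult.commute)
qed

lemma powr_tangent_ge:
  fixes x y a :: real
  assumes "0 \<le> x" "0 < y" "0 < a" "a < 1"
  shows "x powr a \<le> y powr a + a * y powr (a - 1) * (x - y)"
proof (cases "x = 0")
  case True
  have "y powr (a - 1) * y = y powr a" using assms by (simp add: powr_diff)
  then have "y powr a + a * y powr (a - 1) * (x - y) = (1 - a) * y powr a"
    using True by (simp add: algebra_simps)
  then show ?thesis using assms True by simp
next
  case False
  then have x: "x > 0" using assms by simp
  have "a * y powr (a - 1) * (x - y) \<ge> x powr a - y powr a"
  proof -
    have "(- (a * y powr (a - 1))) * (x - y) \<le> - (x powr a) - (- (y powr a))"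
    proof (rule f''_imp_f'[of "{0<..}" "\<lambda>x. - (x powr a)" "\<lambda>x. - (a * x powr (a - 1))"
          "\<lambda>x. - (a * ((a - 1) * x powr (a - 1 - 1)))"])
      fix s :: real assume "s \<in> {0<..}"
      then have s: "s > 0" by simp
      show "((\<lambda>x. - (x powr a)) has_real_derivative - (a * s powr (a - 1))) (at s)"
        using s by (auto intro!: derivative_eq_intros)
      show "((\<lambda>x. - (a * x powr (a - 1))) has_real_derivative - (a * ((a - 1) * s powr (a - 1 - 1)))) (at s)"
        using s by (auto intro!: derivative_eq_intros)
      show "0 \<le> - (a * ((a - 1) * s powr (a - 1 - 1)))"
        using assms by (simp add: mult_nonneg_nonpos mult_nonpos_nonneg)
    qed (use x assms in auto)
    then show ?thesis by simp
  qed
  then show ?thesis by simp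
qed

section \<open>Envelopes of minors along the pencil\<close>

locale finite_dim_pencil =
  fixes A B :: "'a::complex_hilbert \<Rightarrow> 'a" and d :: nat and b :: "nat \<Rightarrow> 'a"
  assumes cA: "compact_operator A" and cB: "compact_operator B"
    and b: "orthonormal d b" and full: "\<And>x. proj d b x = x"
begin

definition X where "X t x = A x + scaleC t (B x)"

lemma cX: "compact_operator (X t)"
  unfolding X_def[abs_def] by (rule compact_operator_add_scaleC[OF cA cB])

lemma linX: "clinear (X t)"
  by (rule compact_operator_clinear[OF cX])

text \<open>A singular system is chosen for each \<open>t\<close> separately, with no continuity in
  \<open>t\<close>. Hence the values are studied through products that are maxima of minors and
  through trace inequalities, never through the vectors as functions of \<open>t\<close>.\<close>

definition sys where "sys t = (SOME el. singular_system (X t) d (fst el) (snd el))"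
definition e where "e t = fst (sys t)"
definition l where "l t = snd (sys t)"

lemma sys: "singular_system (X t) d (e t) (l t)"
proof -
  have "\<exists>el. singular_system (X t) d (fst el) (snd el)"
    using singular_system_exists[OF cX b] by auto
  then show ?thesis unfolding e_def l_def sys_def by (rule someI_ex)
qed

lemma orth_e: "orthonormal d (e t)"
  using sys by (simp add: singular_system_def)

lemma l_nonneg: "j < d \<Longrightarrow> 0 \<le> l t j"
  using sys[of t] by (simp add: singular_system_def)

lemma l_antimono: "i \<le> j \<Longrightarrow> j < d \<Longrightarrow> l t j \<le> l t i"
  using singular_system_antimono[OF cX sys] .

lemma proj_e: "proj d (e t) x = x"
proof -
  have "proj d (e t) (b i) = b i" if "i < d" for i
    using orthonormal_proj_eq[OF b orth_e _ that] full by blast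
  then have "proj d (e t) (proj d b x) = proj d b x"
    by (subst (1 2) proj_def[of d b]) (simp add: proj_sum proj_scaleC)
  then show ?thesis by (simp add: full)
qed

lemma schatten_sum_X: "schatten_sum p (X t) = (\<Sum>j<d. l t j powr (p / 2))"
  by (rule schatten_sum_finite_dim[OF cX sys proj_e])

text \<open>The norm of the \<open>k\<close>-th exterior power of \<open>X t\<close>. Unlike a
  single singular value it is a maximum of moduli of polynomials in \<open>t\<close>.\<close>

definition envelope :: "nat \<Rightarrow> complex \<Rightarrow> real" where
  "envelope k t = (\<Prod>j<k. sqrt (l t j))"

definition minors :: "nat \<Rightarrow> complex poly set" where
  "minors k = {P. \<exists>v u. orthonormal k v \<and> orthonormal k u \<and> (\<forall>t. minor k (X t) v u = poly P t)}"

lemma minors_le: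
  assumes "k \<le> d" "P \<in> minors k"
  shows "cmod (poly P t) \<le> envelope k t"
proof -
  obtain v u where vu: "orthonormal k v" "orthonormal k u" "\<And>t. minor k (X t) v u = poly P t"
    using assms(2) by (auto simp: minors_def)
  show ?thesis unfolding vu(3)[symmetric] envelope_def
    by (rule cmod_minor_le[OF linX singular_system_mono[OF sys assms(1)] vu(1,2)])
qed

lemma envelope_nonneg: "k \<le> d \<Longrightarrow> 0 \<le> envelope k t"
  unfolding envelope_def by (intro prod_nonneg) (auto simp: l_nonneg)

text \<open>The polynomial comes from the singular vectors at this particular \<open>t\<close>, kept
  fixed while the parameter of the pencil varies. Positivity is needed to normalise the left
  singular vectors.\<close>

lemma envelope_attained:
  assumes "k \<le> d" "envelope k t > 0"
  shows "\<exists>P\<in>minors k. cmod (poly P t) = envelope k t"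
proof -
  have pos: "0 < sqrt (l t i)" if "i < k" for i
  proof -
    have "sqrt (l t i) \<noteq> 0" using assms(2) that unfolding envelope_def by (metis finite_lessThan lessThan_iff less_irrefl prod_zero_iff)
    then show ?thesis using l_nonneg[of i t] that assms(1) by simp
  qed
  have "cinner (X t (e t i)) (X t (e t j)) = (if i = j then complex_of_real ((sqrt (l t i))\<^sup>2) else 0)"
    if "i < k" "j < k" for i j
    using singular_system_value[OF cX sys, of i j t] that assms(1) l_nonneg[of i t]
    by (cases "i = j") (simp_all del: of_real_power)
  note lsv = left_singular_vectors[where A = "X t" and v = "e t" and n = k and s = "\<lambda>i. sqrt (l t i)", OF this pos]
  define u where "u = (\<lambda>i. scaleC (complex_of_real (1 / sqrt (l t i))) (X t (e t i)))"
  have u: "orthonormal k u"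
    "\<And>i j. i < k \<Longrightarrow> j < k \<Longrightarrow> cinner (X t (e t i)) (u j) = (if i = j then complex_of_real (sqrt (l t i)) else 0)"
    using lsv unfolding u_def by blast+
  have v: "orthonormal k (e t)" using orthonormal_mono[OF orth_e assms(1)] .
  obtain P where P: "\<And>s. minor k (X s) (e t) u = poly P s"
    using minor_affine_poly[of k A B "e t" u] unfolding X_def[abs_def] by blast
  have "poly P t = (\<Prod>j<k. complex_of_real (sqrt (l t j)))"
    unfolding P[symmetric] by (rule minor_diagonal) (rule u(2))
  then have "cmod (poly P t) = (\<Prod>j<k. \<bar>sqrt (l t j)\<bar>)" by (simp add: prod_norm[symmetric])
  also have "\<dots> = envelope k t" unfolding envelope_def
    using pos by (intro prod.cong refl) (simp add: less_imp_le)
  finally show ?thesis using u(1) v P by (auto simp: minors_def)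
qed

lemma envelope_bounded: "\<exists>K. \<forall>t. cmod t \<le> 1 \<longrightarrow> envelope k t \<le> K" if "k \<le> d"
proof -
  obtain CA where CA: "CA > 0" "\<And>x. norm (A x) \<le> CA * norm x" using compact_operator_bounded[OF cA] by blast
  obtain CB where CB: "CB > 0" "\<And>x. norm (B x) \<le> CB * norm x" using compact_operator_bounded[OF cB] by blast
  have "envelope k t \<le> (CA + CB) ^ k" if t: "cmod t \<le> 1" for t
  proof -
    have "sqrt (l t j) \<le> CA + CB" if "j < k" for j
    proof (rule real_le_lsqrt)
      have j: "j < d" using that \<open>k \<le> d\<close> by simp
      have "norm (X t (e t j)) \<le> norm (A (e t j)) + cmod t * norm (B (e t j))"
        unfolding X_def by (metis norm_triangle_ineq norm_scaleC)
      also have "\<dots> \<le> CA + 1 * CB"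
        using t CA CB CA(2)[of "e t j"] CB(2)[of "e t j"] orthonormal_norm[OF orth_e j]
        by (intro add_mono mult_mono) auto
      finally have "(norm (X t (e t j)))\<^sup>2 \<le> (CA + CB)\<^sup>2" by (intro power_mono) auto
      then show "l t j \<le> (CA + CB)\<^sup>2" using singular_system_norm[OF cX sys j] by simp
    qed (use CA CB in auto)
    then have "envelope k t \<le> (\<Prod>j<k. CA + CB)"
      unfolding envelope_def using l_nonneg \<open>k \<le> d\<close> by (intro prod_mono) auto
    then show ?thesis by simp
  qed
  then show ?thesis by blast
qed

section \<open>Generic rank and leading terms of the singular values\<close>

definition rk :: nat where "rk = (GREATEST k. k \<le> d \<and> (\<exists>P\<in>minors k. P \<noteq> 0))"

lemma minors_0: "\<exists>P\<in>minors 0. P \<noteq> 0"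
proof -
  have "envelope 0 0 > 0" by (simp add: envelope_def)
  then obtain P where "P \<in> minors 0" "cmod (poly P 0) = envelope 0 0" using envelope_attained[of 0 0] by auto
  then show ?thesis by (intro bexI[of _ P]) (auto simp: envelope_def)
qed

lemma rk: "rk \<le> d" "\<exists>P\<in>minors rk. P \<noteq> 0"
  and rk_max: "k \<le> d \<Longrightarrow> \<exists>P\<in>minors k. P \<noteq> 0 \<Longrightarrow> k \<le> rk"
proof -
  let ?Q = "\<lambda>k. k \<le> d \<and> (\<exists>P\<in>minors k. P \<noteq> 0)"
  have "?Q rk" unfolding rk_def by (rule GreatestI_nat[where P = ?Q and k = 0 and b = d]) (use minors_0 in auto)
  then show "rk \<le> d" "\<exists>P\<in>minors rk. P \<noteq> 0" by auto
  show "k \<le> d \<Longrightarrow> \<exists>P\<in>minors k. P \<noteq> 0 \<Longrightarrow> k \<le> rk"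
    unfolding rk_def by (rule Greatest_le_nat[where P = ?Q and b = d]) auto
qed

lemma envelope_Suc: "envelope (Suc k) t = envelope k t * sqrt (l t k)"
  by (simp add: envelope_def)

text \<open>Going down from \<open>rk\<close>: where a minor of order \<open>k + 1\<close> is
  nonzero the envelope of order \<open>k\<close> is positive, and it is attained by a minor of order
  \<open>k\<close>.\<close>

lemma minors_nontrivial:
  assumes "k \<le> rk"
  shows "\<exists>P\<in>minors k. P \<noteq> 0"
  using assms
proof (induction rule: inc_induct)
  case base
  show ?case by (rule rk)
next
  case (step k)
  then obtain P where P: "P \<in> minors (Suc k)" "P \<noteq> 0" by blast
  then obtain t where "poly P t \<noteq> 0" using poly_all_0_iff_0 by blast
  moreover have k: "Suc k \<le> d" using step rk by simp
  ultimately have "envelope (Suc k) t > 0"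
    using minors_le[OF k P(1), of t] by (metis less_le_trans zero_less_norm_iff)
  then have "envelope k t > 0"
    using envelope_nonneg[of k t] k by (metis Suc_leD envelope_Suc less_eq_real_def mult_zero_left less_irrefl)
  then obtain P' where "P' \<in> minors k" "cmod (poly P' t) = envelope k t"
    using envelope_attained[of k t] k by auto
  then show ?case using \<open>envelope k t > 0\<close> by (intro bexI[of _ P']) auto
qed

lemma envelope_eq_0: "rk < k \<Longrightarrow> k \<le> d \<Longrightarrow> envelope k t = 0"
proof (rule ccontr)
  assume k: "rk < k" "k \<le> d" and "envelope k t \<noteq> 0"
  then have pos: "envelope k t > 0" using envelope_nonneg[of k t] by simp
  then obtain P where "P \<in> minors k" "cmod (poly P t) = envelope k t" using envelope_attained k by blast
  then have "\<exists>P\<in>minors k. P \<noteq> 0" using pos by (intro bexI[of _ P]) auto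
  then show False using rk_max k by fastforce
qed

definition leading :: "nat \<Rightarrow> nat \<Rightarrow> real \<Rightarrow> bool" where
  "leading k m C \<longleftrightarrow> C > 0 \<and> ((\<lambda>t. envelope k t / cmod t ^ m) \<longlongrightarrow> C) (at 0) \<and>
    (\<forall>\<epsilon>>0. \<exists>P\<in>minors k. \<exists>Q. P = monom 1 m * Q \<and> cmod (poly Q 0) > C - \<epsilon>) \<and>
    (m = 0 \<longrightarrow> envelope k 0 = C) \<and> (m > 0 \<longrightarrow> envelope k 0 = 0)"

lemma leading_exists: "k \<le> rk \<Longrightarrow> \<exists>m C. leading k m C"
proof -
  assume k: "k \<le> rk"
  have kd: "k \<le> d" using k rk(1) by simp
  obtain P0 where P0: "P0 \<in> minors k" "P0 \<noteq> 0" using minors_nontrivial[OF k] by blast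
  obtain K where K: "\<And>t. cmod t \<le> 1 \<Longrightarrow> envelope k t \<le> K" using envelope_bounded[OF kd] by blast
  show "\<exists>m C. leading k m C"
    by (rule poly_envelope_asymptotic[where F = "minors k" and g = "envelope k" and K = K and ?P0.0 = P0,
        OF minors_le[OF kd] envelope_attained[OF kd] K P0])
      (auto simp: leading_def)
qed

definition lexp where "lexp k = (SOME m. \<exists>C. leading k m C)"
definition lcoef where "lcoef k = (SOME C. leading k (lexp k) C)"

lemma leading: "k \<le> rk \<Longrightarrow> leading k (lexp k) (lcoef k)"
proof -
  assume "k \<le> rk"
  then have "\<exists>C. leading k (lexp k) C" unfolding lexp_def by (rule leading_exists[THEN someI_ex])
  then show ?thesis unfolding lcoef_def by (rule someI_ex)
qed

lemma lcoef_pos: "k \<le> rk \<Longrightarrow> lcoef k > 0"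
  and envelope_tendsto: "k \<le> rk \<Longrightarrow> ((\<lambda>t. envelope k t / cmod t ^ lexp k) \<longlongrightarrow> lcoef k) (at 0)"
  and minors_leading: "k \<le> rk \<Longrightarrow> 0 < \<epsilon> \<Longrightarrow>
    \<exists>P\<in>minors k. \<exists>Q. P = monom 1 (lexp k) * Q \<and> cmod (poly Q 0) > lcoef k - \<epsilon>"
  and lexp_zero: "k \<le> rk \<Longrightarrow> lexp k = 0 \<Longrightarrow> envelope k 0 = lcoef k"
  and lexp_pos: "k \<le> rk \<Longrightarrow> lexp k > 0 \<Longrightarrow> envelope k 0 = 0"
  using leading[of k] unfolding leading_def by blast+

lemma leading_0: "lexp 0 = 0" "lcoef 0 = 1"
proof -
  have "envelope 0 0 = 1" by (simp add: envelope_def)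
  then show "lexp 0 = 0" using lexp_pos[of 0] by fastforce
  with \<open>envelope 0 0 = 1\<close> show "lcoef 0 = 1" using lexp_zero[of 0] by simp
qed

lemma eventually_neq_0: "\<forall>\<^sub>F t in at (0::complex). t \<noteq> 0"
  by (simp add: eventually_at_filter)

lemma envelope_eventually_pos: "k \<le> rk \<Longrightarrow> \<forall>\<^sub>F t in at 0. 0 < envelope k t"
proof -
  assume k: "k \<le> rk"
  have "\<forall>\<^sub>F t in at 0. 0 < envelope k t / cmod t ^ lexp k"
    by (rule order_tendstoD(1)[OF envelope_tendsto[OF k] lcoef_pos[OF k]])
  then show ?thesis using eventually_neq_0
    by eventually_elim (simp add: zero_less_divide_iff)
qed

text \<open>The \<open>j\<close>-th singular value of \<open>X t\<close>, raised to the power \<open>p\<close>, is asymptotic to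
  \<open>\<tau> p j * \<bar>t\<bar> powr ex p j\<close> as \<open>t\<close> tends to \<open>0\<close>.\<close>

definition ex :: "real \<Rightarrow> nat \<Rightarrow> real" where "ex p j = p * (real (lexp (Suc j)) - real (lexp j))"
definition \<tau> :: "real \<Rightarrow> nat \<Rightarrow> real" where "\<tau> p j = (lcoef (Suc j) / lcoef j) powr p"

lemma \<tau>_pos: "j < rk \<Longrightarrow> \<tau> p j > 0"
  using lcoef_pos[of j] lcoef_pos[of "Suc j"] by (simp add: \<tau>_def)

text \<open>A singular value is the quotient of two consecutive envelopes, so its leading term is
  the quotient of theirs; this is where integrality of the exponents comes from.\<close>

lemma singular_value_asymptotic:
  assumes j: "j < rk"
  shows "((\<lambda>t. l t j powr (p / 2) / cmod t powr ex p j) \<longlongrightarrow> \<tau> p j) (at 0)"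
proof -
  let ?k = "real (lexp (Suc j)) - real (lexp j)"
  have jd: "j < d" using j rk(1) by simp
  have "((\<lambda>t. (envelope (Suc j) t / cmod t ^ lexp (Suc j)) / (envelope j t / cmod t ^ lexp j))
      \<longlongrightarrow> lcoef (Suc j) / lcoef j) (at 0)"
    using lcoef_pos[of j] j by (intro tendsto_divide envelope_tendsto) auto
  then have "((\<lambda>t. ((envelope (Suc j) t / cmod t ^ lexp (Suc j)) / (envelope j t / cmod t ^ lexp j)) powr p)
      \<longlongrightarrow> \<tau> p j) (at 0)"
    unfolding \<tau>_def using lcoef_pos[of j] lcoef_pos[of "Suc j"] j
    by (intro tendsto_powr tendsto_const) auto
  moreover have "\<forall>\<^sub>F t in at 0. ((envelope (Suc j) t / cmod t ^ lexp (Suc j)) / (envelope j t / cmod t ^ lexp j)) powr p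
      = l t j powr (p / 2) / cmod t powr ex p j"
    using eventually_neq_0 envelope_eventually_pos[of j, OF less_imp_le[OF j]]
  proof eventually_elim
    case (elim t)
    have "(envelope (Suc j) t / cmod t ^ lexp (Suc j)) / (envelope j t / cmod t ^ lexp j) = sqrt (l t j) / cmod t powr ?k"
      using elim by (simp add: envelope_Suc powr_diff powr_realpow)
    then show ?case
      by (simp add: powr_divide powr_powr ex_def sqrt_powr l_nonneg[OF jd] mult.commute)
  qed
  ultimately show ?thesis by (rule Lim_transform_eventually)
qed

text \<open>Leading terms inherit the decreasing order of the singular values: later ones have a
  larger exponent, or the same exponent and a coefficient that is not larger.\<close>

lemma ex_mono:
  assumes p: "p > 0" and ij: "i \<le> j" "j < rk"
  shows "ex p i \<le> ex p j" and "ex p j = ex p i \<Longrightarrow> \<tau> p j \<le> \<tau> p i"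
proof -
  have jd: "j < d" using ij rk(1) by simp
  have le: "\<forall>\<^sub>F t in at 0. l t j powr (p / 2) \<le> l t i powr (p / 2)"
    using p l_antimono[OF ij(1) jd] l_nonneg[OF jd] by (intro always_eventually allI powr_mono2) auto
  have i: "i < rk" using ij by simp
  note * = tendsto_asymptotic_compare[OF le singular_value_asymptotic[OF ij(2)] \<tau>_pos[OF ij(2)] singular_value_asymptotic[OF i]]
  show "ex p i \<le> ex p j" by (rule *(1))
  show "ex p j = ex p i \<Longrightarrow> \<tau> p j \<le> \<tau> p i" by (rule *(2))
qed

text \<open>The quotients telescope, starting from \<open>lexp 0 = 0\<close> and
  \<open>lcoef 0 = 1\<close>.\<close>

lemma prod_leading:
  assumes p: "p > 0" and k: "k < rk" and r: "r > 0"
  shows "(\<Prod>j\<le>k. (\<tau> p j * r powr ex p j) powr (1 / p)) = lcoef (Suc k) * r ^ lexp (Suc k)"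
  using k
proof (induction k)
  case 0
  then show ?case using p lcoef_pos[of 1] r
    by (simp add: \<tau>_def ex_def leading_0 powr_mult powr_powr powr_realpow)
next
  case (Suc k)
  have "(\<tau> p (Suc k) * r powr ex p (Suc k)) powr (1 / p)
      = lcoef (Suc (Suc k)) / lcoef (Suc k) * (r ^ lexp (Suc (Suc k)) / r ^ lexp (Suc k))"
    using p lcoef_pos[of "Suc k"] lcoef_pos[of "Suc (Suc k)"] r Suc.prems
    by (simp add: \<tau>_def ex_def powr_mult powr_powr powr_diff powr_realpow)
  then show ?case using Suc lcoef_pos[of "Suc k"] r by simp
qed

text \<open>The maximum principle is applied to minors divided by their power of \<open>t\<close>, whose values at \<open>0\<close>
  come arbitrarily close to the leading coefficients of the envelopes.\<close>

lemma leading_terms_le: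
  assumes p: "0 < p" "p < 2"
  shows "\<forall>\<^sub>F r in at_right 0. \<forall>\<epsilon>>0. \<exists>t. cmod t = r \<and>
    (\<Sum>j<rk. \<tau> p j * r powr ex p j) - \<epsilon> \<le> (\<Sum>j<rk. l t j powr (p / 2))"
proof -
  \<comment> \<open>The only restriction on \<open>r\<close>: it is so small that the leading terms
    are in decreasing order, as summation by parts requires.\<close>
  have "\<forall>\<^sub>F r in at_right 0. \<forall>j\<in>{j. Suc j < rk}. \<tau> p (Suc j) * r powr ex p (Suc j) \<le> \<tau> p j * r powr ex p j"
  proof (rule eventually_ball_finite)
    show "finite {j. Suc j < rk}" by (rule finite_subset[of _ "{..<rk}"]) auto
    show "\<forall>j\<in>{j. Suc j < rk}. \<forall>\<^sub>F r in at_right 0. \<tau> p (Suc j) * r powr ex p (Suc j) \<le> \<tau> p j * r powr ex p j"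
      using ex_mono[OF p(1), of _ "Suc _"] by (auto intro!: powr_comparison_eventually \<tau>_pos)
  qed
  moreover have "\<forall>\<^sub>F r in at_right (0::real). r > 0" by (simp add: eventually_at_filter)
  ultimately show ?thesis
  proof eventually_elim
    case (elim r)
    then have r: "r > 0" by simp
    define a where "a = p / 2"
    have a: "0 < a" "a < 1" using p by (auto simp: a_def)
    define \<beta> where "\<beta> j = (\<tau> p j * r powr ex p j) powr (2 / p)" for j
    have pos: "\<tau> p j * r powr ex p j > 0" if "j < rk" for j using \<tau>_pos[OF that, of p] r by simp
    have \<beta>_pos: "\<beta> j > 0" if "j < rk" for j using \<tau>_pos[OF that, of p] r by (simp add: \<beta>_def)
    have \<beta>_mono: "\<beta> (Suc j) \<le> \<beta> j" if "Suc j < rk" for j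
      unfolding \<beta>_def using elim that pos[of "Suc j"] p by (intro powr_mono2) auto
    have \<beta>_powr: "\<beta> j powr a = \<tau> p j * r powr ex p j" if "j < rk" for j
      using \<tau>_pos[OF that, of p] r p by (simp add: \<beta>_def a_def powr_powr)
    \<comment> \<open>The Karamata argument is used with \<open>c = 0\<close>: no quadratic gain is
      sought here, and the vanishing summand only matches the shape of the general
      inequality.\<close>
    define w where "w k = (if k < rk then a * \<beta> k powr a - 0 * \<beta> k else 0)" for k
    have w_mono: "w (Suc k) \<le> w k" for k
      using \<beta>_mono[of k] \<beta>_pos[of k] \<beta>_pos[of "Suc k"] a
      by (auto simp: w_def intro!: mult_left_mono powr_mono2)
    have w_sum: "(\<Sum>k<rk. w k - w (Suc k)) = w 0"
      using sum_lessThan_telescope'[of w rk] by (simp add: w_def)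
    have w0: "w 0 \<ge> 0" using a by (simp add: w_def)
    show ?case
    proof (intro allI impI)
      fix \<epsilon> :: real assume \<epsilon>: "\<epsilon> > 0"
      \<comment> \<open>Minors reach the leading coefficients only up to a factor
        \<open>exp (- \<delta>)\<close>. This costs \<open>2 * \<delta>\<close> in each
        \<open>s k\<close>; the weights telescope to \<open>w 0\<close>, so the total loss is at
        most \<open>\<epsilon> / 2\<close>. The \<open>+ 1\<close> guards against
        \<open>w 0 = 0\<close>.\<close>
      define \<delta> where "\<delta> = \<epsilon> / (4 * (w 0 + 1))"
      have \<delta>: "\<delta> > 0" using \<epsilon> w0 by (simp add: \<delta>_def)
      have "\<exists>P Q. k < rk \<longrightarrow> P \<in> minors (Suc k) \<and> P = monom 1 (lexp (Suc k)) * Q \<and>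
          cmod (poly Q 0) > lcoef (Suc k) * exp (- \<delta>)" for k
      proof (cases "k < rk")
        case True
        then have C: "lcoef (Suc k) > 0" by (intro lcoef_pos) simp
        then have "lcoef (Suc k) * (1 - exp (- \<delta>)) > 0" using \<delta> by simp
        from minors_leading[OF Suc_leI[OF True] this] show ?thesis by (auto simp: algebra_simps)
      qed simp
      then obtain P Q where P: "\<And>k. k < rk \<Longrightarrow> P k \<in> minors (Suc k)"
        and PQ: "\<And>k. k < rk \<Longrightarrow> P k = monom 1 (lexp (Suc k)) * Q k"
        and Q: "\<And>k. k < rk \<Longrightarrow> cmod (poly (Q k) 0) > lcoef (Suc k) * exp (- \<delta>)" by metis
      have Q0: "poly (Q k) 0 \<noteq> 0" if "k < rk" for k
        using Q[OF that] lcoef_pos[of "Suc k"] that by (metis Suc_leI exp_gt_zero less_asym mult_pos_pos norm_zero)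
      have "\<exists>t. cmod t = r \<and> (\<forall>i\<in>{..<rk}. poly (Q i) t \<noteq> 0) \<and>
        (\<Sum>i\<in>{..<rk}. 2 * (w i - w (Suc i)) * ln (cmod (poly (Q i) t) / cmod (poly (Q i) 0))) \<ge> - (\<epsilon> / 2)"
        by (rule exists_on_sphere_weighted_log_ge[where f = "\<lambda>i. poly (Q i)"])
          (use r \<epsilon> Q0 w_mono in \<open>auto intro!: holomorphic_intros\<close>)
      then obtain t where t: "cmod t = r" "\<And>i. i < rk \<Longrightarrow> poly (Q i) t \<noteq> 0"
        "(\<Sum>i<rk. 2 * (w i - w (Suc i)) * ln (cmod (poly (Q i) t) / cmod (poly (Q i) 0))) \<ge> - (\<epsilon> / 2)"
        by auto
      have env: "r ^ lexp (Suc k) * cmod (poly (Q k) t) \<le> envelope (Suc k) t" if k: "k < rk" for k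
        using minors_le[OF _ P[OF k], of t] k rk(1) t(1)
        by (simp add: PQ[OF k] poly_monom norm_mult norm_power)
      have env_pos: "0 < envelope (Suc k) t" if k: "k < rk" for k
        using t(2)[OF k] r by (intro less_le_trans[OF _ env[OF k]]) simp
      have l_pos: "0 < l t k" if k: "k < rk" for k
      proof -
        have "l t k \<noteq> 0" using env_pos[OF k] by (auto simp: envelope_Suc)
        then show ?thesis using l_nonneg[of k t] k rk(1) by simp
      qed
      define s where "s k = 2 * ln (cmod (poly (Q k) t) / cmod (poly (Q k) 0)) - 2 * \<delta>" for k
      have s_le: "s k \<le> (\<Sum>j\<le>k. ln (l t j) - ln (\<beta> j))" if k: "k < rk" for k
      proof -
        let ?C = "lcoef (Suc k)" and ?R = "r ^ lexp (Suc k)" and ?q = "cmod (poly (Q k) t)" and ?z = "cmod (poly (Q k) 0)"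
        have C: "?C > 0" using lcoef_pos[of "Suc k"] k by simp
        have q: "?q > 0" "?z > 0" "?R > 0" using t(2)[OF k] Q0[OF k] r by auto
        have "ln (?R * ?q) \<le> ln (\<Prod>j\<le>k. sqrt (l t j))"
          using env[OF k] q(1,3) by (intro ln_mono) (simp_all add: envelope_def lessThan_Suc_atMost)
        also have "\<dots> = (\<Sum>j\<le>k. ln (sqrt (l t j)))"
          by (rule ln_prod_pos) (use l_pos k in auto)
        also have "\<dots> = (\<Sum>j\<le>k. ln (l t j) / 2)"
          using k rk(1) by (intro sum.cong refl ln_sqrt l_nonneg) auto
        finally have 1: "ln ?R + ln ?q \<le> (\<Sum>j\<le>k. ln (l t j) / 2)"
          unfolding ln_mult_pos[OF q(3,1)] .
        have "ln (?C * ?R) = ln (\<Prod>j\<le>k. (\<tau> p j * r powr ex p j) powr (1 / p))"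
          using prod_leading[OF p(1) k r] by simp
        also have "\<dots> = (\<Sum>j\<le>k. ln ((\<tau> p j * r powr ex p j) powr (1 / p)))"
        proof (rule ln_prod_pos)
          show "0 < (\<tau> p j * r powr ex p j) powr (1 / p)" if "j \<in> {..k}" for j
            using \<tau>_pos[of j p] r that k by simp
        qed simp
        also have "\<dots> = (\<Sum>j\<le>k. ln (\<beta> j) / 2)"
          by (intro sum.cong refl) (use pos k p in \<open>auto simp: \<beta>_def ln_powr\<close>)
        finally have 2: "ln ?C + ln ?R = (\<Sum>j\<le>k. ln (\<beta> j) / 2)"
          unfolding ln_mult_pos[OF C q(3)] .
        have "ln (?C * exp (- \<delta>)) \<le> ln ?z" using Q[OF k] C by (intro ln_mono) auto
        then have 3: "ln ?C - \<delta> \<le> ln ?z" unfolding ln_mult_pos[OF C exp_gt_zero] by simp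
        have "s k = 2 * (ln ?q - ln ?z) - 2 * \<delta>" using q by (simp add: s_def ln_div)
        also have "\<dots> \<le> 2 * ((ln ?R + ln ?q) - (ln ?C + ln ?R))" using 3 by simp
        also have "\<dots> \<le> 2 * ((\<Sum>j\<le>k. ln (l t j) / 2) - (\<Sum>j\<le>k. ln (\<beta> j) / 2))" using 1 2 by simp
        also have "\<dots> = (\<Sum>j\<le>k. ln (l t j) - ln (\<beta> j))"
          unfolding sum_subtractf[symmetric] sum_distrib_left by (intro sum.cong refl) simp
        finally show ?thesis .
      qed
      define \<Lambda> where "\<Lambda> = (\<Sum>j<rk. l t j) + (\<Sum>j<rk. \<beta> j)"
      have l\<Lambda>: "l t k \<le> \<Lambda>" "\<beta> k \<le> \<Lambda>" if k: "k < rk" for k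
      proof -
        have "l t k \<le> (\<Sum>j<rk. l t j)" "\<beta> k \<le> (\<Sum>j<rk. \<beta> j)"
          by (rule member_le_sum; use k l_pos \<beta>_pos in \<open>auto intro: less_imp_le\<close>)+
        moreover have "0 \<le> (\<Sum>j<rk. l t j)" "0 \<le> (\<Sum>j<rk. \<beta> j)"
          using l_pos \<beta>_pos by (auto intro!: sum_nonneg intro: less_imp_le)
        ultimately show "l t k \<le> \<Lambda>" "\<beta> k \<le> \<Lambda>" by (auto simp: \<Lambda>_def)
      qed
      have "(\<Sum>k<rk. \<beta> k powr a - 0 * \<beta> k) + (\<Sum>k<rk. (w k - w (Suc k)) * s k) \<le> (\<Sum>k<rk. l t k powr a - 0 * l t k)"
      proof (rule log_majorisation_sum_ge(1)[where \<Lambda> = \<Lambda> and w = w, OF l_pos l\<Lambda>(1) \<beta>_pos l\<Lambda>(2) \<beta>_mono _ _ a s_le])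
      qed (auto simp: w_def)
      moreover have "(\<Sum>k<rk. (w k - w (Suc k)) * s k) \<ge> - \<epsilon>"
      proof -
        have "(\<Sum>k<rk. (w k - w (Suc k)) * s k)
            = (\<Sum>i<rk. 2 * (w i - w (Suc i)) * ln (cmod (poly (Q i) t) / cmod (poly (Q i) 0))) - 2 * \<delta> * (\<Sum>k<rk. w k - w (Suc k))"
          unfolding s_def sum_distrib_left sum_subtractf[symmetric] by (intro sum.cong refl) (simp add: algebra_simps)
        moreover have "2 * \<delta> * w 0 \<le> \<epsilon> / 2"
          using \<epsilon> w0 by (simp add: \<delta>_def divide_simps)
        ultimately show ?thesis using t(3) unfolding w_sum by linarith
      qed
      moreover have "(\<Sum>k<rk. \<beta> k powr a - 0 * \<beta> k) = (\<Sum>j<rk. \<tau> p j * r powr ex p j)"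
        by (intro sum.cong) (auto simp: \<beta>_powr)
      ultimately show "\<exists>t. cmod t = r \<and>
        (\<Sum>j<rk. \<tau> p j * r powr ex p j) - \<epsilon> \<le> (\<Sum>j<rk. l t j powr (p / 2))"
        using t(1) by (intro exI[of _ t]) (simp add: a_def)
    qed
  qed
qed

end

section \<open>Singular values surviving at \<open>t = 0\<close> and the case
  \<open>q = 1\<close>\<close>

context finite_dim_pencil
begin

definition rk0 :: nat where "rk0 = card {j. j < d \<and> 0 < l 0 j}"

lemma l0_pos_iff: "j < d \<Longrightarrow> 0 < l 0 j \<longleftrightarrow> j < rk0"
proof -
  let ?J = "{j. j < d \<and> 0 < l 0 j}"
  have down: "i \<in> ?J" if "j \<in> ?J" "i \<le> j" for i j
    using that l_antimono[of i j 0] by auto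
  have "?J = {..<card ?J}"
  proof (cases "?J = {}")
    case True
    then show ?thesis by (simp only: card.empty lessThan_0)
  next
    case False
    have fin: "finite ?J" by simp
    have "?J = {..Max ?J}"
    proof
      show "?J \<subseteq> {..Max ?J}" using Max_ge[OF fin] by blast
      show "{..Max ?J} \<subseteq> ?J" using down[OF Max_in[OF fin False]] by blast
    qed
    then have "?J = {..<Suc (Max ?J)}" by (simp only: lessThan_Suc_atMost)
    then show ?thesis by (metis card_lessThan)
  qed
  then show "j < d \<Longrightarrow> 0 < l 0 j \<longleftrightarrow> j < rk0" unfolding rk0_def by blast
qed

lemma rk0_le: "rk0 \<le> d"
  unfolding rk0_def using card_mono[of "{..<d}" "{j. j < d \<and> 0 < l 0 j}"] by auto

lemma envelope_0_pos_iff: "k \<le> d \<Longrightarrow> 0 < envelope k 0 \<longleftrightarrow> k \<le> rk0"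
proof -
  assume k: "k \<le> d"
  have "0 < envelope k 0 \<longleftrightarrow> (\<forall>j<k. 0 < l 0 j)"
  proof
    assume "0 < envelope k 0"
    then have nz: "\<forall>j\<in>{..<k}. sqrt (l 0 j) \<noteq> 0" unfolding envelope_def by (metis finite_lessThan less_irrefl prod_zero_iff)
    show "\<forall>j<k. 0 < l 0 j"
    proof (intro allI impI)
      fix j assume "j < k"
      then have "l 0 j \<noteq> 0" "0 \<le> l 0 j" using nz l_nonneg[of j 0] k by auto
      then show "0 < l 0 j" by simp
    qed
  qed (auto simp: envelope_def intro!: prod_pos)
  also have "\<dots> \<longleftrightarrow> (\<forall>j<k. j < rk0)" using l0_pos_iff k by auto
  also have "\<dots> \<longleftrightarrow> k \<le> rk0" by (metis leI less_le_trans less_irrefl)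
  finally show ?thesis .
qed

lemma rk0_le_rk: "rk0 \<le> rk"
proof -
  have "0 < envelope rk0 0" using envelope_0_pos_iff[OF rk0_le] by simp
  then show ?thesis using envelope_eq_0[of rk0 0] rk0_le by (metis leI less_irrefl)
qed

lemma lexp_eq_0_iff: "k \<le> rk \<Longrightarrow> lexp k = 0 \<longleftrightarrow> k \<le> rk0"
  using lexp_zero[of k] lexp_pos[of k] lcoef_pos[of k] envelope_0_pos_iff[of k] rk(1) by fastforce

lemma ex_below: "j < rk0 \<Longrightarrow> ex p j = 0"
  using lexp_eq_0_iff[of j] lexp_eq_0_iff[of "Suc j"] rk0_le_rk by (simp add: ex_def)

lemma \<tau>_below: "j < rk0 \<Longrightarrow> \<tau> p j = l 0 j powr (p / 2)"
proof -
  assume j: "j < rk0"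
  have "lcoef (Suc j) = lcoef j * sqrt (l 0 j)"
    using lexp_zero[of j] lexp_zero[of "Suc j"] lexp_eq_0_iff[of j] lexp_eq_0_iff[of "Suc j"] j rk0_le_rk
    by (simp add: envelope_Suc)
  then show ?thesis
    using lcoef_pos[of j] j rk0_le_rk rk0_le l_nonneg[of j 0] by (simp add: \<tau>_def sqrt_powr)
qed

text \<open>Near \<open>0\<close> the envelope of order \<open>rk\<close> is positive while the next
  one vanishes identically, so the value with index \<open>rk\<close>, and with it every later one,
  is zero.\<close>

lemma l_eventually_0: "\<forall>\<^sub>F t in at 0. \<forall>j. rk \<le> j \<longrightarrow> j < d \<longrightarrow> l t j = 0"
  using envelope_eventually_pos[OF order_refl]
proof eventually_elim
  case (elim t)
  show ?case
  proof (intro allI impI)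
    fix j assume j: "rk \<le> j" "j < d"
    then have "envelope (Suc rk) t = 0" by (intro envelope_eq_0) auto
    then have "l t rk = 0" using elim by (simp add: envelope_Suc)
    then show "l t j = 0" using l_antimono[OF j, of t] l_nonneg[OF j(2), of t] by simp
  qed
qed

lemma sum_l_eq: "(\<Sum>j<d. l t j) = (\<Sum>j<d. (norm (X t (e 0 j)))\<^sup>2)"
proof -
  have "(\<Sum>j<d. (norm (X t (e 0 j)))\<^sup>2) = (\<Sum>j<d. (norm (X t (e t j)))\<^sup>2)"
    by (rule sum_norm_square_change_of_basis[OF linX orth_e orth_e proj_e])
  also have "\<dots> = (\<Sum>j<d. l t j)" by (intro sum.cong refl singular_system_norm[OF cX sys]) simp
  finally show ?thesis by simp
qed

text \<open>Concavity of \<open>x powr (p/2)\<close> together with Ky Fan's inequalities controls the part of the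
  Schatten sum coming from the singular values that do not vanish at \<open>t = 0\<close>; the terms that are
  linear in \<open>t\<close> cancel between \<open>t\<close> and \<open>-t\<close>.\<close>

lemma large_singular_values_le:
  assumes p: "0 < p" "p < 2"
  shows "\<exists>M. \<forall>t. (\<Sum>j<rk0. l t j powr (p / 2)) + (\<Sum>j<rk0. l (- t) j powr (p / 2))
      \<le> 2 * (\<Sum>j<rk0. l 0 j powr (p / 2)) + M * (cmod t)\<^sup>2"
proof -
  define a where "a = p / 2"
  have a: "0 < a" "a < 1" using p by (auto simp: a_def)
  define Y where "Y = (\<Sum>j<rk0. l 0 j powr (a - 1))"
  \<comment> \<open>These are the tangent slopes of \<open>x powr a\<close> at the values
    \<open>l 0 j\<close>, up to the factor \<open>a\<close>. They increase with \<open>j\<close>,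
    and \<open>Y\<close>, being the sum of all of them, continues the sequence monotonically past
    \<open>rk0\<close>. The signs in the summation by parts then match Ky Fan's
    inequalities.\<close>
  define y where "y j = (if j < rk0 then l 0 j powr (a - 1) else Y)" for j
  define v where "v = e 0"
  define m where "m j = (norm (B (v j)))\<^sup>2" for j
  have X0: "X 0 = A" by (auto simp: X_def)
  have nA: "(norm (A (v j)))\<^sup>2 = l 0 j" if "j < d" for j
    using singular_system_norm[OF cX sys that, of 0] X0 by (simp add: v_def)
  have y0: "0 \<le> y j" for j by (simp add: y_def Y_def sum_nonneg)
  have y_mono: "y j \<le> y (Suc j)" for j
  proof (cases "Suc j < rk0")
    case True
    then show ?thesis
      using l_antimono[of j "Suc j" 0] l0_pos_iff[of "Suc j"] rk0_le a by (auto simp: y_def intro!: powr_mono2')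
  next
    case False
    then show ?thesis unfolding y_def Y_def by (auto intro!: member_le_sum)
  qed
  have half: "(\<Sum>j<rk0. l t j powr a) \<le> (\<Sum>j<rk0. l 0 j powr a)
      + a * (\<Sum>j<rk0. y j * ((norm (X t (v j)))\<^sup>2 - l 0 j)) + a * Y * (cmod t)\<^sup>2 * (\<Sum>j<d. m j)" for t
  proof -
    define \<delta> where "\<delta> j = l t j - (norm (X t (v j)))\<^sup>2" for j
    have D: "0 \<le> (\<Sum>j\<le>k. \<delta> j)" if "k < rk0" for k
    proof -
      have k: "Suc k \<le> d" using that rk0_le by simp
      have "(\<Sum>j<Suc k. (norm (X t (v j)))\<^sup>2) \<le> (\<Sum>j<Suc k. l t j)"
        unfolding v_def by (rule sum_norm_square_le_singular_values[OF linX singular_system_mono[OF sys k] orthonormal_mono[OF orth_e k]])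
      then show ?thesis by (simp add: \<delta>_def sum_subtractf lessThan_Suc_atMost)
    qed
    have "(\<Sum>j<d. f j) = (\<Sum>j<rk0. f j) + (\<Sum>j=rk0..<d. f j)" for f :: "nat \<Rightarrow> real"
      using sum.atLeastLessThan_concat[of 0 rk0 d f] rk0_le by (simp add: atLeast0LessThan)
    note split = this
    \<comment> \<open>The full traces agree, so the excess of the first \<open>rk0\<close> values is
      at most the trace over the remaining \<open>v j\<close>. On these \<open>A\<close> vanishes
      and \<open>X t\<close> acts as \<open>t B\<close>, which makes the excess quadratic in
      \<open>t\<close>.\<close>
    have "0 \<le> (\<Sum>j=rk0..<d. l t j)" by (intro sum_nonneg l_nonneg) simp
    then have "(\<Sum>j<rk0. \<delta> j) \<le> (\<Sum>j=rk0..<d. (norm (X t (v j)))\<^sup>2)"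
      using sum_l_eq[of t] split[of "l t"] split[of "\<lambda>j. (norm (X t (v j)))\<^sup>2"]
      by (simp add: \<delta>_def sum_subtractf v_def)
    also have "\<dots> = (\<Sum>j=rk0..<d. (cmod t)\<^sup>2 * m j)"
    proof (intro sum.cong refl)
      fix j assume j: "j \<in> {rk0..<d}"
      then have "l 0 j = 0" using l0_pos_iff[of j] l_nonneg[of j 0] by force
      then have "A (v j) = 0" using nA[of j] j by simp
      then show "(norm (X t (v j)))\<^sup>2 = (cmod t)\<^sup>2 * m j"
        by (simp add: X_def m_def norm_scaleC power_mult_distrib)
    qed
    also have "\<dots> \<le> (\<Sum>j<d. (cmod t)\<^sup>2 * m j)" by (intro sum_mono2) (auto simp: m_def)
    finally have \<delta>_sum: "(\<Sum>j<rk0. \<delta> j) \<le> (cmod t)\<^sup>2 * (\<Sum>j<d. m j)" by (simp add: sum_distrib_left)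
    have "(\<Sum>j<rk0. y j * \<delta> j) = (\<Sum>k<rk0. (y k - y (Suc k)) * (\<Sum>j\<le>k. \<delta> j)) + y rk0 * (\<Sum>j<rk0. \<delta> j)"
      by (rule sum_by_parts)
    also have "\<dots> \<le> 0 + Y * ((cmod t)\<^sup>2 * (\<Sum>j<d. m j))"
    proof (rule add_mono)
      show "(\<Sum>k<rk0. (y k - y (Suc k)) * (\<Sum>j\<le>k. \<delta> j)) \<le> 0"
        using D y_mono by (intro sum_nonpos mult_nonpos_nonneg) auto
      show "y rk0 * (\<Sum>j<rk0. \<delta> j) \<le> Y * ((cmod t)\<^sup>2 * (\<Sum>j<d. m j))"
        using \<delta>_sum y0[of rk0] by (simp add: y_def mult_left_mono)
    qed
    finally have y\<delta>: "(\<Sum>j<rk0. y j * \<delta> j) \<le> Y * ((cmod t)\<^sup>2 * (\<Sum>j<d. m j))" by simp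
    have "(\<Sum>j<rk0. l t j powr a) \<le> (\<Sum>j<rk0. l 0 j powr a + a * y j * (l t j - l 0 j))"
    proof (rule sum_mono)
      fix j assume "j \<in> {..<rk0}"
      then have j: "j < rk0" "j < d" using rk0_le by auto
      show "l t j powr a \<le> l 0 j powr a + a * y j * (l t j - l 0 j)"
        using powr_tangent_ge[OF l_nonneg[OF j(2), of t] _ a, of "l 0 j"] l0_pos_iff[OF j(2)] j by (simp add: y_def)
    qed
    also have "\<dots> = (\<Sum>j<rk0. l 0 j powr a) + a * (\<Sum>j<rk0. y j * ((norm (X t (v j)))\<^sup>2 - l 0 j)) + a * (\<Sum>j<rk0. y j * \<delta> j)"
      unfolding sum_distrib_left sum.distrib[symmetric] by (intro sum.cong refl) (simp add: \<delta>_def algebra_simps)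
    also have "a * (\<Sum>j<rk0. y j * \<delta> j) \<le> a * (Y * ((cmod t)\<^sup>2 * (\<Sum>j<d. m j)))"
      using y\<delta> a by (intro mult_left_mono) auto
    finally show ?thesis by (simp add: mult.assoc)
  qed
  have "(\<Sum>j<rk0. l t j powr a) + (\<Sum>j<rk0. l (- t) j powr a) \<le> 2 * (\<Sum>j<rk0. l 0 j powr a)
      + (2 * a * (\<Sum>j<rk0. y j * m j) + 2 * a * Y * (\<Sum>j<d. m j)) * (cmod t)\<^sup>2" for t
  proof -
    have "((norm (X t (v j)))\<^sup>2 - l 0 j) + ((norm (X (- t) (v j)))\<^sup>2 - l 0 j) = 2 * m j * (cmod t)\<^sup>2" if "j < d" for j
      unfolding X_def norm_add_scaleC_square nA[OF that] by (simp add: m_def)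
    then have "y j * ((norm (X t (v j)))\<^sup>2 - l 0 j) + y j * ((norm (X (- t) (v j)))\<^sup>2 - l 0 j) = y j * (2 * m j * (cmod t)\<^sup>2)"
      if "j < d" for j using that unfolding distrib_left[symmetric] by simp
    then have "(\<Sum>j<rk0. y j * ((norm (X t (v j)))\<^sup>2 - l 0 j)) + (\<Sum>j<rk0. y j * ((norm (X (- t) (v j)))\<^sup>2 - l 0 j))
        = (\<Sum>j<rk0. y j * (2 * m j * (cmod t)\<^sup>2))"
      unfolding sum.distrib[symmetric] using rk0_le by (intro sum.cong) auto
    also have "\<dots> = 2 * (\<Sum>j<rk0. y j * m j) * (cmod t)\<^sup>2"
      by (simp add: sum_distrib_left sum_distrib_right mult_ac)
    finally have *: "a * (\<Sum>j<rk0. y j * ((norm (X t (v j)))\<^sup>2 - l 0 j)) + a * (\<Sum>j<rk0. y j * ((norm (X (- t) (v j)))\<^sup>2 - l 0 j))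
        = a * (2 * (\<Sum>j<rk0. y j * m j) * (cmod t)\<^sup>2)"
      unfolding distrib_left[symmetric] by simp
    have "(2 * a * V + 2 * a * Y * W) * c = a * (2 * V * c) + 2 * (a * Y * c * W)" for V W c :: real
      by (simp add: algebra_simps)
    note this[of "\<Sum>j<rk0. y j * m j" "\<Sum>j<d. m j" "(cmod t)\<^sup>2"]
    then show ?thesis using half[of t] half[of "- t"] * unfolding norm_minus_cancel by linarith
  qed
  then show ?thesis unfolding a_def by blast
qed

text \<open>Two estimates for the singular values vanishing at \<open>0\<close> collide. The maximum
  principle bounds the sum \<open>T r\<close> of their leading terms by
  \<open>(1 + r) powr p - 1\<close>, which is strictly below \<open>p * r\<close>; averaging over
  \<open>t\<close> and \<open>- t\<close> shows that their first-order coefficients add up to at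
  least \<open>p\<close>. The contradiction is read off at a fixed small \<open>r\<close>, because
  the strict inequality would be lost in the limit.\<close>

lemma schatten_sum_neq_l1:
  assumes p: "0 < p" "p < 1" and N: "\<And>t. cmod t < 1 \<Longrightarrow> schatten_sum p (X t) = (1 + cmod t) powr p"
  shows False
proof -
  have p2: "p < 2" using p by simp
  have N': "(\<Sum>j<d. l t j powr (p / 2)) = (1 + cmod t) powr p" if "cmod t < 1" for t
    using N[OF that] schatten_sum_X by simp
  have split: "(\<Sum>j<n. f j) = (\<Sum>j<rk0. f j) + (\<Sum>j=rk0..<n. f j)" if "rk0 \<le> n" for f :: "nat \<Rightarrow> real" and n
    using sum.atLeastLessThan_concat[of 0 rk0 n f] that by (simp add: atLeast0LessThan)
  have zero: "(\<Sum>j=rk0..<d. l 0 j powr (p / 2)) = 0"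
  proof (rule sum.neutral, rule ballI)
    fix j assume j: "j \<in> {rk0..<d}"
    then have "l 0 j = 0" using l0_pos_iff[of j] l_nonneg[of j 0] by force
    then show "l 0 j powr (p / 2) = 0" by simp
  qed
  then have S0: "(\<Sum>j<rk0. l 0 j powr (p / 2)) = 1" using N'[of 0] split[OF rk0_le] by simp
  define T where "T r = (\<Sum>j=rk0..<rk. \<tau> p j * r powr ex p j)" for r
  have rpos: "\<forall>\<^sub>F r in at_right (0::real). 0 < r \<and> r < 1"
    using eventually_at_right_real[of 0 1] by (simp add: greaterThanLessThan_iff)
  have T_le: "\<forall>\<^sub>F r in at_right 0. T r \<le> (1 + r) powr p - 1"
    using leading_terms_le[OF p(1) p2] rpos
  proof eventually_elim
    case (elim r)
    have "(\<Sum>j<rk. \<tau> p j * r powr ex p j) \<le> (1 + r) powr p"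
    proof (rule field_le_epsilon)
      fix \<epsilon> :: real assume "\<epsilon> > 0"
      then obtain t where t: "cmod t = r" "(\<Sum>j<rk. \<tau> p j * r powr ex p j) - \<epsilon> \<le> (\<Sum>j<rk. l t j powr (p / 2))"
        using elim by blast
      have "(\<Sum>j<rk. l t j powr (p / 2)) \<le> (\<Sum>j<d. l t j powr (p / 2))"
        using rk(1) by (intro sum_mono2) auto
      then show "(\<Sum>j<rk. \<tau> p j * r powr ex p j) \<le> (1 + r) powr p + \<epsilon>" using t N'[of t] elim by simp
    qed
    moreover have "(\<Sum>j<rk0. \<tau> p j * r powr ex p j) = 1"
      using S0 elim by (simp add: \<tau>_below ex_below)
    ultimately show ?case using split[OF rk0_le_rk, of "\<lambda>j. \<tau> p j * r powr ex p j"] by (simp add: T_def)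
  qed
  have T_less: "\<forall>\<^sub>F r in at_right 0. T r < p * r"
    using T_le rpos by eventually_elim (use one_plus_powr_less[OF _ p] in fastforce)
  have T_terms: "0 \<le> \<tau> p j * r powr ex p j" if "j < rk" for j r using \<tau>_pos[OF that, of p] by simp
  \<comment> \<open>A positive term with exponent below \<open>1\<close> would by itself exceed
    \<open>p * r\<close> for small \<open>r\<close>.\<close>
  have ex_ge_1: "1 \<le> ex p j" if j: "j \<in> {rk0..<rk}" for j
  proof (rule ccontr)
    assume "\<not> 1 \<le> ex p j"
    then have "((\<lambda>r::real. p * r powr (1 - ex p j)) \<longlongrightarrow> p * 0) (at_right 0)"
      by (intro tendsto_mult tendsto_const powr_tendsto_0_at_right) simp
    then have "\<forall>\<^sub>F r in at_right 0. p * r powr (1 - ex p j) < \<tau> p j"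
      using \<tau>_pos[of j p] j by (intro order_tendstoD) auto
    then have "\<forall>\<^sub>F r in at_right (0::real). False"
      using T_less rpos
    proof eventually_elim
      case (elim r)
      have "\<tau> p j * r powr ex p j \<le> T r"
        unfolding T_def using j T_terms by (intro member_le_sum) auto
      also have "\<dots> < p * r" by (rule elim)
      also have "\<dots> = p * r powr (1 - ex p j) * r powr ex p j"
        using elim by (simp add: powr_add[symmetric])
      also have "\<dots> \<le> \<tau> p j * r powr ex p j" using elim by (intro mult_right_mono) auto
      finally show False by simp
    qed
    then show False by simp
  qed
  \<comment> \<open>Only terms of exponent exactly \<open>1\<close> survive division by
    \<bar>t\<bar>; those of larger exponent tend to \<open>0\<close>.\<close>
  define \<tau>1 where "\<tau>1 = (\<Sum>j=rk0..<rk. if ex p j = 1 then \<tau> p j else 0)"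
  have norm0: "((\<lambda>t::complex. cmod t) \<longlongrightarrow> 0) (at 0)" using tendsto_norm_zero[OF tendsto_ident_at] .
  have lim_term: "((\<lambda>t. l t j powr (p / 2) / cmod t) \<longlongrightarrow> (if ex p j = 1 then \<tau> p j else 0)) (at 0)"
    if j: "j \<in> {rk0..<rk}" for j
  proof -
    have "((\<lambda>t::complex. cmod t powr (ex p j - 1)) \<longlongrightarrow> (if ex p j = 1 then 1 else 0)) (at 0)"
    proof (cases "ex p j = 1")
      case True
      have "\<forall>\<^sub>F t in at (0::complex). 1 = cmod t powr (ex p j - 1)"
        using eventually_neq_0 by eventually_elim (simp add: True)
      from Lim_transform_eventually[OF tendsto_const this] show ?thesis using True by simp
    next
      case False
      then have "ex p j - 1 > 0" using ex_ge_1[OF j] by simp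
      then show ?thesis using tendsto_powr'[OF norm0 tendsto_const, of "ex p j - 1"] False by simp
    qed
    then have "((\<lambda>t. l t j powr (p / 2) / cmod t powr ex p j * cmod t powr (ex p j - 1)) \<longlongrightarrow>
        \<tau> p j * (if ex p j = 1 then 1 else 0)) (at 0)"
      using j by (intro tendsto_mult singular_value_asymptotic) auto
    moreover have "\<forall>\<^sub>F t in at 0. l t j powr (p / 2) / cmod t powr ex p j * cmod t powr (ex p j - 1) = l t j powr (p / 2) / cmod t"
      using eventually_neq_0 by eventually_elim (simp add: powr_diff)
    ultimately have "((\<lambda>t. l t j powr (p / 2) / cmod t) \<longlongrightarrow> \<tau> p j * (if ex p j = 1 then 1 else 0)) (at 0)"
      by (rule Lim_transform_eventually)
    then show ?thesis by (cases "ex p j = 1") simp_all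
  qed
  define S1 where "S1 t = (\<Sum>j=rk0..<rk. l t j powr (p / 2) / cmod t)" for t
  have S1: "(S1 \<longlongrightarrow> \<tau>1) (at 0)" unfolding S1_def \<tau>1_def by (intro tendsto_sum lim_term)
  have lim_r: "filterlim (\<lambda>r::real. complex_of_real r) (at 0) (at_right 0)"
    unfolding filterlim_at
    using rpos tendsto_of_real[OF tendsto_ident_at[of "0::real" "{0<..}"], where 'a = complex]
    by (auto elim: eventually_mono)
  have lim_mr: "filterlim (\<lambda>r::real. - complex_of_real r) (at 0) (at_right 0)"
    unfolding filterlim_at
    using rpos tendsto_minus[OF tendsto_of_real[OF tendsto_ident_at[of "0::real" "{0<..}"], where 'a = complex]]
    by (auto elim: eventually_mono)
  have limS: "((\<lambda>r::real. S1 (complex_of_real r) + S1 (- complex_of_real r)) \<longlongrightarrow> \<tau>1 + \<tau>1) (at_right 0)"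
    using filterlim_compose[OF S1 lim_r] filterlim_compose[OF S1 lim_mr] by (rule tendsto_add)
  obtain M where M: "\<And>t. (\<Sum>j<rk0. l t j powr (p / 2)) + (\<Sum>j<rk0. l (- t) j powr (p / 2)) \<le> 2 + M * (cmod t)\<^sup>2"
    using large_singular_values_le[OF p(1) p2] S0 by auto
  have lower: "\<forall>\<^sub>F r in at_right 0. 2 * (((1 + r) powr p - 1) / r) - M * r \<le> S1 (complex_of_real r) + S1 (- complex_of_real r)"
    using eventually_compose_filterlim[OF l_eventually_0 lim_r] eventually_compose_filterlim[OF l_eventually_0 lim_mr] rpos
  proof eventually_elim
    case (elim r)
    have S: "S1 t * r = (1 + r) powr p - (\<Sum>j<rk0. l t j powr (p / 2))"
      if t: "cmod t = r" and z: "\<forall>j. rk \<le> j \<longrightarrow> j < d \<longrightarrow> l t j = 0" for t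
    proof -
      have "S1 t * r = (\<Sum>j=rk0..<rk. l t j powr (p / 2))"
        using elim t by (simp add: S1_def sum_distrib_right)
      also have "\<dots> = (\<Sum>j=rk0..<d. l t j powr (p / 2))"
        using z rk(1) by (intro sum.mono_neutral_left) auto
      finally show ?thesis using N'[of t] split[OF rk0_le, of "\<lambda>j. l t j powr (p / 2)"] t elim by simp
    qed
    have r: "r > 0" "cmod (complex_of_real r) = r" "cmod (- complex_of_real r) = r" using elim by auto
    have "2 * ((1 + r) powr p - 1) - M * r\<^sup>2 \<le> (S1 (complex_of_real r) + S1 (- complex_of_real r)) * r"
      using M[of "complex_of_real r"] S[OF r(2)] S[OF r(3)] elim r(2) by (simp add: distrib_right)
    then have "(2 * ((1 + r) powr p - 1) - M * r\<^sup>2) / r \<le> S1 (complex_of_real r) + S1 (- complex_of_real r)"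
      using r(1) by (simp add: divide_le_eq)
    then show ?case using r(1) by (simp add: diff_divide_distrib power2_eq_square)
  qed
  have deriv: "((\<lambda>r::real. ((1 + r) powr p - 1) / r) \<longlongrightarrow> p) (at_right 0)"
  proof -
    have "((\<lambda>x::real. x powr p) has_real_derivative p * 1 powr (p - 1)) (at 1)"
      by (auto intro!: derivative_eq_intros)
    then have "((\<lambda>r::real. ((1 + r) powr p - 1) / r) \<longlongrightarrow> p) (at 0)" by (simp add: DERIV_def)
    then show ?thesis by (rule tendsto_within_subset) simp
  qed
  have lim: "((\<lambda>r::real. 2 * (((1 + r) powr p - 1) / r) - M * r) \<longlongrightarrow> 2 * p - M * 0) (at_right 0)"
    by (intro tendsto_diff tendsto_mult tendsto_const deriv tendsto_ident_at)
  have "2 * p - M * 0 \<le> \<tau>1 + \<tau>1"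
    by (rule tendsto_le[OF _ limS lim lower]) simp
  then have \<tau>1: "p \<le> \<tau>1" by simp
  have "\<forall>\<^sub>F r in at_right (0::real). False"
    using T_less rpos
  proof eventually_elim
    case (elim r)
    have "p * r \<le> \<tau>1 * r" using \<tau>1 elim by (intro mult_right_mono) auto
    also have "\<dots> = (\<Sum>j=rk0..<rk. (if ex p j = 1 then \<tau> p j else 0) * r)"
      by (simp only: \<tau>1_def sum_distrib_right)
    \<comment> \<open>The terms of exponent above \<open>1\<close> are nonnegative and are
      dropped.\<close>
    also have "\<dots> \<le> T r" unfolding T_def using elim T_terms by (intro sum_mono) auto
    also have "\<dots> < p * r" by (rule elim)
    finally show False by simp
  qed
  then show False by simp
qed

end

section \<open>Non-embeddability\<close>

text \<open>\<open>A\<close> and \<open>B\<close> are the images of the two diagonal rank-one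
  operators, and linearity carries \<open>diag_operator e f 1 t\<close> to \<open>A + t B\<close>.
  The disc \<bar>t\<bar> \<open>< 1\<close> keeps the two entries of different modulus.\<close>

lemma embedding_pencil:
  fixes T :: "('h::complex_hilbert \<Rightarrow> 'h) \<Rightarrow> ('k::complex_hilbert \<Rightarrow> 'k)"
  assumes T: "schatten_isometric_embedding q (ereal p) T" and p: "0 < p" and q: "0 < q"
    and ef: "cinner e e = 1" "cinner f f = 1" "cinner e (f::'h) = 0"
  shows "\<exists>A B :: 'k \<Rightarrow> 'k. compact_operator A \<and> compact_operator B \<and> (\<exists>x. B x \<noteq> 0) \<and>
    (\<forall>t. cmod t < 1 \<longrightarrow> (\<lambda>x. A x + scaleC t (B x)) \<in> schatten_class (ereal p) \<and>
      schatten_sum p (\<lambda>x. A x + scaleC t (B x)) = schatten_norm q (diag_operator e f 1 t) powr p)"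
proof -
  let ?D = "diag_operator e f"
  have D: "?D x y \<in> schatten_class q" if "cmod x \<noteq> cmod y" for x y
    by (rule schatten_class_diag_operator[OF ef that])
  have T1: "\<And>X. X \<in> schatten_class q \<Longrightarrow> T X \<in> schatten_class (ereal p)"
    and T2: "\<And>X Y. X \<in> schatten_class q \<Longrightarrow> Y \<in> schatten_class q \<Longrightarrow> T (\<lambda>x. X x + Y x) = (\<lambda>y. T X y + T Y y)"
    and T3: "\<And>c X. X \<in> schatten_class q \<Longrightarrow> T (\<lambda>x. scaleC c (X x)) = (\<lambda>y. scaleC c (T X y))"
    and T4: "\<And>X. X \<in> schatten_class q \<Longrightarrow> schatten_norm (ereal p) (T X) = schatten_norm q X"
    using T unfolding schatten_isometric_embedding_def by blast+
  define A where "A = T (?D 1 0)"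
  define B where "B = T (?D 0 1)"
  have Tt: "T (?D 0 t) = (\<lambda>x. scaleC t (B x))" for t
    unfolding B_def using T3[OF D[of 0 1], of t] diag_operator_scale[OF ef, of t] by simp
  have eq: "T (?D 1 t) = (\<lambda>x. A x + scaleC t (B x))" if t: "cmod t < 1" for t
  \<comment> \<open>For \<open>t = 0\<close> the summand \<open>?D 0 t\<close> has equal entries and
    is not covered by \<open>D\<close>.\<close>
  proof (cases "t = 0")
    case True
    then show ?thesis by (simp add: A_def)
  next
    case False
    have "?D 1 t = (\<lambda>z. ?D 1 0 z + ?D 0 t z)"
      using diag_operator_add_scale[OF ef, of 1 t] diag_operator_scale[OF ef, of t] by simp
    then have "T (?D 1 t) = (\<lambda>y. T (?D 1 0) y + T (?D 0 t) y)"
      using T2[OF D[of 1 0] D[of 0 t]] False by simp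
    then show ?thesis by (simp add: Tt A_def)
  qed
  have cA: "compact_operator A" "compact_operator B"
    using T1[OF D[of 1 0]] T1[OF D[of 0 1]] by (simp_all add: A_def B_def schatten_class_iff)
  have nz: "\<exists>x. B x \<noteq> 0"
  proof (rule ccontr)
    assume "\<not> (\<exists>x. B x \<noteq> 0)"
    \<comment> \<open>If \<open>B\<close> vanished, two operators of norms 2 and 1 would have the
      same image.\<close>
    then have "T (?D 0 2) = T (?D 0 1)" unfolding Tt by auto
    then have "schatten_norm q (?D 0 2) = schatten_norm q (?D 0 1)"
      using T4[OF D[of 0 2]] T4[OF D[of 0 1]] by simp
    moreover have "schatten_norm q (?D 0 y) = cmod y" if "y \<noteq> 0" for y
    proof (cases q)
      case (real q')
      then show ?thesis using that q schatten_norm_diag_operator[OF ef, of 0 y q'] by (simp add: powr_powr)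
    next
      case PInf
      then show ?thesis by (simp add: schatten_norm_infinity_diag_operator[OF ef])
    qed (use q in simp)
    ultimately show False by (metis norm_one norm_numeral numeral_eq_one_iff semiring_norm(85) zero_neq_numeral zero_neq_one)
  qed
  have cls: "(\<lambda>x. A x + scaleC t (B x)) \<in> schatten_class (ereal p)" if "cmod t < 1" for t
    unfolding eq[OF that, symmetric] using that by (intro T1 D) auto
  have sm: "schatten_sum p (\<lambda>x. A x + scaleC t (B x)) = schatten_norm q (?D 1 t) powr p"
    if "cmod t < 1" for t
  proof -
    have "cmod 1 \<noteq> cmod t" using that by auto
    from T4[OF D[OF this]] show ?thesis
      unfolding eq[OF that, symmetric] schatten_sum_eq_norm[OF p] by simp
  qed
  show ?thesis
  proof (rule exI[where x = A], rule exI[where x = B], intro conjI cA nz)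
    show "\<forall>t. cmod t < 1 \<longrightarrow> (\<lambda>x. A x + scaleC t (B x)) \<in> schatten_class (ereal p) \<and>
      schatten_sum p (\<lambda>x. A x + scaleC t (B x)) = schatten_norm q (?D 1 t) powr p"
      using cls sm by simp
  qed
qed

lemma no_embedding_exponent_gt_2:
  fixes T :: "('h::complex_hilbert \<Rightarrow> 'h) \<Rightarrow> ('k::complex_hilbert \<Rightarrow> 'k)"
  assumes ef: "cinner e e = 1" "cinner f f = 1" "cinner e (f::'h) = 0"
    and q: "2 < q" and p: "0 < p" "p < 2"
  shows "\<not> schatten_isometric_embedding q (ereal p) T"
proof
  assume T: "schatten_isometric_embedding q (ereal p) T"
  have q0: "0 < q" using q by (cases q) auto
  from embedding_pencil[OF T p(1) q0 ef] obtain A B :: "'k \<Rightarrow> 'k" and x0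
    where AB: "compact_operator A" "compact_operator B" and x0: "B x0 \<noteq> 0"
    and XN: "\<forall>t. cmod t < 1 \<longrightarrow> (\<lambda>x. A x + scaleC t (B x)) \<in> schatten_class (ereal p) \<and>
      schatten_sum p (\<lambda>x. A x + scaleC t (B x)) = schatten_norm q (diag_operator e f 1 t) powr p"
    by (elim exE conjE)
  from XN have cX: "(\<lambda>x. A x + scaleC t (B x)) \<in> schatten_class (ereal p)"
    and N: "schatten_sum p (\<lambda>x. A x + scaleC t (B x)) = schatten_norm q (diag_operator e f 1 t) powr p"
    if "cmod t < 1" for t using that by simp_all
  have "\<exists>\<kappa>>0. \<forall>r \<epsilon>. 0 < r \<longrightarrow> r < 1 \<longrightarrow> 0 < \<epsilon> \<longrightarrow>
    (\<exists>t. cmod t = r \<and> schatten_sum p A + \<kappa> * r\<^sup>2 - \<epsilon> \<le> schatten_sum p (\<lambda>x. A x + scaleC t (B x)))"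
    by (rule schatten_sum_circle_lower_bound[OF p AB(2) x0 cX])
  then obtain \<kappa> where \<kappa>: "\<kappa> > 0" and main: "\<forall>r \<epsilon>. 0 < r \<longrightarrow> r < 1 \<longrightarrow> 0 < \<epsilon> \<longrightarrow>
    (\<exists>t. cmod t = r \<and> schatten_sum p A + \<kappa> * r\<^sup>2 - \<epsilon> \<le> schatten_sum p (\<lambda>x. A x + scaleC t (B x)))"
    by (elim exE conjE)
  \<comment> \<open>The \<open>p\<close>-th power of the norm of the diagonal operator as a function
    of \<bar>t\<bar>. For \<open>q = \<infinity>\<close> it is constant on the unit disc, so any
    positive growth is already contradictory.\<close>
  define h where "h r = (if q = \<infinity> then 1 else (1 + r powr real_of_ereal q) powr (p / real_of_ereal q))" for r
  have N': "schatten_sum p (\<lambda>x. A x + scaleC t (B x)) = h (cmod t)" if "cmod t < 1" for t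
  proof (cases q)
    case (real q')
    have "cmod 1 \<noteq> cmod t" using that by auto
    from schatten_norm_diag_operator[OF ef this, of q'] show ?thesis
      using real q0 N[OF that] by (simp add: h_def powr_powr)
  next
    case PInf
    then show ?thesis using N[OF that] that by (simp add: h_def schatten_norm_infinity_diag_operator[OF ef])
  qed (use q in simp)
  have h0: "schatten_sum p A = 1" using N'[of 0] q0 by (cases q) (auto simp: h_def)
  have hr: "1 + \<kappa> * r\<^sup>2 \<le> h r" if r: "0 < r" "r < 1" for r
  proof (rule field_le_epsilon)
    fix \<epsilon> :: real assume "\<epsilon> > 0"
    with main r obtain t where "cmod t = r"
      "schatten_sum p A + \<kappa> * r\<^sup>2 - \<epsilon> \<le> schatten_sum p (\<lambda>x. A x + scaleC t (B x))" by blast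
    then show "1 + \<kappa> * r\<^sup>2 \<le> h r + \<epsilon>" using N'[of t] h0 r by simp
  qed
  show False
  proof (cases q)
    case PInf
    then have "\<kappa> * (1 / 2)\<^sup>2 \<le> 0" using hr[of "1/2"] by (simp add: h_def)
    moreover have "0 < \<kappa> * (1 / 2)\<^sup>2" using \<kappa> by simp
    ultimately show False by linarith
  next
    case (real q')
    then have q': "q' > 2" using q by simp
    have "((\<lambda>r::real. p / q' * r powr (q' - 2)) \<longlongrightarrow> p / q' * 0) (at_right 0)"
      by (intro tendsto_mult tendsto_const powr_tendsto_0_at_right) (use q' in simp)
    then have "\<forall>\<^sub>F r in at_right 0. p / q' * r powr (q' - 2) < \<kappa>"
      using \<kappa> by (intro order_tendstoD) auto
    moreover have "\<forall>\<^sub>F r in at_right (0::real). 0 < r \<and> r < 1"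
      using eventually_at_right_real[of 0 1] by (simp add: greaterThanLessThan_iff)
    ultimately have "\<forall>\<^sub>F r in at_right (0::real). False"
    proof eventually_elim
      case (elim r)
      have "1 + \<kappa> * r\<^sup>2 \<le> (1 + r powr q') powr (p / q')" using hr[of r] elim real by (simp add: h_def)
      \<comment> \<open>Since \<open>p < 2 < q'\<close>, the exponent \<open>p / q'\<close> is below
        \<open>1\<close> and the tangent at \<open>1\<close> lies above the power.\<close>
      also have "\<dots> \<le> 1 + p / q' * r powr q'"
        using powr_tangent_ge[of "1 + r powr q'" 1 "p / q'"] p q' by (simp add: add_nonneg_nonneg)
      finally have "\<kappa> * r\<^sup>2 \<le> p / q' * r powr q'" by simp
      also have "\<dots> = p / q' * r powr (q' - 2) * r\<^sup>2" using elim by (simp add: powr_diff)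
      also have "\<dots> < \<kappa> * r\<^sup>2" using elim by (intro mult_strict_right_mono) auto
      finally show False by simp
    qed
    then show False by simp
  qed (use q in simp)
qed

lemma no_embedding_exponent_1:
  fixes T :: "('h::complex_hilbert \<Rightarrow> 'h) \<Rightarrow> ('k::complex_hilbert \<Rightarrow> 'k)"
  assumes ef: "cinner e e = 1" "cinner f f = 1" "cinner e (f::'h) = 0"
    and p: "0 < p" "p < 1"
    and b: "orthonormal d b" "\<And>x::'k. proj d b x = x"
  shows "\<not> schatten_isometric_embedding 1 (ereal p) T"
proof
  assume T: "schatten_isometric_embedding 1 (ereal p) T"
  have "0 < (1::ereal)" by simp
  from embedding_pencil[OF T p(1) this ef] obtain A B :: "'k \<Rightarrow> 'k"
    where AB: "compact_operator A" "compact_operator B"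
    and XN: "\<forall>t. cmod t < 1 \<longrightarrow> (\<lambda>x. A x + scaleC t (B x)) \<in> schatten_class (ereal p) \<and>
      schatten_sum p (\<lambda>x. A x + scaleC t (B x)) = schatten_norm 1 (diag_operator e f 1 t) powr p"
    by (elim exE conjE)
  interpret finite_dim_pencil A B d b by unfold_locales (use AB b in auto)
  have "schatten_sum p (X t) = (1 + cmod t) powr p" if "cmod t < 1" for t
  proof -
    have "cmod 1 \<noteq> cmod t" using that by auto
    from schatten_norm_diag_operator[OF ef this, of 1] show ?thesis
      using XN that by (simp add: X_def[abs_def] one_ereal_def)
  qed
  then show False by (rule schatten_sum_neq_l1[OF p])
qed

section \<open>Orthonormal bases and pairs in the given spaces\<close>

lemma cinner_axis: "cinner (axis i 1 :: complex ^ 'n) (axis j 1) = (if i = j then 1 else 0)"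
  and cinner_axis_right: "cinner x (axis i 1 :: complex ^ 'n) = x $ i"
proof -
  show r: "cinner x (axis i 1 :: complex ^ 'n) = x $ i" for x i
    unfolding cinner_vec_def cinner_complex_def axis_def
    by (simp add: if_distrib[of "\<lambda>z. _ * z"] if_distrib[of cnj] cong: if_cong)
  show "cinner (axis i 1 :: complex ^ 'n) (axis j 1) = (if i = j then 1 else 0)"
    unfolding r by (simp add: axis_def)
qed

lemma complex_vec_basis:
  obtains b :: "nat \<Rightarrow> complex ^ 'n" where "orthonormal CARD('n) b" "\<And>x. proj CARD('n) b x = x"
proof -
  obtain h :: "nat \<Rightarrow> 'n" where h: "bij_betw h {..<CARD('n)} UNIV"
    using ex_bij_betw_nat_finite[of "UNIV :: 'n set"] by (auto simp: atLeast0LessThan)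
  define b :: "nat \<Rightarrow> complex ^ 'n" where "b i = axis (h i) 1" for i
  have "orthonormal CARD('n) b"
    unfolding orthonormal_def b_def cinner_axis using h by (auto simp: bij_betw_def inj_on_def)
  moreover have "proj CARD('n) b x = x" for x
  proof -
    have "proj CARD('n) b x = (\<Sum>i<CARD('n). (\<lambda>k. scaleC (x $ k) (axis k 1)) (h i))"
      by (simp add: proj_def b_def cinner_axis_right)
    also have "\<dots> = (\<Sum>k\<in>UNIV. scaleC (x $ k) (axis k 1))"
      by (rule sum.reindex_bij_betw[OF h])
    also have "\<dots> = x"
    proof (rule iffD2[OF Finite_Cartesian_Product.vec_eq_iff], rule allI)
      fix i
      have "(\<Sum>k\<in>UNIV. scaleC (x $ k) (axis k 1)) $ i = (\<Sum>k\<in>UNIV. x $ k * (if i = k then 1 else 0))"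
        by (simp add: sum_component scaleC_vec_def scaleC_complex_def axis_def)
      also have "\<dots> = (\<Sum>k\<in>UNIV. if k = i then x $ k else 0)" by (intro sum.cong) auto
      also have "\<dots> = x $ i" by simp
      finally show "(\<Sum>k\<in>UNIV. scaleC (x $ k) (axis k 1)) $ i = x $ i" .
    qed
    finally show ?thesis .
  qed
  ultimately show thesis by (rule that)
qed

text \<open>Dimension at least two enters through an independent set of two vectors; Gram-Schmidt
  turns it into an orthonormal pair.\<close>

lemma orthonormal_pair_of_independent:
  fixes B :: "'h::complex_hilbert set"
  assumes B: "complex_vector.independent B" "card B = 2"
  obtains e f :: 'h where "cinner e e = 1" "cinner f f = 1" "cinner e f = 0"
proof -
  obtain u v where uv: "B = {u, v}" "u \<noteq> v" using B(2) card_2_iff by metis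
  have u: "u \<noteq> 0" using B(1) complex_vector.dependent_zero[of B] uv by auto
  define e where "e = scaleC (complex_of_real (1 / norm u)) u"
  have "norm e = 1" using u by (simp add: e_def norm_scaleC norm_divide)
  then have ee: "cinner e e = 1" by (simp add: cinner_self)
  then have o: "orthonormal (Suc 0) (\<lambda>_. e)" by (simp add: orthonormal_def)
  have "proj (Suc 0) (\<lambda>_. e) v \<noteq> v"
  proof
    assume "proj (Suc 0) (\<lambda>_. e) v = v"
    then have v: "v = scaleC (cinner v e * complex_of_real (1 / norm u)) u"
      by (simp add: proj_def e_def scaleC_scaleC)
    have "scaleC (cinner v e * complex_of_real (1 / norm u)) u \<in> complex_vector.span (B - {v})"
      using uv by (intro complex_vector.span_scale complex_vector.span_base) auto
    then have "v \<in> complex_vector.span (B - {v})" using v by simp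
    then show False using B(1) uv unfolding complex_vector.dependent_def by blast
  qed
  from orthonormal_extend_residual[OF o this] obtain f where f: "norm f = 1" "cinner f e = 0" by blast
  have "cinner e f = 0" using f(2) by (subst cinner_commute) simp
  moreover have "cinner f f = 1" using f(1) by (simp add: cinner_self)
  ultimately show thesis using ee that by blast
qed

lemma complex_vec_orthonormal_pair:
  assumes "CARD('m::finite) \<ge> 2"
  obtains e f :: "complex ^ 'm" where "cinner e e = 1" "cinner f f = 1" "cinner e f = 0"
proof -
  have "\<not> (\<forall>i\<in>(UNIV::'m set). \<forall>j\<in>(UNIV::'m set). i = j)"
    using assms card_le_Suc0_iff_eq[of "UNIV::'m set"] by auto
  then obtain i j :: 'm where "i \<noteq> j" by blast
  then show thesis by (intro that[of "axis i 1" "axis j 1"]) (auto simp: cinner_axis)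
qed

theorem corollary5p1:
  assumes "CARD('m::finite) \<ge> 2" and "CARD('n::finite) \<ge> 1"
  shows
    "(\<nexists>T :: (complex^'m \<Rightarrow> complex^'m) \<Rightarrow> (complex^'n \<Rightarrow> complex^'n).
        schatten_isometric_embedding 3 1 T)
   \<and> (\<forall>q p :: real. 2 < q \<and> 0 < p \<and> p < 1 \<longrightarrow>
        (\<nexists>T :: (complex^'m \<Rightarrow> complex^'m) \<Rightarrow> (complex^'n \<Rightarrow> complex^'n).
           schatten_isometric_embedding (ereal q) (ereal p) T))
   \<and> (\<forall>p :: real. 0 < p \<and> p < 1 \<longrightarrow>
        (\<nexists>T :: (complex^'m \<Rightarrow> complex^'m) \<Rightarrow> (complex^'n \<Rightarrow> complex^'n).
           schatten_isometric_embedding 1 (ereal p) T) \<and>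
        (\<nexists>T :: (complex^'m \<Rightarrow> complex^'m) \<Rightarrow> (complex^'n \<Rightarrow> complex^'n).
           schatten_isometric_embedding \<infinity> (ereal p) T))
   \<and> ((\<exists>B :: 'h::complex_hilbert set. complex_vector.independent B \<and> card B = 2) \<longrightarrow>
        (\<forall>(q :: ereal) (p :: real).
           (2 < q \<and> 0 < p \<and> p < 1) \<or> (2 < q \<and> q < 4 \<and> p = 1) \<longrightarrow>
           (\<nexists>T :: ('h \<Rightarrow> 'h) \<Rightarrow> ('k::complex_hilbert \<Rightarrow> 'k).
              schatten_isometric_embedding q (ereal p) T)))"
proof -
  obtain e f :: "complex ^ 'm" where ef: "cinner e e = 1" "cinner f f = 1" "cinner e f = 0"
    using complex_vec_orthonormal_pair[OF assms(1)] by blast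
  obtain b :: "nat \<Rightarrow> complex ^ 'n" where b: "orthonormal CARD('n) b" "\<And>x. proj CARD('n) b x = x"
    using complex_vec_basis by blast
  \<comment> \<open>This settles every finite-dimensional claim except the one on
    \<open>q = 1\<close>; its range \<open>p < 2\<close> includes the pair \<open>q = 3\<close>,
    \<open>p = 1\<close>.\<close>
  note no = no_embedding_exponent_gt_2[OF ef]
  show ?thesis
  proof (intro conjI allI impI notI; (elim exE)?)
    fix T :: "(complex^'m \<Rightarrow> complex^'m) \<Rightarrow> (complex^'n \<Rightarrow> complex^'n)"
    assume "schatten_isometric_embedding 3 1 T"
    then show False using no[of 3 1 T] by (simp add: one_ereal_def)
  next
    fix q p :: real and T :: "(complex^'m \<Rightarrow> complex^'m) \<Rightarrow> (complex^'n \<Rightarrow> complex^'n)"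
    assume "2 < q \<and> 0 < p \<and> p < 1" "schatten_isometric_embedding (ereal q) (ereal p) T"
    then show False using no[of "ereal q" p T] by simp
  next
    fix p :: real and T :: "(complex^'m \<Rightarrow> complex^'m) \<Rightarrow> (complex^'n \<Rightarrow> complex^'n)"
    assume "0 < p \<and> p < 1" "schatten_isometric_embedding 1 (ereal p) T"
    then show False using no_embedding_exponent_1[OF ef _ _ b, of p T] by simp
  next
    fix p :: real and T :: "(complex^'m \<Rightarrow> complex^'m) \<Rightarrow> (complex^'n \<Rightarrow> complex^'n)"
    assume "0 < p \<and> p < 1" "schatten_isometric_embedding \<infinity> (ereal p) T"
    then show False using no[of \<infinity> p T] by simp
  next
    fix q :: ereal and p :: real and B :: "'h set" and T :: "('h \<Rightarrow> 'h) \<Rightarrow> ('k \<Rightarrow> 'k)"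
    assume "complex_vector.independent B \<and> card B = 2"
      and pq: "(2 < q \<and> 0 < p \<and> p < 1) \<or> (2 < q \<and> q < 4 \<and> p = 1)"
      and T: "schatten_isometric_embedding q (ereal p) T"
    then obtain e f :: 'h where ef: "cinner e e = 1" "cinner f f = 1" "cinner e f = 0"
      using orthonormal_pair_of_independent by blast
    show False using no_embedding_exponent_gt_2[OF ef, of q p T] pq T by auto
  qed
qed

end
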